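(* There is an open neighbourhood $U$ of the set of positive $Sp(2)\cdot Sp(1)$-invariant 3-forms on $S^7$, inside the space of positive $Sp(2)\cdot U(1)$-invariant 3-forms on $S^7$, such that the $G_2$-Laplacian $\varphi\mapsto\Delta_\varphi\varphi$ restricted to $U$ is a bijection onto its image.
   Context: $Sp(2)\cdot Sp(1)=(Sp(2)\times Sp(1))/\mathbb{Z}_2$ acts transitively on $S^7\subset\mathbb{H}^2$ by $[(A,q)]\cdot v=Av\bar q$, and $Sp(2)\cdot U(1)=(Sp(2)\times U(1))/\mathbb{Z}_2$ (with $U(1)\subset Sp(1)$ the unit complex numbers) is the subgroup which also acts transitively; hence every $Sp(2)\cdot Sp(1)$-invariant form is $Sp(2)\cdot U(1)$-invariant. The space of positive $Sp(2)\cdot U(1)$-invariant 3-forms is a 4-dimensional manifold (an open subset of the 4-dimensional space of invariant 3-forms). A 3-form $\varphi$ on a 7-dimensional space is positive if there exist a positive definite inner product $g$ and a volume form $\mathrm{dvol}_g$ of $g$ (for one of the two orientations) with $\frac16\iota_X\varphi\wedge\iota_Y\varphi\wedge\varphi=g(X,Y)\mathrm{dvol}_g$; this determines $g_\varphi$ and an orientation. $\Delta_\varphi=*_\varphi d*_\varphi d-d*_\varphi d*_\varphi$ is the Hodge Laplacian on 3-forms for $g_\varphi$ and the induced orientation. *)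

theory Defs
  imports "HOL-Analysis.Analysis"
begin

type_synonym quat = "real \<times> real \<times> real \<times> real"
type_synonym H2 = "quat \<times> quat"

definition qone :: quat where "qone = (1, 0, 0, 0)"

definition qconj :: "quat \<Rightarrow> quat" where
  "qconj q = (case q of (a, b, c, d) \<Rightarrow> (a, -b, -c, -d))"

definition qmul :: "quat \<Rightarrow> quat \<Rightarrow> quat" where
  "qmul q r = (case q of (a1, b1, c1, d1) \<Rightarrow> case r of (a2, b2, c2, d2) \<Rightarrow>
     (a1*a2 - b1*b2 - c1*c2 - d1*d2,
      a1*b2 + b1*a2 + c1*d2 - d1*c2,
      a1*c2 - b1*d2 + c1*a2 + d1*b2,
      a1*d2 + b1*c2 - c1*b2 + d1*a2))"

text \<open>A 2x2 quaternionic matrix ((a,b),(c,d)) is stored as (a,b,c,d).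
  Sp(2): A^* A = I.\<close>
definition Sp2 :: "(quat \<times> quat \<times> quat \<times> quat) set" where
  "Sp2 = {(a, b, c, d).
     qmul (qconj a) a + qmul (qconj c) c = qone \<and>
     qmul (qconj a) b + qmul (qconj c) d = 0 \<and>
     qmul (qconj b) a + qmul (qconj d) c = 0 \<and>
     qmul (qconj b) b + qmul (qconj d) d = qone}"

definition Sp1 :: "quat set" where "Sp1 = {q. norm q = 1}"

definition U1 :: "quat set" where "U1 = {(cos t, sin t, 0, 0) | t. True}"

definition act :: "(quat \<times> quat \<times> quat \<times> quat) \<Rightarrow> quat \<Rightarrow> H2 \<Rightarrow> H2" where
  "act A q v = (case A of (a, b, c, d) \<Rightarrow> case v of (v1, v2) \<Rightarrow>
     (qmul (qmul a v1 + qmul b v2) (qconj q), qmul (qmul c v1 + qmul d v2) (qconj q)))"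

definition G_Sp1 :: "(H2 \<Rightarrow> H2) set" where
  "G_Sp1 = {act A q | A q. A \<in> Sp2 \<and> q \<in> Sp1}"

definition G_U1 :: "(H2 \<Rightarrow> H2) set" where
  "G_U1 = {act A q | A q. A \<in> Sp2 \<and> q \<in> U1}"

abbreviation S7 :: "H2 set" where "S7 \<equiv> sphere 0 1"

definition tangent :: "H2 \<Rightarrow> H2 set" where "tangent p = {v. inner v p = 0}"

definition tproj :: "H2 \<Rightarrow> H2 \<Rightarrow> H2" where "tproj p v = v - (inner v p) *\<^sub>R p"

definition multilin_on :: "H2 set \<Rightarrow> nat \<Rightarrow> (H2 list \<Rightarrow> real) \<Rightarrow> bool" where
  "multilin_on T k f \<longleftrightarrow> (\<forall>vs. length vs = k \<longrightarrow> set vs \<subseteq> T \<longrightarrow>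
     (\<forall>i<k. \<forall>u\<in>T. \<forall>w\<in>T. \<forall>a b::real.
        f (vs[i := a *\<^sub>R u + b *\<^sub>R w]) = a * f (vs[i := u]) + b * f (vs[i := w])))"

definition alternating_on :: "H2 set \<Rightarrow> nat \<Rightarrow> (H2 list \<Rightarrow> real) \<Rightarrow> bool" where
  "alternating_on T k f \<longleftrightarrow> (\<forall>vs. length vs = k \<longrightarrow> set vs \<subseteq> T \<longrightarrow>
     (\<forall>i j. i < j \<longrightarrow> j < k \<longrightarrow> vs ! i = vs ! j \<longrightarrow> f vs = 0))"

text \<open>A k-form on T_p S^7, normalised so that it only depends on tangential parts
  and vanishes on lists of the wrong length (so that it is uniquely determined).\<close>
definition is_form_at :: "H2 \<Rightarrow> nat \<Rightarrow> (H2 list \<Rightarrow> real) \<Rightarrow> bool" where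
  "is_form_at p k f \<longleftrightarrow> (\<forall>vs. length vs \<noteq> k \<longrightarrow> f vs = 0) \<and>
     (\<forall>vs. f vs = f (map (tproj p) vs)) \<and>
     multilin_on (tangent p) k f \<and> alternating_on (tangent p) k f"

text \<open>Wedge product with the standard (determinant) normalisation.\<close>
definition wedge :: "nat \<Rightarrow> nat \<Rightarrow> (H2 list \<Rightarrow> real) \<Rightarrow> (H2 list \<Rightarrow> real) \<Rightarrow> H2 list \<Rightarrow> real" where
  "wedge k l \<alpha> \<beta> vs = (if length vs = k + l then
     (\<Sum>\<sigma>\<in>{\<sigma>. \<sigma> permutes {..<k+l}}.
        of_int (sign \<sigma>) * \<alpha> (take k (map (\<lambda>i. vs ! \<sigma> i) [0..<k+l]))
                        * \<beta> (drop k (map (\<lambda>i. vs ! \<sigma> i) [0..<k+l])))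
     / (fact k * fact l) else 0)"

definition metric_at :: "H2 \<Rightarrow> (H2 \<Rightarrow> H2 \<Rightarrow> real) \<Rightarrow> bool" where
  "metric_at p g \<longleftrightarrow> bilinear g \<and> (\<forall>v w. g v w = g w v) \<and>
     (\<forall>v w. g v w = g (tproj p v) (tproj p w)) \<and>
     (\<forall>v\<in>tangent p. v \<noteq> 0 \<longrightarrow> g v v > 0)"

definition onb :: "H2 \<Rightarrow> (H2 \<Rightarrow> H2 \<Rightarrow> real) \<Rightarrow> (nat \<Rightarrow> H2) \<Rightarrow> bool" where
  "onb p g e \<longleftrightarrow> (\<forall>i<7. e i \<in> tangent p) \<and>
     (\<forall>i<7. \<forall>j<7. g (e i) (e j) = (if i = j then 1 else 0))"

text \<open>vol is a volume form of g (for one of the two orientations).\<close>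
definition volform_at :: "H2 \<Rightarrow> (H2 \<Rightarrow> H2 \<Rightarrow> real) \<Rightarrow> (H2 list \<Rightarrow> real) \<Rightarrow> bool" where
  "volform_at p g vol \<longleftrightarrow> is_form_at p 7 vol \<and>
     (\<forall>e. onb p g e \<longrightarrow> \<bar>vol (map e [0..<7])\<bar> = 1)"

definition pos_at :: "H2 \<Rightarrow> (H2 list \<Rightarrow> real) \<Rightarrow> (H2 \<Rightarrow> H2 \<Rightarrow> real) \<Rightarrow> (H2 list \<Rightarrow> real) \<Rightarrow> bool" where
  "pos_at p \<phi> g vol \<longleftrightarrow> metric_at p g \<and> volform_at p g vol \<and>
     (\<forall>X\<in>tangent p. \<forall>Y\<in>tangent p. \<forall>vs. length vs = 7 \<longrightarrow> set vs \<subseteq> tangent p \<longrightarrow>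
        (1/6) * wedge 4 3 (wedge 2 2 (\<lambda>us. \<phi> (X # us)) (\<lambda>us. \<phi> (Y # us))) \<phi> vs
          = g X Y * vol vs)"

text \<open>Induced inner product on k-forms (independent of the orthonormal basis).\<close>
definition form_inner :: "H2 \<Rightarrow> (H2 \<Rightarrow> H2 \<Rightarrow> real) \<Rightarrow> nat \<Rightarrow> (H2 list \<Rightarrow> real) \<Rightarrow> (H2 list \<Rightarrow> real) \<Rightarrow> real" where
  "form_inner p g k \<gamma> \<beta> = (let e = (SOME e. onb p g e) in
     (\<Sum>is\<in>{is. length is = k \<and> set is \<subseteq> {..<7}}. \<gamma> (map e is) * \<beta> (map e is)) / fact k)"

definition star_at :: "H2 \<Rightarrow> (H2 \<Rightarrow> H2 \<Rightarrow> real) \<Rightarrow> (H2 list \<Rightarrow> real) \<Rightarrow> nat \<Rightarrow> (H2 list \<Rightarrow> real) \<Rightarrow> H2 list \<Rightarrow> real" where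
  "star_at p g vol k \<beta> = (THE \<alpha>. is_form_at p (7 - k) \<alpha> \<and>
     (\<forall>\<gamma>. is_form_at p k \<gamma> \<longrightarrow>
        (\<forall>vs. length vs = 7 \<longrightarrow> wedge k (7 - k) \<gamma> \<alpha> vs = form_inner p g k \<gamma> \<beta> * vol vs)))"

text \<open>A differential k-form on S^7 is represented by omega :: H2 => H2 list => real;
  only the values at points p of S^7 on tangent vectors at p are meaningful.\<close>
type_synonym dform = "H2 \<Rightarrow> H2 list \<Rightarrow> real"

definition is_kform :: "nat \<Rightarrow> dform \<Rightarrow> bool" where
  "is_kform k \<omega> \<longleftrightarrow> (\<forall>p\<in>S7. multilin_on (tangent p) k (\<omega> p) \<and> alternating_on (tangent p) k (\<omega> p))"

definition form_eq :: "nat \<Rightarrow> dform \<Rightarrow> dform \<Rightarrow> bool" where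
  "form_eq k \<omega> \<eta> \<longleftrightarrow> (\<forall>p\<in>S7. \<forall>vs. length vs = k \<longrightarrow> set vs \<subseteq> tangent p \<longrightarrow> \<omega> p vs = \<eta> p vs)"

definition invariant_form :: "(H2 \<Rightarrow> H2) set \<Rightarrow> nat \<Rightarrow> dform \<Rightarrow> bool" where
  "invariant_form G k \<omega> \<longleftrightarrow> (\<forall>g\<in>G. \<forall>p\<in>S7. \<forall>vs. length vs = k \<longrightarrow> set vs \<subseteq> tangent p \<longrightarrow>
     \<omega> (g p) (map g vs) = \<omega> p vs)"

text \<open>Exterior derivative: pull back along the radial projection r(x) = x/|x| to
  R^8 - {0}, apply the usual exterior derivative there, restrict to S^7.\<close>
definition dr :: "H2 \<Rightarrow> H2 \<Rightarrow> H2" where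
  "dr x v = (1 / norm x) *\<^sub>R (v - (inner v x / (norm x)\<^sup>2) *\<^sub>R x)"

definition radial_ext :: "dform \<Rightarrow> dform" where
  "radial_ext \<omega> x vs = \<omega> (x /\<^sub>R norm x) (map (dr x) vs)"

definition dirderiv :: "(H2 \<Rightarrow> real) \<Rightarrow> H2 \<Rightarrow> H2 \<Rightarrow> real" where
  "dirderiv f p v = deriv (\<lambda>t. f (p + t *\<^sub>R v)) 0"

definition extd :: "nat \<Rightarrow> dform \<Rightarrow> dform" where
  "extd k \<omega> p vs = (if length vs = k + 1 then
     (\<Sum>i<k+1. (-1) ^ i * dirderiv (\<lambda>y. radial_ext \<omega> y (take i vs @ drop (Suc i) vs)) p (vs ! i))
     else 0)"

definition positive_form :: "dform \<Rightarrow> bool" where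
  "positive_form \<phi> \<longleftrightarrow> (\<forall>p\<in>S7. \<exists>g vol. pos_at p (\<phi> p) g vol)"

definition g_phi :: "dform \<Rightarrow> H2 \<Rightarrow> H2 \<Rightarrow> H2 \<Rightarrow> real" where
  "g_phi \<phi> p = (THE g. \<exists>vol. pos_at p (\<phi> p) g vol)"

definition vol_phi :: "dform \<Rightarrow> H2 \<Rightarrow> H2 list \<Rightarrow> real" where
  "vol_phi \<phi> p = (THE vol. pos_at p (\<phi> p) (g_phi \<phi> p) vol)"

definition hstar :: "dform \<Rightarrow> nat \<Rightarrow> dform \<Rightarrow> dform" where
  "hstar \<phi> k \<beta> p = (if p \<in> S7 then star_at p (g_phi \<phi> p) (vol_phi \<phi> p) k (\<beta> p) else (\<lambda>vs. 0))"

definition g2_laplacian :: "dform \<Rightarrow> dform" where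
  "g2_laplacian \<phi> p vs =
     hstar \<phi> 4 (extd 3 (hstar \<phi> 4 (extd 3 \<phi>))) p vs
   - extd 2 (hstar \<phi> 5 (extd 4 (hstar \<phi> 3 \<phi>))) p vs"

definition pos_inv_3forms :: "(H2 \<Rightarrow> H2) set \<Rightarrow> dform set" where
  "pos_inv_3forms G = {\<phi>. is_kform 3 \<phi> \<and> invariant_form G 3 \<phi> \<and> positive_form \<phi>}"

text \<open>Sup-distance over unit tangent vectors; for invariant forms this is a norm
  on the finite-dimensional space of invariant 3-forms, so it induces its topology.\<close>
definition form_dist :: "dform \<Rightarrow> dform \<Rightarrow> real" where
  "form_dist \<phi> \<psi> = Sup {\<bar>\<phi> p vs - \<psi> p vs\<bar> | p vs. p \<in> S7 \<and> length vs = 3 \<and>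
     set vs \<subseteq> tangent p \<and> (\<forall>v\<in>set vs. norm v \<le> 1)}"

end

theory Submission
  imports Defs
begin

text \<open>
  By invariance, a \<open>Sp(2)U(1)\<close>-invariant 3-form on the sphere is determined by its value at one point,
  where it is fixed by the isotropy group; this leaves the four-parameter family \<open>Phi a b c e\<close>, in
  which the \<open>Sp(2)Sp(1)\<close>-invariant forms are those with \<open>c = b\<close> and \<open>e = 0\<close>. The contact forms
  \<open>\<eta>\<^sub>1, \<eta>\<^sub>2, \<eta>\<^sub>3\<close> with \<open>d \<eta>\<^sub>i = 2 \<theta>\<^sub>i\<close> make the metric, the Hodge star and the exterior derivative of all
  forms involved explicit, so that the Laplacian becomes a map between coefficient quadruples. Up to
  scaling, this map depends on the three quantities \<open>\<sigma> = a b / (c\<^sup>2 + e\<^sup>2)\<close>, \<open>u = c / b\<close> and \<open>w = e / b\<close>, and the required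
  neighbourhood is \<open>u\<close> close to 1 and \<open>w\<close> close to 0, uniformly in \<open>\<sigma>\<close>. There the ratios of
  coefficients are compared with the mean value theorem along segments.
\<close>

section \<open>Alternating multilinear maps and the wedge product\<close>

text \<open>The forms to be covered are a non-compact family: with c = b and e = 0 the quantity
  \<sigma> takes every positive value. An inverse function theorem at each form would only give
  local injectivity, so every estimate has to hold uniformly in \<sigma>. This is achieved by
  bounding errors by multiples of the polynomials A and C themselves instead of by constants.

  At u = \<rho> = 1 the reduced coefficients are A = 3 \<sigma>^3 + 3 \<sigma>^2 and B = C = 6
  \<sigma>^2 + \<sigma> + 1. Hence ln (A / C) increases in ln \<sigma> with slope bounded below,
  which recovers \<sigma>, while B / (\<rho> C) is constant in \<sigma> and thus sees the other
  directions.

  The parameter w enters A, B and C only through \<rho> = u^2 + w^2. These three equations therefore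
  control everything by the change of w^2, which is second order near w = 0; the last coefficient, w
  times a positive factor, must decide w itself. The tolerance 1/100000 leaves room in the linear
  estimates that close this loop.

  Hodge stars are never computed: a proposed answer is verified on the frame, with parameters chosen
  so that each check is a polynomial identity.\<close>

definition skew :: "nat \<Rightarrow> ('a list \<Rightarrow> real) \<Rightarrow> bool" where
  "skew k f \<longleftrightarrow> (\<forall>xs x y ys. length xs + length ys + 2 = k \<longrightarrow>
     f (xs @ x # y # ys) = - f (xs @ y # x # ys))"

lemma skewD: "skew k f \<Longrightarrow> length xs + length ys + 2 = k \<Longrightarrow> f (xs @ x # y # ys) = - f (xs @ y # x # ys)"
  unfolding skew_def by blast

lemma skew_snoc: "skew (Suc k) f \<Longrightarrow> skew k (\<lambda>us. f (us @ [v]))"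
  unfolding skew_def
proof (intro allI impI)
  fix xs ys :: "'a list" and x y
  assume H: "\<forall>xs x y ys. length xs + length ys + 2 = Suc k \<longrightarrow> f (xs @ x # y # ys) = - f (xs @ y # x # ys)"
    and L: "length xs + length ys + 2 = k"
  show "f ((xs @ x # y # ys) @ [v]) = - f ((xs @ y # x # ys) @ [v])"
    using H[rule_format, of xs "ys @ [v]" x y] L by simp
qed

lemma skew_Cons: "skew (Suc k) f \<Longrightarrow> skew k (\<lambda>us. f (v # us))"
  unfolding skew_def
proof (intro allI impI)
  fix xs ys :: "'a list" and x y
  assume H: "\<forall>xs x y ys. length xs + length ys + 2 = Suc k \<longrightarrow> f (xs @ x # y # ys) = - f (xs @ y # x # ys)"
    and L: "length xs + length ys + 2 = k"
  show "f (v # (xs @ x # y # ys)) = - f (v # (xs @ y # x # ys))"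
    using H[rule_format, of "v # xs" ys x y] L by simp
qed

lemma skew_rotate:
  assumes "skew k f" "length A + length M + length B + 1 = k"
  shows "f (A @ x # M @ B) = (-1) ^ length M * f (A @ M @ x # B)"
  using assms(2)
proof (induction M arbitrary: A)
  case (Cons m M)
  have "f (A @ x # (m # M) @ B) = - f (A @ m # x # M @ B)"
    using skewD[OF assms(1), of A "M @ B" x m] Cons.prems by simp
  also have "f (A @ m # x # M @ B) = (-1) ^ length M * f (A @ m # M @ x # B)"
    using Cons.IH[of "A @ [m]"] Cons.prems by simp
  finally show ?case by simp
qed simp

lemma skew_swap:
  assumes "skew k f" "length A + length M + length B + 2 = k"
  shows "f (A @ x # M @ y # B) = - f (A @ y # M @ x # B)"
proof -
  have 1: "f (A @ x # M @ y # B) = (-1) ^ length (M @ [y]) * f (A @ M @ y # x # B)"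
    using skew_rotate[OF assms(1), of A "M @ [y]" B x] assms(2) by simp
  have 2: "f (A @ y # M @ x # B) = (-1) ^ length M * f (A @ M @ y # x # B)"
    using skew_rotate[OF assms(1), of A M "x # B" y] assms(2) by simp
  show ?thesis using 1 2 by simp
qed

lemma skew_list_update_swap:
  assumes "skew k f" "length vs = k" "i < k" "j < k" "i \<noteq> j"
  shows "f (vs[i := vs ! j, j := vs ! i]) = - f vs"
proof -
  have *: "f (vs[i := vs ! j, j := vs ! i]) = - f vs" if "i < j" "j < k" for i j
  proof -
    have e: "take i vs @ vs ! i # drop (Suc i) (take j vs) @ vs ! j # drop (Suc j) vs = vs" (is "?l = _")
    proof (rule nth_equalityI)
      show "length ?l = length vs" using that assms(2) by simp
    next
      fix m assume "m < length ?l"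
      then show "?l ! m = vs ! m"
        using that assms(2)
        by (cases "m < i"; cases "m = i"; cases "m < j"; cases "m = j") (auto simp: nth_append nth_Cons')
    qed
    have e2: "vs[i := vs ! j, j := vs ! i] =
        take i vs @ vs ! j # drop (Suc i) (take j vs) @ vs ! i # drop (Suc j) vs" (is "?l = ?r")
    proof (rule nth_equalityI)
      show "length ?l = length ?r" using that assms(2) by simp
    next
      fix m assume "m < length ?l"
      then show "?l ! m = ?r ! m"
        using that assms(2)
        by (cases "m < i"; cases "m = i"; cases "m < j"; cases "m = j")
          (auto simp: nth_append nth_Cons' nth_list_update)
    qed
    show ?thesis
      using skew_swap[OF assms(1), of "take i vs" "drop (Suc i) (take j vs)" "drop (Suc j) vs" "vs ! j" "vs ! i"]
        that assms(2) unfolding e2 e by simp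
  qed
  show ?thesis
  proof (cases "i < j")
    case False
    then have "j < i" using assms by simp
    then show ?thesis using *[of j i] assms by (metis list_update_swap)
  qed (use * assms in auto)
qed

lemma skew_repeat:
  assumes "skew k f" "length vs = k" "i < k" "j < k" "i \<noteq> j" "vs ! i = vs ! j"
  shows "f vs = 0"
proof -
  have "vs[i := vs ! j, j := vs ! i] = vs"
    using assms(6) list_update_id[of vs i] list_update_id[of vs j] by simp
  then show ?thesis using skew_list_update_swap[OF assms(1-5)] by simp
qed

lemma skew_permutes:
  assumes "skew k f" "length vs = k" "\<sigma> permutes {..<k}"
  shows "f (map (\<lambda>i. vs ! \<sigma> i) [0..<k]) = of_int (sign \<sigma>) * f vs"
proof -
  have "finite {..<k}" by simp
  then show ?thesis using assms(3)
  proof (induction rule: permutes_rev_induct)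
    case id
    then show ?case using assms(2) map_nth[of vs] by simp
  next
    case (swap a b p)
    let ?w = "map (\<lambda>i. vs ! p i) [0..<k]"
    have "map (\<lambda>i. vs ! (p \<circ> Transposition.transpose a b) i) [0..<k] = ?w[a := ?w ! b, b := ?w ! a]"
      using swap.hyps
      by (intro nth_equalityI) (auto simp: nth_list_update Transposition.transpose_def)
    then have "f (map (\<lambda>i. vs ! (p \<circ> Transposition.transpose a b) i) [0..<k]) = - f ?w"
      using skew_list_update_swap[OF assms(1), of ?w a b] swap.hyps by simp
    moreover have "sign (p \<circ> Transposition.transpose a b) = - sign p"
      using swap.hyps by (subst sign_compose)
        (auto simp: sign_swap_id permutation_swap_id intro: permutes_imp_permutation[of "{..<k}"])
    ultimately show ?case using swap.IH by (simp add: o_def)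
  qed
qed

text \<open>The number \<open>c\<close> is the sign of the rearrangement, so one value serves every
  antisymmetric \<open>f\<close> and every prefix \<open>A\<close>. This lets two forms be compared
  on the same shuffled index list, where the signs cancel because c * c = 1.\<close>

lemma mset_eq_imp_skew_sign:
  assumes "mset xs = mset ys"
  shows "\<exists>c::real. c * c = 1 \<and>
    (\<forall>f A. skew (length A + length ys) f \<longrightarrow> f (A @ map E xs) = c * f (A @ map E ys))"
  using assms
proof (induction xs arbitrary: ys)
  case Nil
  then show ?case by (intro exI[of _ 1]) simp
next
  case (Cons x xs)
  then have "x \<in> set ys" by (metis list.set_intros(1) set_mset_mset)
  then obtain y1 y2 where ys: "ys = y1 @ x # y2" by (meson split_list)
  then have "mset xs = mset (y1 @ y2)" using Cons.prems by simp
  from Cons.IH[OF this] obtain c :: real where c: "c * c = 1"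
    "\<And>f A. skew (length A + length (y1 @ y2)) f \<Longrightarrow> f (A @ map E xs) = c * f (A @ map E (y1 @ y2))"
    by blast
  have "f (A @ map E (x # xs)) = (c * (-1) ^ length y1) * f (A @ map E ys)"
    if "skew (length A + length ys) f" for f A
  proof -
    have "f (A @ map E (x # xs)) = c * f (A @ E x # map E (y1 @ y2))"
      using c(2)[of "A @ [E x]" f] that ys by simp
    also have "f (A @ E x # map E (y1 @ y2)) = (-1) ^ length y1 * f (A @ map E ys)"
      using skew_rotate[OF that, of A "map E y1" "map E y2" "E x"] ys by simp
    finally show ?thesis by simp
  qed
  moreover have "(c * (-1) ^ length y1) * (c * (-1) ^ length y1) = 1"
    using c(1) by (simp add: power_mult_distrib[symmetric] algebra_simps flip: power2_eq_square power_mult)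
  ultimately show ?case by blast
qed

section \<open>Contraction of a wedge product with its last vector\<close>

text \<open>Coset decomposition according to the slot \<open>b\<close> that receives the last index
  \<open>m\<close>. The detour through inverses puts the transposition on the right, where it acts
  on slots and not on values.\<close>

lemma sum_permutes_lessThan_Suc:
  "(\<Sum>p | p permutes {..<Suc m}. f p) =
   (\<Sum>b<Suc m. \<Sum>q | q permutes {..<m}. f (q \<circ> Transposition.transpose m b))"
proof -
  have "(\<Sum>p | p permutes {..<Suc m}. f p) = (\<Sum>p | p permutes {..<Suc m}. f (inv p))"
    by (rule sum_permutations_inverse)
  also have "\<dots> = (\<Sum>b<Suc m. \<Sum>q | q permutes {..<m}. f (inv (Transposition.transpose m b \<circ> q)))"
    using sum_over_permutations_insert[of "{..<m}" m "\<lambda>p. f (inv p)"] by (simp add: lessThan_Suc)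
  also have "\<dots> = (\<Sum>b<Suc m. \<Sum>q | q permutes {..<m}. f (inv q \<circ> Transposition.transpose m b))"
    by (intro sum.cong refl arg_cong[where f=f]) (simp add: o_inv_distrib permutes_bij)
  also have "\<dots> = (\<Sum>b<Suc m. \<Sum>q | q permutes {..<m}. f (q \<circ> Transposition.transpose m b))"
    by (rule sum.cong[OF refl]) (rule sum_permutations_inverse[symmetric])
  finally show ?thesis .
qed

lemma sign_comp_transpose:
  assumes "q permutes {..<m::nat}"
  shows "sign (q \<circ> Transposition.transpose a b) = (if a = b then sign q else - sign q)"
  using assms by (subst sign_compose)
    (auto simp: sign_swap_id permutation_swap_id intro: permutes_imp_permutation[of "{..<m}"])

definition perm_list :: "'a list \<Rightarrow> (nat \<Rightarrow> nat) \<Rightarrow> 'a list" where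
  "perm_list vs q = map (\<lambda>i. vs ! q i) [0..<length vs]"

lemma length_perm_list [simp]: "length (perm_list vs q) = length vs"
  by (simp add: perm_list_def)

lemma perm_list_transpose:
  assumes "a < length vs" "b < length vs"
  shows "perm_list vs (q \<circ> Transposition.transpose a b) =
    (perm_list vs q)[a := perm_list vs q ! b, b := perm_list vs q ! a]"
  using assms
  by (intro nth_equalityI) (auto simp: perm_list_def nth_list_update Transposition.transpose_def)

lemma perm_list_snoc:
  assumes "q permutes {..<length vs}"
  shows "perm_list (vs @ [v]) q = perm_list vs q @ [v]"
proof -
  have "q (length vs) = length vs" "\<And>i. i < length vs \<Longrightarrow> q i < length vs"
    using assms permutes_in_image[OF assms] by (auto simp: permutes_def)
  then show ?thesis by (intro nth_equalityI) (auto simp: perm_list_def nth_append less_Suc_eq)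
qed

lemma wedge_perm_list:
  "length vs = k + l \<Longrightarrow> wedge k l \<alpha> \<beta> vs =
    (\<Sum>\<sigma> | \<sigma> permutes {..<length vs}. of_int (sign \<sigma>) * \<alpha> (take k (perm_list vs \<sigma>)) * \<beta> (drop k (perm_list vs \<sigma>)))
     / (fact k * fact l)"
  by (simp add: wedge_def perm_list_def)

text \<open>The sum runs over all permutations, so reindexing it by the adjacent transposition
  produces the sign, whatever the factors are.\<close>

lemma skew_wedge: "skew (k + l) (wedge k l \<alpha> \<beta>)"
  unfolding skew_def
proof (intro allI impI)
  fix xs ys :: "H2 list" and x y
  assume L: "length xs + length ys + 2 = k + l"
  let ?v = "xs @ x # y # ys" and ?w = "xs @ y # x # ys" and ?n = "length xs"
  let ?t = "Transposition.transpose ?n (Suc ?n)"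
  have t: "?t permutes {..<k+l}" using L by (intro permutes_swap_id) auto
  have nth: "?w ! (?t i) = ?v ! i" for i
    by (auto simp: Transposition.transpose_def nth_append nth_Cons' )
  have pl: "perm_list ?w (?t \<circ> \<sigma>) = perm_list ?v \<sigma>" for \<sigma>
    by (simp add: perm_list_def nth)
  have "(\<Sum>\<sigma> | \<sigma> permutes {..<k+l}. of_int (sign \<sigma>) * \<alpha> (take k (perm_list ?w \<sigma>)) * \<beta> (drop k (perm_list ?w \<sigma>)))
    = (\<Sum>\<sigma> | \<sigma> permutes {..<k+l}. of_int (sign (?t \<circ> \<sigma>)) * \<alpha> (take k (perm_list ?w (?t \<circ> \<sigma>))) * \<beta> (drop k (perm_list ?w (?t \<circ> \<sigma>))))"
    by (rule setum_permutations_compose_left[OF t])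
  also have "\<dots> = (\<Sum>\<sigma> | \<sigma> permutes {..<k+l}. - (of_int (sign \<sigma>) * \<alpha> (take k (perm_list ?v \<sigma>)) * \<beta> (drop k (perm_list ?v \<sigma>))))"
    by (intro sum.cong refl)
      (auto simp: pl sign_compose sign_swap_id permutation_swap_id permutes_imp_permutation[of "{..<k+l}"])
  finally show "wedge k l \<alpha> \<beta> ?v = - wedge k l \<alpha> \<beta> ?w"
    using L by (simp add: wedge_perm_list sum_negf)
qed

definition wsum :: "nat \<Rightarrow> (H2 list \<Rightarrow> real) \<Rightarrow> (H2 list \<Rightarrow> real) \<Rightarrow> H2 list \<Rightarrow> real" where
  "wsum k \<alpha> \<beta> vs = (\<Sum>\<sigma> | \<sigma> permutes {..<length vs}.
     of_int (sign \<sigma>) * \<alpha> (take k (perm_list vs \<sigma>)) * \<beta> (drop k (perm_list vs \<sigma>)))"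

lemma perm_list_snoc_transpose:
  assumes "q permutes {..<length vs}" "b < length vs"
  shows "perm_list (vs @ [v]) (q \<circ> Transposition.transpose (length vs) b) =
    (perm_list vs q)[b := v] @ [perm_list vs q ! b]"
  using assms by (simp add: perm_list_transpose perm_list_snoc nth_append list_update_append)

text \<open>Here \<open>v\<close> lands in slot \<open>b\<close> of the \<beta>-block. Exchanging it
  with the displaced entry at the end costs one sign, which cancels the sign of the transposition in
  \<tau>.\<close>

lemma wsum_snoc_right:
  assumes \<beta>: "skew (Suc l) \<beta>" and L: "length vs = k + l" and b: "k \<le> b" "b \<le> length vs"
    and q: "q permutes {..<length vs}"
  defines "\<tau> \<equiv> q \<circ> Transposition.transpose (length vs) b"
  shows "of_int (sign \<tau>) * \<alpha> (take k (perm_list (vs @ [v]) \<tau>)) * \<beta> (drop k (perm_list (vs @ [v]) \<tau>))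
     = of_int (sign q) * \<alpha> (take k (perm_list vs q)) * \<beta> (drop k (perm_list vs q) @ [v])"
proof (cases "b = length vs")
  case True
  then show ?thesis using L by (simp add: \<tau>_def perm_list_snoc[OF q])
next
  case False
  let ?Q = "perm_list vs q"
  have b': "b < length vs" using b False by simp
  have e: "drop k (?Q[b := v] @ [?Q ! b]) =
     (drop k ?Q @ [v])[b - k := (drop k ?Q @ [v]) ! l, l := (drop k ?Q @ [v]) ! (b - k)]"
    using b' b(1) L by (intro nth_equalityI)
      (auto simp: nth_append nth_list_update)
  have "\<beta> (drop k (?Q[b := v] @ [?Q ! b])) = - \<beta> (drop k ?Q @ [v])"
    unfolding e by (rule skew_list_update_swap[OF \<beta>]) (use L b b' in auto)
  moreover have "take k (?Q[b := v] @ [?Q ! b]) = take k ?Q"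
    using b b' L by simp
  ultimately show ?thesis
    using b' q by (simp add: \<tau>_def perm_list_snoc_transpose sign_comp_transpose[OF q])
qed

text \<open>Here \<open>v\<close> lands in the \<alpha>-block and the displaced entry goes to the
  end of the \<beta>-block. Reindexing by the transposition of \<open>b\<close> and \<open>k\<close>
  brings \<open>v\<close> to the last \<alpha>-slot. Moving the displaced entry to the front of the
  \<beta>-block takes l - 1 swaps, which together with the sign of the transposition gives
  (-1)^l.\<close>

lemma wsum_snoc_left:
  assumes \<alpha>: "skew (Suc k) \<alpha>" and \<beta>: "skew l \<beta>" and L: "length vs = k + l" and l: "l > 0" and b: "b \<le> k"
  shows "(\<Sum>q | q permutes {..<length vs}.
     of_int (sign (q \<circ> Transposition.transpose (length vs) b))
      * \<alpha> (take (Suc k) (perm_list (vs @ [v]) (q \<circ> Transposition.transpose (length vs) b)))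
      * \<beta> (drop (Suc k) (perm_list (vs @ [v]) (q \<circ> Transposition.transpose (length vs) b))))
     = (-1) ^ l * wsum k (\<lambda>us. \<alpha> (us @ [v])) \<beta> vs"
proof -
  define t where "t q = - of_int (sign q) * \<alpha> ((take (Suc k) (perm_list vs q))[b := v])
     * \<beta> (drop (Suc k) (perm_list vs q) @ [perm_list vs q ! b])" for q
  define t' where "t' q = (-1) ^ l * (of_int (sign q) * \<alpha> (take k (perm_list vs q) @ [v])
     * \<beta> (drop k (perm_list vs q)))" for q
  have b': "b < length vs" using b L l by simp
  have rot: "\<beta> (drop (Suc k) Q @ [Q ! k]) = - ((-1) ^ l * \<beta> (drop k Q))" if "length Q = k + l" for Q
  proof -
    have "drop k Q = Q ! k # drop (Suc k) Q" using that l by (simp add: Cons_nth_drop_Suc)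
    moreover have "\<beta> ([] @ Q ! k # drop (Suc k) Q @ []) =
        (-1) ^ length (drop (Suc k) Q) * \<beta> ([] @ drop (Suc k) Q @ Q ! k # [])"
      by (rule skew_rotate[OF \<beta>]) (use that l in auto)
    moreover obtain l' where "l = Suc l'" using l by (cases l) auto
    ultimately show ?thesis using that by simp
  qed
  have tt: "t (q \<circ> Transposition.transpose b k) = t' q" if q: "q permutes {..<length vs}" for q
  proof (cases "b = k")
    case True
    let ?Q = "perm_list vs q"
    have "(take (Suc k) ?Q)[k := v] = take k ?Q @ [v]"
      using L l by (simp add: take_Suc_conv_app_nth list_update_append)
    then show ?thesis using True rot[of ?Q] L by (simp add: t_def t'_def algebra_simps)
  next
    case False
    then have bk: "b < k" using b by simp
    let ?Q = "perm_list vs q"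
    let ?R = "perm_list vs (q \<circ> Transposition.transpose b k)"
    let ?A = "take k ?Q @ [v]"
    have R: "?R = ?Q[b := ?Q ! k, k := ?Q ! b]"
      using b' L l by (intro perm_list_transpose) auto
    have e: "(take (Suc k) ?R)[b := v] = ?A[b := ?A ! k, k := ?A ! b]"
      unfolding R using bk L l by (intro nth_equalityI) (auto simp: nth_append nth_list_update less_Suc_eq)
    have "\<alpha> ((take (Suc k) ?R)[b := v]) = - \<alpha> ?A"
      unfolding e by (rule skew_list_update_swap[OF \<alpha>]) (use bk L l in auto)
    moreover have "drop (Suc k) ?R @ [?R ! b] = drop (Suc k) ?Q @ [?Q ! k]"
      unfolding R using bk L l by simp
    ultimately show ?thesis
      using False rot[of ?Q] L sign_comp_transpose[OF q, of b k] by (simp add: t_def t'_def algebra_simps)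
  qed
  have "of_int (sign (q \<circ> Transposition.transpose (length vs) b))
      * \<alpha> (take (Suc k) (perm_list (vs @ [v]) (q \<circ> Transposition.transpose (length vs) b)))
      * \<beta> (drop (Suc k) (perm_list (vs @ [v]) (q \<circ> Transposition.transpose (length vs) b))) = t q"
    if q: "q permutes {..<length vs}" for q
  proof -
    let ?Q = "perm_list vs q"
    have "take (Suc k) (?Q[b := v] @ [?Q ! b]) = (take (Suc k) ?Q)[b := v]"
      using L l by (simp add: take_update_swap)
    moreover have "drop (Suc k) (?Q[b := v] @ [?Q ! b]) = drop (Suc k) ?Q @ [?Q ! b]"
      using L l b by simp
    ultimately show ?thesis
      using b' q by (simp add: t_def perm_list_snoc_transpose sign_comp_transpose[OF q])
  qed
  then have "?thesis \<longleftrightarrow> (\<Sum>q | q permutes {..<length vs}. t q) = (-1) ^ l * wsum k (\<lambda>us. \<alpha> (us @ [v])) \<beta> vs"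
    by simp
  also have "(\<Sum>q | q permutes {..<length vs}. t q) =
      (\<Sum>q | q permutes {..<length vs}. t (q \<circ> Transposition.transpose b k))"
    by (rule sum_permutations_compose_right) (use b' L l b in \<open>auto intro!: permutes_swap_id\<close>)
  also have "\<dots> = (\<Sum>q | q permutes {..<length vs}. t' q)"
    using tt by simp
  also have "\<dots> = (-1) ^ l * wsum k (\<lambda>us. \<alpha> (us @ [v])) \<beta> vs"
    by (simp add: t'_def wsum_def sum_distrib_left)
  finally show ?thesis by (simp add: o_def)
qed

text \<open>For l = 0 there is no \<beta>-slot to take the displaced entry; it stays inside
  \<alpha>, and a plain swap replaces the rotation.\<close>

lemma wsum_snoc_left0:
  assumes \<alpha>: "skew (Suc k) \<alpha>" and L: "length vs = k" and b: "b \<le> k"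
  shows "(\<Sum>q | q permutes {..<length vs}.
     of_int (sign (q \<circ> Transposition.transpose (length vs) b))
      * \<alpha> (take (Suc k) (perm_list (vs @ [v]) (q \<circ> Transposition.transpose (length vs) b)))
      * \<beta> (drop (Suc k) (perm_list (vs @ [v]) (q \<circ> Transposition.transpose (length vs) b))))
     = wsum k (\<lambda>us. \<alpha> (us @ [v])) \<beta> vs"
  unfolding wsum_def
proof (rule sum.cong[OF refl])
  fix q assume "q \<in> {q. q permutes {..<length vs}}"
  then have q: "q permutes {..<k}" using L by simp
  let ?\<tau> = "q \<circ> Transposition.transpose k b" and ?Q = "perm_list vs q"
  have "of_int (sign ?\<tau>) * \<alpha> (perm_list (vs @ [v]) ?\<tau>) = of_int (sign q) * \<alpha> (?Q @ [v])"
  proof (cases "b = k")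
    case True
    then show ?thesis using perm_list_snoc[of q vs v] q L by simp
  next
    case False
    then have b': "b < length vs" using b L by simp
    have e: "?Q[b := v] @ [?Q ! b] = (?Q @ [v])[b := (?Q @ [v]) ! k, k := (?Q @ [v]) ! b]"
      using b' L by (simp add: nth_append list_update_append)
    have "\<alpha> (?Q[b := v] @ [?Q ! b]) = - \<alpha> (?Q @ [v])"
      unfolding e by (rule skew_list_update_swap[OF \<alpha>]) (use b' L in auto)
    then show ?thesis
      using perm_list_snoc_transpose[of q vs b v] b' q L sign_comp_transpose[OF q, of k b] False by simp
  qed
  then show "of_int (sign (q \<circ> Transposition.transpose (length vs) b))
      * \<alpha> (take (Suc k) (perm_list (vs @ [v]) (q \<circ> Transposition.transpose (length vs) b)))
      * \<beta> (drop (Suc k) (perm_list (vs @ [v]) (q \<circ> Transposition.transpose (length vs) b)))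
      = of_int (sign q) * \<alpha> (take k (perm_list vs q) @ [v]) * \<beta> (drop k (perm_list vs q))"
    using L by simp
qed

text \<open>The k + l slots available to \<open>v\<close> split into the two blocks, and all slots
  of one block contribute equally; this is the origin of the factors k and l.\<close>

lemma wsum_snoc:
  assumes \<alpha>: "skew k \<alpha>" and \<beta>: "skew l \<beta>" and L: "Suc (length vs) = k + l"
  shows "wsum k \<alpha> \<beta> (vs @ [v]) =
     (case l of 0 \<Rightarrow> 0 | Suc l' \<Rightarrow> real l * wsum k \<alpha> (\<lambda>us. \<beta> (us @ [v])) vs)
   + (case k of 0 \<Rightarrow> 0 | Suc k' \<Rightarrow> real k * (-1) ^ l * wsum k' (\<lambda>us. \<alpha> (us @ [v])) \<beta> vs)"
proof -
  let ?m = "length vs"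
  let ?S = "\<lambda>b. \<Sum>q | q permutes {..<?m}. of_int (sign (q \<circ> Transposition.transpose ?m b))
      * \<alpha> (take k (perm_list (vs @ [v]) (q \<circ> Transposition.transpose ?m b)))
      * \<beta> (drop k (perm_list (vs @ [v]) (q \<circ> Transposition.transpose ?m b)))"
  have "wsum k \<alpha> \<beta> (vs @ [v]) = (\<Sum>b<Suc ?m. ?S b)"
    unfolding wsum_def using sum_permutes_lessThan_Suc[of "\<lambda>\<sigma>. of_int (sign \<sigma>) * \<alpha> (take k (perm_list (vs @ [v]) \<sigma>)) * \<beta> (drop k (perm_list (vs @ [v]) \<sigma>))" ?m]
    by simp
  also have "\<dots> = (\<Sum>b\<in>{..<k} \<union> {k..<k+l}. ?S b)"
    using L by (intro sum.cong) auto
  also have "\<dots> = (\<Sum>b<k. ?S b) + (\<Sum>b\<in>{k..<k+l}. ?S b)"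
    by (rule sum.union_disjoint) auto
  also have "(\<Sum>b\<in>{k..<k+l}. ?S b) = (case l of 0 \<Rightarrow> 0 | Suc l' \<Rightarrow> real l * wsum k \<alpha> (\<lambda>us. \<beta> (us @ [v])) vs)"
  proof (cases l)
    case (Suc l')
    have "?S b = wsum k \<alpha> (\<lambda>us. \<beta> (us @ [v])) vs" if "b \<in> {k..<k+l}" for b
      unfolding wsum_def using that Suc L \<beta>
      by (intro sum.cong refl) (rule wsum_snoc_right[of l'], auto)
    then show ?thesis using Suc by simp
  qed simp
  also have "(\<Sum>b<k. ?S b) = (case k of 0 \<Rightarrow> 0 | Suc k' \<Rightarrow> real k * (-1) ^ l * wsum k' (\<lambda>us. \<alpha> (us @ [v])) \<beta> vs)"
  proof (cases k)
    case (Suc k')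
    have "?S b = (-1) ^ l * wsum k' (\<lambda>us. \<alpha> (us @ [v])) \<beta> vs" if "b < k" for b
    proof (cases "l = 0")
      case True
      then show ?thesis using wsum_snoc_left0[of k' \<alpha> vs b v \<beta>] Suc \<alpha> L that by simp
    next
      case False
      then show ?thesis using wsum_snoc_left[of k' \<alpha> l \<beta> vs b v] Suc \<alpha> \<beta> L that by simp
    qed
    then show ?thesis using Suc by simp
  qed simp
  finally show ?thesis by simp
qed

lemma wedge_wsum: "length vs = k + l \<Longrightarrow> wedge k l \<alpha> \<beta> vs = wsum k \<alpha> \<beta> vs / (fact k * fact l)"
  by (simp add: wedge_perm_list wsum_def)

lemma wedge_Nil [simp]: "wedge 0 0 \<alpha> \<beta> [] = \<alpha> [] * \<beta> []"
  by (simp add: wedge_def)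

lemma wedge_0_snoc:
  assumes "skew (Suc l) \<beta>" "length vs = l"
  shows "wedge 0 (Suc l) \<alpha> \<beta> (vs @ [v]) = wedge 0 l \<alpha> (\<lambda>us. \<beta> (us @ [v])) vs"
proof -
  have "skew 0 \<alpha>" by (simp add: skew_def)
  from wsum_snoc[OF this assms(1), of vs v] assms(2)
  have "wsum 0 \<alpha> \<beta> (vs @ [v]) = real (Suc l) * wsum 0 \<alpha> (\<lambda>us. \<beta> (us @ [v])) vs"
    by (simp del: of_nat_Suc)
  then show ?thesis using assms(2)
    by (subst (1 2) wedge_wsum) (simp_all del: of_nat_Suc)
qed

lemma wedge_snoc_0:
  assumes "skew (Suc k) \<alpha>" "length vs = k"
  shows "wedge (Suc k) 0 \<alpha> \<beta> (vs @ [v]) = wedge k 0 (\<lambda>us. \<alpha> (us @ [v])) \<beta> vs"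
proof -
  have "skew 0 \<beta>" by (simp add: skew_def)
  from wsum_snoc[OF assms(1) this, of vs v] assms(2)
  have "wsum (Suc k) \<alpha> \<beta> (vs @ [v]) = real (Suc k) * wsum k (\<lambda>us. \<alpha> (us @ [v])) \<beta> vs"
    by (simp del: of_nat_Suc)
  then show ?thesis using assms(2)
    by (subst (1 2) wedge_wsum) (simp_all del: of_nat_Suc)
qed

text \<open>Leibniz rule for contraction in the last slot: the factors k + 1 and l + 1 from
  \<open>wsum_snoc\<close> are absorbed by the factorials of the determinant normalisation.\<close>

lemma wedge_snoc:
  assumes "skew (Suc k) \<alpha>" "skew (Suc l) \<beta>" "length vs = Suc (k + l)"
  shows "wedge (Suc k) (Suc l) \<alpha> \<beta> (vs @ [v]) =
    wedge (Suc k) l \<alpha> (\<lambda>us. \<beta> (us @ [v])) vs - (-1) ^ l * wedge k (Suc l) (\<lambda>us. \<alpha> (us @ [v])) \<beta> vs"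
proof -
  let ?x = "wsum (Suc k) \<alpha> (\<lambda>us. \<beta> (us @ [v])) vs" and ?y = "wsum k (\<lambda>us. \<alpha> (us @ [v])) \<beta> vs"
  have 1: "wsum (Suc k) \<alpha> \<beta> (vs @ [v]) = real (Suc l) * ?x - real (Suc k) * ((-1) ^ l * ?y)"
    using wsum_snoc[OF assms(1,2), of vs v] assms(3) by (simp del: of_nat_Suc)
  have "wedge (Suc k) (Suc l) \<alpha> \<beta> (vs @ [v]) = wsum (Suc k) \<alpha> \<beta> (vs @ [v]) / (fact (Suc k) * fact (Suc l))"
    using assms(3) by (intro wedge_wsum) simp
  also have "\<dots> = real (Suc l) * ?x / (fact (Suc k) * fact (Suc l)) - real (Suc k) * ((-1) ^ l * ?y) / (fact (Suc k) * fact (Suc l))"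
    unfolding 1 by (rule diff_divide_distrib)
  also have "real (Suc l) * ?x / (fact (Suc k) * fact (Suc l)) = ?x / (fact (Suc k) * fact l)"
    by (simp add: fact_Suc[of l] del: of_nat_Suc fact_Suc)
  also have "real (Suc k) * ((-1) ^ l * ?y) / (fact (Suc k) * fact (Suc l)) = (-1) ^ l * (?y / (fact k * fact (Suc l)))"
    by (simp add: fact_Suc[of k] del: of_nat_Suc fact_Suc)
  also have "?x / (fact (Suc k) * fact l) = wedge (Suc k) l \<alpha> (\<lambda>us. \<beta> (us @ [v])) vs"
    using assms(3) by (intro wedge_wsum[symmetric]) simp
  also have "?y / (fact k * fact (Suc l)) = wedge k (Suc l) (\<lambda>us. \<alpha> (us @ [v])) \<beta> vs"
    using assms(3) by (intro wedge_wsum[symmetric]) simp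
  finally show ?thesis .
qed

section \<open>Multilinearity on the ambient space and forms on a tangent space\<close>

text \<open>Linearity is asked on all of \<open>H2\<close>. A normalised form factors through
  \<open>tproj\<close> and therefore satisfies it, and computations are spared the tangency side
  conditions of \<open>multilin_on\<close>.\<close>

definition mlin :: "nat \<Rightarrow> (H2 list \<Rightarrow> real) \<Rightarrow> bool" where
  "mlin k f \<longleftrightarrow> (\<forall>xs u w ys a b. length xs + length ys + 1 = k \<longrightarrow>
     f (xs @ (a *\<^sub>R u + b *\<^sub>R w) # ys) = a * f (xs @ u # ys) + b * f (xs @ w # ys))"

lemma mlinD: "mlin k f \<Longrightarrow> length xs + length ys + 1 = k \<Longrightarrow>
    f (xs @ (a *\<^sub>R u + b *\<^sub>R w) # ys) = a * f (xs @ u # ys) + b * f (xs @ w # ys)"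
  unfolding mlin_def by blast

lemma mlin_scale: "mlin k f \<Longrightarrow> length xs + length ys + 1 = k \<Longrightarrow> f (xs @ (a *\<^sub>R u) # ys) = a * f (xs @ u # ys)"
  using mlinD[of k f xs ys a u 0 0] by simp

lemma mlin_zero: "mlin k f \<Longrightarrow> length xs + length ys + 1 = k \<Longrightarrow> f (xs @ 0 # ys) = 0"
  using mlinD[of k f xs ys 0 0 0 0] by simp

lemma mlin_sum:
  assumes "mlin k f" "length xs + length ys + 1 = k" "finite I"
  shows "f (xs @ (\<Sum>i\<in>I. c i *\<^sub>R e i) # ys) = (\<Sum>i\<in>I. c i * f (xs @ e i # ys))"
  using assms(3)
proof (induction rule: finite_induct)
  case empty
  then show ?case using mlin_zero[OF assms(1,2)] by simp
next
  case (insert x F)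
  then show ?case using mlinD[OF assms(1,2), of "c x" "e x" 1 "\<Sum>i\<in>F. c i *\<^sub>R e i"] by simp
qed

lemma tproj_in_tangent: "p \<in> S7 \<Longrightarrow> tproj p v \<in> tangent p"
  by (simp add: tproj_def tangent_def inner_diff_left dot_square_norm)

lemma zero_in_tangent: "0 \<in> tangent p"
  by (simp add: tangent_def)

lemma tproj_tangent: "v \<in> tangent p \<Longrightarrow> tproj p v = v"
  by (simp add: tproj_def tangent_def)

lemma tproj_idem: "p \<in> S7 \<Longrightarrow> tproj p (tproj p v) = tproj p v"
  by (intro tproj_tangent tproj_in_tangent)

lemma tproj_lin: "tproj p (a *\<^sub>R u + b *\<^sub>R w) = a *\<^sub>R tproj p u + b *\<^sub>R tproj p w"
  by (simp add: tproj_def inner_add_left algebra_simps)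

lemma map_tproj_tangent: "set vs \<subseteq> tangent p \<Longrightarrow> map (tproj p) vs = vs"
  by (induction vs) (auto simp: tproj_tangent)

lemma is_form_at_len: "is_form_at p k f \<Longrightarrow> length vs \<noteq> k \<Longrightarrow> f vs = 0"
  unfolding is_form_at_def by blast

lemma is_form_at_tproj: "is_form_at p k f \<Longrightarrow> f (map (tproj p) vs) = f vs"
  unfolding is_form_at_def by metis

lemma is_form_at_mlin:
  assumes "p \<in> S7" "is_form_at p k f"
  shows "mlin k f"
  unfolding mlin_def
proof (intro allI impI)
  fix xs ys :: "H2 list" and u w :: H2 and a b :: real
  assume L: "length xs + length ys + 1 = k"
  have m: "multilin_on (tangent p) k f" using assms unfolding is_form_at_def by blast
  let ?X = "map (tproj p) xs" and ?Y = "map (tproj p) ys"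
  have "f (?X @ (a *\<^sub>R tproj p u + b *\<^sub>R tproj p w) # ?Y) = a * f (?X @ tproj p u # ?Y) + b * f (?X @ tproj p w # ?Y)"
    using m[unfolded multilin_on_def, rule_format, of "?X @ 0 # ?Y" "length xs" "tproj p u" "tproj p w" a b]
      L tproj_in_tangent[OF assms(1)] zero_in_tangent by (simp add: image_subset_iff list_update_append)
  then show "f (xs @ (a *\<^sub>R u + b *\<^sub>R w) # ys) = a * f (xs @ u # ys) + b * f (xs @ w # ys)"
    using is_form_at_tproj[OF assms(2), of "xs @ (a *\<^sub>R u + b *\<^sub>R w) # ys"]
      is_form_at_tproj[OF assms(2), of "xs @ u # ys"] is_form_at_tproj[OF assms(2), of "xs @ w # ys"]
    by (simp add: tproj_lin)
qed

lemma is_form_at_skew: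
  assumes "p \<in> S7" "is_form_at p k f"
  shows "skew k f"
  unfolding skew_def
proof (intro allI impI)
  fix xs ys :: "H2 list" and x y :: H2
  assume L: "length xs + length ys + 2 = k"
  have al: "alternating_on (tangent p) k f" using assms unfolding is_form_at_def by blast
  have z: "f (xs @ v # v # ys) = 0" for v
  proof -
    let ?vs = "map (tproj p) (xs @ v # v # ys)"
    have "f ?vs = 0"
      using al[unfolded alternating_on_def, rule_format, of ?vs "length xs" "Suc (length xs)"]
        L tproj_in_tangent[OF assms(1)] by (simp add: nth_append image_subset_iff)
    then show ?thesis using is_form_at_tproj[OF assms(2), of "xs @ v # v # ys"] by simp
  qed
  note m = is_form_at_mlin[OF assms]
  have a1: "f (xs @ (x + y) # v # ys) = f (xs @ x # v # ys) + f (xs @ y # v # ys)" for v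
    using mlinD[OF m, of xs "v # ys" 1 x 1 y] L by simp
  have a2: "f (xs @ v # (x + y) # ys) = f (xs @ v # x # ys) + f (xs @ v # y # ys)" for v
    using mlinD[OF m, of "xs @ [v]" ys 1 x 1 y] L by simp
  show "f (xs @ x # y # ys) = - f (xs @ y # x # ys)"
    using z[of "x + y"] z[of x] z[of y] by (simp add: a1 a2)
qed

lemma is_form_atI:
  assumes "skew k f" "mlin k f" "\<And>vs. length vs \<noteq> k \<Longrightarrow> f vs = 0" "\<And>vs. f vs = f (map (tproj p) vs)"
  shows "is_form_at p k f"
  unfolding is_form_at_def multilin_on_def alternating_on_def
proof (intro conjI allI impI ballI)
  fix vs :: "H2 list" assume "length vs \<noteq> k" then show "f vs = 0" by fact
next
  fix vs :: "H2 list" show "f vs = f (map (tproj p) vs)" by fact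
next
  fix vs :: "H2 list" and i u w and a b :: real
  assume "length vs = k" "i < k"
  then have e: "vs[i := x] = take i vs @ x # drop (Suc i) vs" for x
    by (simp add: upd_conv_take_nth_drop)
  show "f (vs[i := a *\<^sub>R u + b *\<^sub>R w]) = a * f (vs[i := u]) + b * f (vs[i := w])"
    unfolding e by (rule mlinD[OF assms(2)]) (use \<open>length vs = k\<close> \<open>i < k\<close> in auto)
next
  fix vs :: "H2 list" and i j assume "length vs = k" "i < j" "j < k" "vs ! i = vs ! j"
  then show "f vs = 0" using skew_repeat[OF assms(1), of vs i j] by auto
qed

text \<open>The representative of a form that satisfies the normalisation built into \<^const>\<open>is_form_at\<close>.\<close>

definition nrm :: "H2 \<Rightarrow> nat \<Rightarrow> (H2 list \<Rightarrow> real) \<Rightarrow> H2 list \<Rightarrow> real" where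
  "nrm p k f vs = (if length vs = k then f (map (tproj p) vs) else 0)"

lemma nrm_tangent: "length vs = k \<Longrightarrow> set vs \<subseteq> tangent p \<Longrightarrow> nrm p k f vs = f vs"
  by (simp add: nrm_def map_tproj_tangent)

lemma is_form_at_nrm:
  assumes p: "p \<in> S7" and "multilin_on (tangent p) k f" "alternating_on (tangent p) k f"
  shows "is_form_at p k (nrm p k f)"
proof -
  have "multilin_on (tangent p) k (nrm p k f)"
    unfolding multilin_on_def
  proof (intro allI impI ballI)
    fix vs :: "H2 list" and i u w and a b :: real
    assume v: "length vs = k" "set vs \<subseteq> tangent p" "i < k" "u \<in> tangent p" "w \<in> tangent p"
    have "a *\<^sub>R u + b *\<^sub>R w \<in> tangent p" using v by (simp add: tangent_def inner_add_left)
    then have "nrm p k f (vs[i := x]) = f (vs[i := x])" if "x \<in> {u, w, a *\<^sub>R u + b *\<^sub>R w}" for x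
      using v that by (intro nrm_tangent) (auto dest!: set_update_subset_insert[THEN subsetD])
    then show "nrm p k f (vs[i := a *\<^sub>R u + b *\<^sub>R w]) = a * nrm p k f (vs[i := u]) + b * nrm p k f (vs[i := w])"
      using assms(2) v unfolding multilin_on_def by simp
  qed
  moreover have "alternating_on (tangent p) k (nrm p k f)"
    using assms(3) unfolding alternating_on_def by (auto simp: nrm_tangent)
  moreover have "nrm p k f vs = nrm p k f (map (tproj p) vs)" for vs
    using p by (simp add: nrm_def o_def tproj_idem)
  moreover have "nrm p k f vs = 0" if "length vs \<noteq> k" for vs using that by (simp add: nrm_def)
  ultimately show ?thesis unfolding is_form_at_def by blast
qed

lemma perm_list_update:
  assumes "\<sigma> permutes {..<length vs}" "j < length vs"
  shows "perm_list (vs[j := z]) \<sigma> = (perm_list vs \<sigma>)[inv \<sigma> j := z]"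
proof -
  have 1: "inv \<sigma> j = i \<longleftrightarrow> \<sigma> i = j" for i using assms(1) by (metis permutes_inverses)
  have 2: "\<sigma> i < length vs" if "i < length vs" for i
    using permutes_in_image[OF assms(1), of i] that by simp
  have 3: "inv \<sigma> j < length vs"
    using permutes_in_image[OF permutes_inv[OF assms(1)], of j] assms(2) by simp
  show ?thesis
    using assms(2) 2 3 by (intro nth_equalityI) (auto simp: perm_list_def nth_list_update 1)
qed

lemma mlin_update:
  assumes "mlin k f" "length vs = k" "i < k"
  shows "f (vs[i := a *\<^sub>R u + b *\<^sub>R w]) = a * f (vs[i := u]) + b * f (vs[i := w])"
  using mlinD[OF assms(1), of "take i vs" "drop (Suc i) vs" a u b w] assms(2,3)
  by (simp add: upd_conv_take_nth_drop)

lemma mlin_wedge: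
  assumes "mlin k \<alpha>" "mlin l \<beta>"
  shows "mlin (k + l) (wedge k l \<alpha> \<beta>)"
  unfolding mlin_def
proof (intro allI impI)
  fix xs ys :: "H2 list" and u w :: H2 and a b :: real
  assume L: "length xs + length ys + 1 = k + l"
  define vs where "vs = xs @ 0 # ys"
  let ?n = "length xs"
  have len: "length vs = k + l" "?n < k + l" using L by (auto simp: vs_def)
  have e: "xs @ z # ys = vs[?n := z]" for z by (simp add: vs_def)
  define t where "t \<sigma> z = of_int (sign \<sigma>) * \<alpha> (take k (perm_list (vs[?n := z]) \<sigma>)) * \<beta> (drop k (perm_list (vs[?n := z]) \<sigma>))" for \<sigma> z
  have "t \<sigma> (a *\<^sub>R u + b *\<^sub>R w) = a * t \<sigma> u + b * t \<sigma> w" if s: "\<sigma> permutes {..<k+l}" for \<sigma>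
  proof -
    define Q where "Q = perm_list vs \<sigma>"
    define j where "j = inv \<sigma> ?n"
    have "j < k + l" using permutes_in_image[OF permutes_inv[OF s], of ?n] len by (simp add: j_def)
    have lq: "length Q = k + l" using len by (simp add: Q_def)
    have pl: "perm_list (vs[?n := z]) \<sigma> = Q[j := z]" for z
      unfolding Q_def j_def using s len by (intro perm_list_update) auto
    show ?thesis
    proof (cases "j < k")
      case True
      then have "take k (Q[j := z]) = (take k Q)[j := z]" "drop k (Q[j := z]) = drop k Q" for z
        by (simp_all add: take_update_swap)
      then show ?thesis
        using mlin_update[OF assms(1), of "take k Q" j a u b w] True lq
        by (simp add: t_def pl algebra_simps)
    next
      case False
      then have "drop k (Q[j := z]) = (drop k Q)[j - k := z]" "take k (Q[j := z]) = take k Q" for z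
        by (simp_all add: drop_update_swap)
      then show ?thesis
        using mlin_update[OF assms(2), of "drop k Q" "j - k" a u b w] False lq \<open>j < k + l\<close>
        by (simp add: t_def pl algebra_simps)
    qed
  qed
  then have "(\<Sum>\<sigma> | \<sigma> permutes {..<k+l}. t \<sigma> (a *\<^sub>R u + b *\<^sub>R w)) =
      a * (\<Sum>\<sigma> | \<sigma> permutes {..<k+l}. t \<sigma> u) + b * (\<Sum>\<sigma> | \<sigma> permutes {..<k+l}. t \<sigma> w)"
    by (simp add: sum.distrib sum_distrib_left)
  moreover have "wedge k l \<alpha> \<beta> (xs @ z # ys) = (\<Sum>\<sigma> | \<sigma> permutes {..<k+l}. t \<sigma> z) / (fact k * fact l)" for z
    unfolding e t_def using len by (subst wedge_perm_list) auto
  ultimately show "wedge k l \<alpha> \<beta> (xs @ (a *\<^sub>R u + b *\<^sub>R w) # ys) =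
      a * wedge k l \<alpha> \<beta> (xs @ u # ys) + b * wedge k l \<alpha> \<beta> (xs @ w # ys)"
    by (simp add: add_divide_distrib)
qed

lemma perm_list_map:
  assumes "\<sigma> permutes {..<length vs}"
  shows "perm_list (map h vs) \<sigma> = map h (perm_list vs \<sigma>)"
proof -
  have "\<sigma> i < length vs" if "i < length vs" for i
    using permutes_in_image[OF assms, of i] that by simp
  then show ?thesis by (simp add: perm_list_def)
qed

text \<open>A wedge evaluates its factors only on lists drawn from its own arguments, so forms that
  agree on tangent vectors have the same wedge there.\<close>

lemma wedge_cong_set:
  assumes "\<And>us. length us = k \<Longrightarrow> set us \<subseteq> set vs \<Longrightarrow> \<alpha> us = \<alpha>' us"
    "\<And>us. length us = l \<Longrightarrow> set us \<subseteq> set vs \<Longrightarrow> \<beta> us = \<beta>' us"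
  shows "wedge k l \<alpha> \<beta> vs = wedge k l \<alpha>' \<beta>' vs"
proof (cases "length vs = k + l")
  case True
  have "\<alpha> (take k (perm_list vs \<sigma>)) = \<alpha>' (take k (perm_list vs \<sigma>)) \<and> \<beta> (drop k (perm_list vs \<sigma>)) = \<beta>' (drop k (perm_list vs \<sigma>))"
    if "\<sigma> permutes {..<length vs}" for \<sigma>
  proof -
    have "set (perm_list vs \<sigma>) \<subseteq> set vs"
    proof
      fix v assume "v \<in> set (perm_list vs \<sigma>)"
      then obtain i where "i < length vs" "v = vs ! \<sigma> i" by (auto simp: perm_list_def)
      then show "v \<in> set vs" using permutes_in_image[OF that, of i] by simp
    qed
    then show ?thesis using True
      by (intro conjI assms) (auto dest!: in_set_takeD in_set_dropD)
  qed
  then show ?thesis unfolding wedge_perm_list[OF True] by simp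
qed (simp add: wedge_def)

lemma is_form_at_wedge:
  assumes p: "p \<in> S7" and "is_form_at p k \<alpha>" "is_form_at p l \<beta>"
  shows "is_form_at p (k + l) (wedge k l \<alpha> \<beta>)"
proof (rule is_form_atI)
  show "skew (k + l) (wedge k l \<alpha> \<beta>)" by (rule skew_wedge)
  show "mlin (k + l) (wedge k l \<alpha> \<beta>)" using assms by (intro mlin_wedge is_form_at_mlin)
  show "wedge k l \<alpha> \<beta> vs = 0" if "length vs \<noteq> k + l" for vs using that by (simp add: wedge_def)
  show "wedge k l \<alpha> \<beta> vs = wedge k l \<alpha> \<beta> (map (tproj p) vs)" for vs
  proof (cases "length vs = k + l")
    case True
    have 1: "\<alpha> (take k (map (tproj p) xs)) = \<alpha> (take k xs)" "\<beta> (drop k (map (tproj p) xs)) = \<beta> (drop k xs)" for xs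
      using is_form_at_tproj[OF assms(2)] is_form_at_tproj[OF assms(3)] by (simp_all add: take_map drop_map)
    have 2: "\<And>\<sigma>. \<sigma> permutes {..<k + l} \<Longrightarrow> perm_list (map (tproj p) vs) \<sigma> = map (tproj p) (perm_list vs \<sigma>)"
      using True by (simp add: perm_list_map)
    show ?thesis using True by (simp add: wedge_perm_list 2 1)
  qed (simp add: wedge_def)
qed

section \<open>Shuffle expansion and the Hodge star\<close>

fun incs :: "nat \<Rightarrow> 'a list \<Rightarrow> 'a list list" where
  "incs 0 xs = [[]]"
| "incs (Suc k) [] = []"
| "incs (Suc k) (x # xs) = map ((#) x) (incs k xs) @ incs (Suc k) xs"

lemma incs_complete:
  fixes xs js :: "nat list"
  assumes "sorted_wrt (<) js" "set js \<subseteq> set xs" "sorted_wrt (<) xs" "length js = k"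
  shows "js \<in> set (incs k xs)"
  using assms
proof (induction xs arbitrary: js k)
  case (Cons x xs)
  show ?case
  proof (cases js)
    case (Cons j js')
    obtain k' where k: "k = Suc k'" using Cons.prems(4) Cons by (cases k) auto
    show ?thesis
    proof (cases "j = x")
      case True
      have "set js' \<subseteq> set xs" using Cons.prems(1,2) Cons True by auto
      then have "js' \<in> set (incs k' xs)" using Cons.IH[of js' k'] Cons.prems Cons k by auto
      then show ?thesis using Cons True k by simp
    next
      case False
      then have "x < j" using Cons.prems Cons by auto
      then have "\<forall>y\<in>set js. x < y" using Cons.prems(1) Cons by auto
      then have "set js \<subseteq> set xs" using Cons.prems(2) by auto
      then have "js \<in> set (incs k xs)" using Cons.IH[of js k] Cons.prems by auto
      then show ?thesis using k by simp
    qed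
  qed (use Cons.prems in auto)
qed auto

text \<open>The signed shuffles of a list given in reverse order: the recursion peels off the last
  vector, which is the direction in which the Leibniz rule for contractions is stated.\<close>

fun shuf :: "nat \<Rightarrow> nat \<Rightarrow> 'a list \<Rightarrow> (real \<times> 'a list \<times> 'a list) list" where
  "shuf 0 0 [] = [(1, [], [])]"
| "shuf 0 (Suc l) (x # xs) = map (\<lambda>(s, I, J). (s, I, J @ [x])) (shuf 0 l xs)"
| "shuf (Suc k) 0 (x # xs) = map (\<lambda>(s, I, J). (s, I @ [x], J)) (shuf k 0 xs)"
| "shuf (Suc k) (Suc l) (x # xs) = map (\<lambda>(s, I, J). (s, I, J @ [x])) (shuf (Suc k) l xs)
     @ map (\<lambda>(s, I, J). (- ((-1) ^ l) * s, I @ [x], J)) (shuf k (Suc l) xs)"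
| "shuf k l xs = []"

text \<open>Iterating the Leibniz rule replaces the sum over all permutations by one over shuffles:
  at most 35 terms in dimension 7, few enough to be enumerated by \<open>simp\<close>.\<close>

lemma wedge_shuf:
  assumes "skew k \<alpha>" "skew l \<beta>" "length xs = k + l"
  shows "wedge k l \<alpha> \<beta> (map E (rev xs)) = (\<Sum>(s, I, J)\<leftarrow>shuf k l xs. s * \<alpha> (map E I) * \<beta> (map E J))"
  using assms
proof (induction k l xs arbitrary: \<alpha> \<beta> rule: shuf.induct)
  case (2 l x xs)
  have "wedge 0 (Suc l) \<alpha> \<beta> (map E (rev xs) @ [E x]) = wedge 0 l \<alpha> (\<lambda>us. \<beta> (us @ [E x])) (map E (rev xs))"
    using 2 by (intro wedge_0_snoc) auto
  also have "\<dots> = (\<Sum>(s, I, J)\<leftarrow>shuf 0 l xs. s * \<alpha> (map E I) * \<beta> (map E J @ [E x]))"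
    using 2 by (intro 2 skew_snoc) auto
  finally show ?case by (simp add: o_def case_prod_unfold)
next
  case (3 k x xs)
  have "wedge (Suc k) 0 \<alpha> \<beta> (map E (rev xs) @ [E x]) = wedge k 0 (\<lambda>us. \<alpha> (us @ [E x])) \<beta> (map E (rev xs))"
    using 3 by (intro wedge_snoc_0) auto
  also have "\<dots> = (\<Sum>(s, I, J)\<leftarrow>shuf k 0 xs. s * \<alpha> (map E I @ [E x]) * \<beta> (map E J))"
    using 3 by (intro 3 skew_snoc) auto
  finally show ?case by (simp add: o_def case_prod_unfold)
next
  case (4 k l x xs)
  have "wedge (Suc k) (Suc l) \<alpha> \<beta> (map E (rev xs) @ [E x]) =
     wedge (Suc k) l \<alpha> (\<lambda>us. \<beta> (us @ [E x])) (map E (rev xs))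
      - (-1) ^ l * wedge k (Suc l) (\<lambda>us. \<alpha> (us @ [E x])) \<beta> (map E (rev xs))"
    using 4 by (intro wedge_snoc) auto
  also have "wedge (Suc k) l \<alpha> (\<lambda>us. \<beta> (us @ [E x])) (map E (rev xs))
     = (\<Sum>(s, I, J)\<leftarrow>shuf (Suc k) l xs. s * \<alpha> (map E I) * \<beta> (map E J @ [E x]))"
    using 4 by (intro 4 skew_snoc) auto
  also have "wedge k (Suc l) (\<lambda>us. \<alpha> (us @ [E x])) \<beta> (map E (rev xs))
     = (\<Sum>(s, I, J)\<leftarrow>shuf k (Suc l) xs. s * \<alpha> (map E I @ [E x]) * \<beta> (map E J))"
    using 4 by (intro 4 skew_snoc) auto
  finally show ?case
    by (simp add: o_def case_prod_unfold sum_list_const_mult[symmetric] mult.assoc uminus_sum_list_map)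
qed auto

text \<open>Abstracts the summand F(I) H(I) / G(I) of an inner product of two forms: in a swap the
  signs of both factors cancel, and a repeated index gives zero.\<close>

definition ssym :: "('a list \<Rightarrow> real) \<Rightarrow> bool" where
  "ssym f \<longleftrightarrow> (\<forall>as x zs. f (as @ x # x # zs) = 0) \<and> (\<forall>as x y zs. f (as @ x # y # zs) = f (as @ y # x # zs))"

lemma ssym_Cons: "ssym f \<Longrightarrow> ssym (\<lambda>is. f (x # is))"
  unfolding ssym_def by (metis append_Cons)

lemma ssymD: "ssym f \<Longrightarrow> f (x # x # zs) = 0" "ssym f \<Longrightarrow> f (x # y # zs) = f (y # x # zs)"
  unfolding ssym_def by (metis append_Nil)+

abbreviation lists_of :: "nat \<Rightarrow> 'a set \<Rightarrow> 'a list set" where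
  "lists_of k X \<equiv> {is. length is = k \<and> set is \<subseteq> X}"

lemma sum_lists_Suc:
  "(\<Sum>is\<in>lists_of (Suc k) X. f is) = (\<Sum>y\<in>X. \<Sum>is\<in>lists_of k X. f (y # is))"
proof -
  have "lists_of (Suc k) X = (\<lambda>(y, is). y # is) ` (X \<times> lists_of k X)"
    by (auto simp: length_Suc_conv image_iff)
  moreover have "inj_on (\<lambda>(y, is). y # is) (X \<times> lists_of k X)" by (auto simp: inj_on_def)
  ultimately have "(\<Sum>is\<in>lists_of (Suc k) X. f is) = (\<Sum>(y, is)\<in>X \<times> lists_of k X. f (y # is))"
    by (simp add: sum.reindex case_prod_unfold)
  then show ?thesis by (simp add: sum.cartesian_product)
qed

text \<open>A list containing \<open>x\<close> twice contributes nothing, so each new list has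
  \<open>x\<close> in exactly one of k + 1 positions, and symmetry moves it to the front.\<close>

lemma sum_lists_insert:
  assumes "ssym f" "finite X" "x \<notin> X"
  shows "(\<Sum>is\<in>lists_of (Suc k) (insert x X). f is) =
    (\<Sum>is\<in>lists_of (Suc k) X. f is) + real (Suc k) * (\<Sum>is\<in>lists_of k X. f (x # is))"
  using assms(1)
proof (induction k arbitrary: f)
  case 0
  have "lists_of 0 Y = {[]}" for Y :: "'a set" by auto
  then show ?case using assms by (simp add: sum_lists_Suc)
next
  case (Suc k)
  note s = ssym_Cons[OF Suc.prems]
  have "(\<Sum>is\<in>lists_of (Suc (Suc k)) (insert x X). f is) =
     (\<Sum>y\<in>insert x X. (\<Sum>is\<in>lists_of (Suc k) X. f (y # is)) + real (Suc k) * (\<Sum>is\<in>lists_of k X. f (y # x # is)))"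
    using Suc.IH[OF s] by (subst sum_lists_Suc) simp
  also have "\<dots> = (\<Sum>is\<in>lists_of (Suc k) X. f (x # is)) + (\<Sum>is\<in>lists_of (Suc (Suc k)) X. f is)
      + real (Suc k) * (\<Sum>y\<in>X. \<Sum>is\<in>lists_of k X. f (y # x # is))"
    using assms(2,3) ssymD(1)[OF Suc.prems]
    by (simp add: sum.distrib sum_distrib_left sum_lists_Suc[where k = "Suc k" and X = X and f = f])
  also have "(\<Sum>y\<in>X. \<Sum>is\<in>lists_of k X. f (y # x # is)) = (\<Sum>is\<in>lists_of (Suc k) X. f (x # is))"
    by (subst sum_lists_Suc) (intro sum.cong refl ssymD(2)[OF Suc.prems])
  finally show ?case by (simp add: algebra_simps)
qed

text \<open>The factor \<open>fact k\<close> counts the orderings of an increasing list; it cancels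
  the one in \<open>form_inner\<close>.\<close>

lemma sum_lists_incs:
  assumes "ssym f" "distinct xs"
  shows "(\<Sum>is\<in>lists_of k (set xs). f is) = fact k * sum_list (map f (incs k xs))"
  using assms
proof (induction xs arbitrary: k f)
  case Nil
  show ?case
  proof (cases k)
    case 0
    have "lists_of 0 (set ([] :: 'a list)) = {[]}" by auto
    then show ?thesis using 0 by simp
  qed (auto intro!: sum.neutral)
next
  case (Cons x xs)
  show ?case
  proof (cases k)
    case 0
    have "lists_of 0 (set (x # xs)) = {[]}" by auto
    then show ?thesis using 0 by simp
  next
    case (Suc k')
    have "(\<Sum>is\<in>lists_of (Suc k') (insert x (set xs)). f is) =
      (\<Sum>is\<in>lists_of (Suc k') (set xs). f is) + real (Suc k') * (\<Sum>is\<in>lists_of k' (set xs). f (x # is))"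
      by (rule sum_lists_insert) (use Cons.prems in auto)
    also have "(\<Sum>is\<in>lists_of (Suc k') (set xs). f is) = fact (Suc k') * sum_list (map f (incs (Suc k') xs))"
      using Cons.prems by (intro Cons.IH) auto
    also have "(\<Sum>is\<in>lists_of k' (set xs). f (x # is)) = fact k' * sum_list (map (\<lambda>is. f (x # is)) (incs k' xs))"
      using Cons.prems by (intro Cons.IH ssym_Cons) auto
    finally show ?thesis using Suc by (simp add: o_def algebra_simps)
  qed
qed

section \<open>Forms are determined by their values on a frame\<close>

lemma skew_not_distinct:
  assumes "skew k f" "length js = k" "\<not> distinct js"
  shows "f (map E js) = 0"
proof -
  obtain i j where "i < k" "j < k" "i \<noteq> j" "js ! i = js ! j"
    using assms(2,3) by (auto simp: distinct_conv_nth)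
  then show ?thesis using skew_repeat[OF assms(1), of "map E js" i j] assms(2) by simp
qed

text \<open>Sorting the indices changes \<open>f\<close> and \<open>g\<close> by the same sign, and
  lists with repetitions give zero, so increasing lists decide.\<close>

lemma skew_index_ext:
  assumes f: "skew k f" and g: "skew k g" and E: "\<forall>js\<in>set (incs k [0..<n]). f (map E js) = g (map E js)"
    and js: "length js = k" "set js \<subseteq> {..<n}"
  shows "f (map E js) = g (map E js)"
proof (cases "distinct js")
  case True
  let ?s = "sort js"
  have "sorted_wrt (<) ?s" using True by (simp add: strict_sorted_iff)
  then have "?s \<in> set (incs k [0..<n])"
    using js by (intro incs_complete) (auto simp: strict_sorted_iff)
  then have fg: "f (map E ?s) = g (map E ?s)" using E by blast
  obtain c :: real where c: "\<And>f A. skew (length A + length ?s) f \<Longrightarrow> f (A @ map E js) = c * f (A @ map E ?s)"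
    using mset_eq_imp_skew_sign[of js ?s E] by auto
  show ?thesis using c[of "[]" f] c[of "[]" g] f g js fg by simp
next
  case False
  then show ?thesis using skew_not_distinct[of k f js] skew_not_distinct[of k g js] f g js by simp
qed

definition tbasis :: "H2 \<Rightarrow> (nat \<Rightarrow> H2) \<Rightarrow> bool" where
  "tbasis p E \<longleftrightarrow> (\<forall>i<7. E i \<in> tangent p) \<and> (\<forall>v\<in>tangent p. \<exists>c. v = (\<Sum>i<7. c i *\<^sub>R E i))"

lemma mlin_ext:
  assumes f: "mlin k f" and g: "mlin k g" and T: "tbasis p E"
    and fg: "\<And>js. length js = k \<Longrightarrow> set js \<subseteq> {..<7} \<Longrightarrow> f (map E js) = g (map E js)"
    and vs: "length vs = k" "set vs \<subseteq> tangent p"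
  shows "f vs = g vs"
proof -
  have "f (xs @ map E js) = g (xs @ map E js)"
    if "set xs \<subseteq> tangent p" "set js \<subseteq> {..<7}" "length xs + length js = k" for xs js
    using that
  proof (induction xs arbitrary: js rule: rev_induct)
    case Nil
    then show ?case using fg by simp
  next
    case (snoc x xs)
    then obtain c where x: "x = (\<Sum>i<7. c i *\<^sub>R E i)" using T unfolding tbasis_def by auto
    have "f (xs @ E i # map E js) = g (xs @ E i # map E js)" if "i < 7" for i
      using snoc.IH[of "i # js"] snoc.prems that by simp
    then have "(\<Sum>i<7. c i * f (xs @ E i # map E js)) = (\<Sum>i<7. c i * g (xs @ E i # map E js))"
      by simp
    then show ?case
      using mlin_sum[OF f, of xs "map E js" "{..<7}" c E] mlin_sum[OF g, of xs "map E js" "{..<7}" c E] snoc.prems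
      by (simp add: x)
  qed
  from this[of vs "[]"] vs show ?thesis by simp
qed

lemma form_ext:
  assumes p: "p \<in> S7" and f: "is_form_at p k f" and g: "is_form_at p k g" and T: "tbasis p E"
    and E: "\<forall>js\<in>set (incs k [0..<7]). f (map E js) = g (map E js)"
  shows "f = g"
proof
  fix vs
  show "f vs = g vs"
  proof (cases "length vs = k")
    case True
    have "f (map (tproj p) vs) = g (map (tproj p) vs)"
      by (rule mlin_ext[OF is_form_at_mlin[OF p f] is_form_at_mlin[OF p g] T
            skew_index_ext[OF is_form_at_skew[OF p f] is_form_at_skew[OF p g] E]])
        (use True tproj_in_tangent[OF p] in \<open>auto\<close>)
    then show ?thesis using is_form_at_tproj[OF f] is_form_at_tproj[OF g] by simp
  next
    case False
    then show ?thesis using is_form_at_len[OF f] is_form_at_len[OF g] by simp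
  qed
qed

section \<open>Orthonormal frames and the inner product of forms\<close>

lemma metric_at_lin:
  assumes "metric_at p g"
  shows "g (\<Sum>i\<in>I. c i *\<^sub>R e i) w = (\<Sum>i\<in>I. c i * g (e i) w)"
proof -
  have l: "linear (\<lambda>x. g x w)" using assms unfolding metric_at_def bilinear_def by blast
  show ?thesis using linear_sum[OF l, of "\<lambda>i. c i *\<^sub>R e i" I] linear_scale[OF l] by simp
qed

lemma tangent_dim:
  assumes "p \<in> S7"
  shows "dim (tangent p) = 7"
proof -
  have "p \<noteq> 0" using assms by auto
  then show ?thesis using dim_hyperplane[of p] by (simp add: tangent_def inner_commute numeral_eq_Suc)
qed

text \<open>The Gram relations make the seven vectors independent, and the tangent space has
  dimension 7.\<close>

lemma onb_expand:
  assumes p: "p \<in> S7" and g: "metric_at p g" and e: "onb p g e" and v: "v \<in> tangent p"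
  shows "v = (\<Sum>i<7. g v (e i) *\<^sub>R e i)"
proof -
  have ee: "g (e i) (e j) = (if i = j then 1 else 0)" if "i < 7" "j < 7" for i j
    using e that by (simp add: onb_def)
  have inj: "inj_on e {..<7}"
  proof (rule inj_onI)
    fix i j assume "i \<in> {..<7::nat}" "j \<in> {..<7::nat}" "e i = e j"
    then show "i = j" using ee[of i j] ee[of j j] by (auto split: if_splits)
  qed
  have coef: "g (\<Sum>i<7. c i *\<^sub>R e i) (e j) = c j" if "j < 7" for c j
  proof -
    have "g (\<Sum>i<7. c i *\<^sub>R e i) (e j) = (\<Sum>i<7. c i * g (e i) (e j))"
      by (rule metric_at_lin[OF g])
    also have "\<dots> = (\<Sum>i<7. if i = j then c j else 0)"
      using that by (intro sum.cong refl) (auto simp: ee)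
    finally show ?thesis using that by simp
  qed
  let ?B = "e ` {..<7}"
  have cB: "card ?B = 7" using inj by (simp add: card_image)
  have sub: "?B \<subseteq> tangent p" using e by (auto simp: onb_def)
  have g0: "g 0 w = 0" for w using metric_at_lin[OF g, of "\<lambda>_. 0" "\<lambda>_. 0" "{}" w] by simp
  have "independent ?B"
  proof (rule independent_if_scalars_zero)
    fix f x assume f: "(\<Sum>x\<in>?B. f x *\<^sub>R x) = 0" and "x \<in> ?B"
    then obtain j where j: "j < 7" "x = e j" by auto
    have "(\<Sum>i<7. f (e i) *\<^sub>R e i) = 0" using f by (simp add: sum.reindex[OF inj])
    then have "f (e j) = 0" using coef[OF j(1), of "\<lambda>i. f (e i)"] g0 by simp
    then show "f x = 0" using j by simp
  qed simp
  then have "tangent p \<subseteq> span ?B"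
    using card_ge_dim_independent[OF sub] cB tangent_dim[OF p] by simp
  then have "v \<in> span ?B" using v by blast
  then obtain u where "v = (\<Sum>x\<in>?B. u x *\<^sub>R x)" by (auto simp: span_finite)
  then have vu: "v = (\<Sum>i<7. u (e i) *\<^sub>R e i)" by (simp add: sum.reindex[OF inj])
  have "g v (e j) = u (e j)" if "j < 7" for j unfolding vu by (rule coef[OF that])
  then show ?thesis using vu by simp
qed

lemma onb_parseval:
  assumes p: "p \<in> S7" and g: "metric_at p g" and e: "onb p g e" "onb p g e'"
    and F: "mlin k F" and G: "mlin k G" and L: "length A + length B + 1 = k"
  shows "(\<Sum>i<7. F (A @ e i # B) * G (A @ e i # B)) = (\<Sum>i<7. F (A @ e' i # B) * G (A @ e' i # B))"
proof -
  have sym: "g v w = g w v" for v w using g unfolding metric_at_def by blast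
  have T: "e i \<in> tangent p" "e' i \<in> tangent p" if "i < 7" for i using e that by (auto simp: onb_def)
  have 1: "F (A @ e i # B) = (\<Sum>j<7. g (e i) (e' j) * F (A @ e' j # B))" if "i < 7" for i
    using mlin_sum[OF F L, of "{..<7}" "\<lambda>j. g (e i) (e' j)" e'] onb_expand[OF p g e(2) T(1)[OF that]] by simp
  have 2: "G (A @ e' j # B) = (\<Sum>i<7. g (e' j) (e i) * G (A @ e i # B))" if "j < 7" for j
    using mlin_sum[OF G L, of "{..<7}" "\<lambda>i. g (e' j) (e i)" e] onb_expand[OF p g e(1) T(2)[OF that]] by simp
  have "(\<Sum>i<7. F (A @ e i # B) * G (A @ e i # B)) =
     (\<Sum>i<7. \<Sum>j<7. g (e i) (e' j) * F (A @ e' j # B) * G (A @ e i # B))"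
    by (simp add: 1 sum_distrib_right)
  also have "\<dots> = (\<Sum>j<7. \<Sum>i<7. g (e i) (e' j) * F (A @ e' j # B) * G (A @ e i # B))"
    by (rule sum.swap)
  also have "\<dots> = (\<Sum>j<7. F (A @ e' j # B) * G (A @ e' j # B))"
    by (intro sum.cong refl) (simp add: 2 sum_distrib_left sym algebra_simps)
  finally show ?thesis .
qed

text \<open>\<open>form_inner\<close> takes its orthonormal basis from \<open>SOME\<close>.
  Exchanging the basis in one slot at a time by Parseval shows that any other basis gives the same
  sum, so an explicit frame may be used.\<close>

lemma onb_sum_lists:
  assumes p: "p \<in> S7" and g: "metric_at p g" and e: "onb p g e" "onb p g e'"
    and F: "mlin k F" and G: "mlin k G"
  shows "(\<Sum>is\<in>lists_of k {..<7}. F (map e is) * G (map e is)) = (\<Sum>is\<in>lists_of k {..<7}. F (map e' is) * G (map e' is))"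
proof -
  have "(\<Sum>is\<in>lists_of m {..<7}. F (A @ map e is) * G (A @ map e is)) =
      (\<Sum>is\<in>lists_of m {..<7}. F (A @ map e' is) * G (A @ map e' is))" if "length A + m = k" for A m
    using that
  proof (induction m arbitrary: A)
    case 0
    have "lists_of 0 {..<7::nat} = {[]}" by auto
    then show ?case by simp
  next
    case (Suc m)
    have "(\<Sum>is\<in>lists_of (Suc m) {..<7}. F (A @ map e is) * G (A @ map e is)) =
       (\<Sum>i<7. \<Sum>is\<in>lists_of m {..<7}. F ((A @ [e i]) @ map e is) * G ((A @ [e i]) @ map e is))"
      by (simp add: sum_lists_Suc)
    also have "\<dots> = (\<Sum>i<7. \<Sum>is\<in>lists_of m {..<7}. F ((A @ [e i]) @ map e' is) * G ((A @ [e i]) @ map e' is))"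
      by (rule sum.cong[OF refl], rule Suc.IH) (use Suc.prems in simp)
    also have "\<dots> = (\<Sum>is\<in>lists_of m {..<7}. \<Sum>i<7. F (A @ e i # map e' is) * G (A @ e i # map e' is))"
      by (subst sum.swap) simp
    also have "\<dots> = (\<Sum>is\<in>lists_of m {..<7}. \<Sum>i<7. F (A @ e' i # map e' is) * G (A @ e' i # map e' is))"
      by (intro sum.cong refl onb_parseval[OF p g e F G]) (use Suc.prems in auto)
    also have "\<dots> = (\<Sum>is\<in>lists_of (Suc m) {..<7}. F (A @ map e' is) * G (A @ map e' is))"
      by (subst sum.swap) (simp add: sum_lists_Suc)
    finally show ?case .
  qed
  from this[of "[]" k] show ?thesis by simp
qed

lemma mlin_map_scale:
  assumes "mlin k f" "length is = k"
  shows "f (map (\<lambda>i. c i *\<^sub>R E i) is) = prod_list (map c is) * f (map E is)"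
proof -
  have "f (A @ map (\<lambda>i. c i *\<^sub>R E i) is) = prod_list (map c is) * f (A @ map E is)"
    if "length A + length is = k" for A
    using that
  proof (induction "is" arbitrary: A)
    case (Cons i "is")
    have "f (A @ map (\<lambda>i. c i *\<^sub>R E i) (i # is)) = c i * f ((A @ [E i]) @ map (\<lambda>i. c i *\<^sub>R E i) is)"
      using mlin_scale[OF assms(1), of A "map (\<lambda>i. c i *\<^sub>R E i) is" "c i" "E i"] Cons.prems by simp
    also have "\<dots> = c i * (prod_list (map c is) * f ((A @ [E i]) @ map E is))"
      by (subst Cons.IH) (use Cons.prems in auto)
    finally show ?case by simp
  qed simp
  from this[of "[]"] assms(2) show ?thesis by simp
qed

text \<open>Orthogonal but not normalised, with squared lengths \<open>G\<close>. Each index occurs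
  twice in an inner product, so the square roots of a normalised frame disappear from the
  formulas.\<close>

definition orthog :: "H2 \<Rightarrow> (H2 \<Rightarrow> H2 \<Rightarrow> real) \<Rightarrow> (nat \<Rightarrow> H2) \<Rightarrow> (nat \<Rightarrow> real) \<Rightarrow> bool" where
  "orthog p g E G \<longleftrightarrow> (\<forall>i<7. E i \<in> tangent p \<and> G i > 0) \<and>
     (\<forall>i<7. \<forall>j<7. g (E i) (E j) = (if i = j then G i else 0))"

lemma orthog_onb:
  assumes g: "metric_at p g" and E: "orthog p g E G"
  shows "onb p g (\<lambda>i. (1 / sqrt (G i)) *\<^sub>R E i)"
proof -
  have b: "bilinear g" using g unfolding metric_at_def by blast
  show ?thesis
    unfolding onb_def
  proof (intro conjI allI impI)
    fix i :: nat assume "i < 7"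
    then show "(1 / sqrt (G i)) *\<^sub>R E i \<in> tangent p" using E by (auto simp: orthog_def tangent_def)
  next
    fix i j :: nat assume "i < 7" "j < 7"
    moreover from this have "G j > 0" "g (E i) (E j) = (if i = j then G i else 0)"
      using E unfolding orthog_def by blast+
    ultimately show "g ((1 / sqrt (G i)) *\<^sub>R E i) ((1 / sqrt (G j)) *\<^sub>R E j) = (if i = j then 1 else 0)"
      by (simp add: bilinear_lmul[OF b] bilinear_rmul[OF b])
  qed
qed

lemma prod_list_sqrt_inv:
  assumes "\<And>i. i \<in> set is \<Longrightarrow> G i > 0"
  shows "prod_list (map (\<lambda>i. 1 / sqrt (G i)) is) * prod_list (map (\<lambda>i. 1 / sqrt (G i)) is) = 1 / prod_list (map G is)"
  using assms
proof (induction "is")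
  case (Cons i "is")
  have s: "sqrt (G i) * sqrt (G i) = G i" using Cons.prems[of i] by simp
  have "prod_list (map (\<lambda>i. 1 / sqrt (G i)) (i # is)) * prod_list (map (\<lambda>i. 1 / sqrt (G i)) (i # is))
    = (1 / (sqrt (G i) * sqrt (G i))) * (prod_list (map (\<lambda>i. 1 / sqrt (G i)) is) * prod_list (map (\<lambda>i. 1 / sqrt (G i)) is))"
    by (simp add: algebra_simps)
  also have "\<dots> = (1 / G i) * (1 / prod_list (map G is))" using Cons s by simp
  finally show ?case by simp
qed simp

lemma form_inner_orthog:
  assumes p: "p \<in> S7" and g: "metric_at p g" and E: "orthog p g E G"
    and F: "is_form_at p k F" and H: "is_form_at p k H"
  shows "form_inner p g k F H = (\<Sum>is\<leftarrow>incs k [0..<7]. F (map E is) * H (map E is) / prod_list (map G is))"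
proof -
  let ?e' = "\<lambda>i. (1 / sqrt (G i)) *\<^sub>R E i"
  define e where "e = (SOME e. onb p g e)"
  note e' = orthog_onb[OF g E]
  have e: "onb p g e" unfolding e_def by (rule someI[where P = "onb p g", OF e'])
  note mF = is_form_at_mlin[OF p F] and mH = is_form_at_mlin[OF p H]
  note sF = is_form_at_skew[OF p F] and sH = is_form_at_skew[OF p H]
  define f where "f is = F (map E is) * H (map E is) / prod_list (map G is)" for "is"
  have "form_inner p g k F H = (\<Sum>is\<in>lists_of k {..<7}. F (map e is) * H (map e is)) / fact k"
    by (simp add: form_inner_def Let_def e_def)
  also have "(\<Sum>is\<in>lists_of k {..<7}. F (map e is) * H (map e is)) = (\<Sum>is\<in>lists_of k {..<7}. F (map ?e' is) * H (map ?e' is))"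
    by (rule onb_sum_lists[OF p g e e' mF mH])
  also have "\<dots> = (\<Sum>is\<in>lists_of k {..<7}. f is)"
  proof (intro sum.cong refl, clarify)
    fix "is" :: "nat list" assume i: "k = length is" "set is \<subseteq> {..<7}"
    let ?c = "prod_list (map (\<lambda>i. 1 / sqrt (G i)) is)"
    have "F (map ?e' is) * H (map ?e' is) = (?c * ?c) * (F (map E is) * H (map E is))"
      using mlin_map_scale[OF mF, of "is" "\<lambda>i. 1 / sqrt (G i)" E] mlin_map_scale[OF mH, of "is" "\<lambda>i. 1 / sqrt (G i)" E] i
      by (simp add: algebra_simps)
    also have "?c * ?c = 1 / prod_list (map G is)"
      by (rule prod_list_sqrt_inv) (use i E in \<open>auto simp: orthog_def\<close>)
    finally show "F (map ?e' is) * H (map ?e' is) = f is" by (simp add: f_def)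
  qed
  also have "\<dots> = fact k * sum_list (map f (incs k [0..<7]))"
  proof -
    have "ssym f"
      unfolding ssym_def
    proof (intro conjI allI)
      fix as zs :: "nat list" and x y
      show "f (as @ x # x # zs) = 0"
      proof (cases "length (as @ x # x # zs) = k")
        case True
        then have "F (map E (as @ x # x # zs)) = 0" by (intro skew_not_distinct[OF sF]) auto
        then show ?thesis by (simp add: f_def)
      qed (simp add: f_def is_form_at_len[OF F])
      show "f (as @ x # y # zs) = f (as @ y # x # zs)"
      proof (cases "length (as @ x # x # zs) = k")
        case True
        then show ?thesis
          using skewD[OF sF, of "map E as" "map E zs" "E x" "E y"] skewD[OF sH, of "map E as" "map E zs" "E x" "E y"]
          by (simp add: f_def algebra_simps)
      qed (simp add: f_def is_form_at_len[OF F])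
    qed
    from sum_lists_incs[OF this, of "[0..<7]" k] show ?thesis by (simp add: atLeast0LessThan)
  qed
  finally show ?thesis by (simp add: f_def[abs_def])
qed

lemma perm_list_map_upt:
  assumes "\<sigma> permutes {..<n}"
  shows "perm_list (map E [0..<n]) \<sigma> = map E (map \<sigma> [0..<n])"
  using assms permutes_in_image[OF assms] by (auto simp: perm_list_def)

text \<open>This is the uniqueness half of the star, which is defined by \<open>THE\<close>. Testing
  against the contraction of \<open>vol\<close> with the frame vectors of index list
  \<open>J\<close> isolates the value of \<delta> on them.\<close>

lemma wedge_left_nondegenerate:
  assumes p: "p \<in> S7" and vol: "is_form_at p 7 vol" "vol (map E [0..<7]) \<noteq> 0"
    and T: "tbasis p E" and kl: "k + l = 7" and \<delta>: "is_form_at p l \<delta>"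
    and z: "\<And>\<gamma>. is_form_at p k \<gamma> \<Longrightarrow> wedge k l \<gamma> \<delta> (map E [0..<7]) = 0"
  shows "\<delta> vs = 0"
proof -
  note mv = is_form_at_mlin[OF p vol(1)] and sv = is_form_at_skew[OF p vol(1)]
  note md = is_form_at_mlin[OF p \<delta>] and sd = is_form_at_skew[OF p \<delta>]
  have TE: "set (map E js) \<subseteq> tangent p" if "set js \<subseteq> {..<7}" for js
    using T that by (auto simp: tbasis_def)
  have "\<delta> (map E J) = 0" if J: "length J = l" "set J \<subseteq> {..<7}" for J
  proof (cases "distinct J")
    case False
    then show ?thesis using skew_not_distinct[OF sd J(1)] by simp
  next
    case True
    define \<gamma> where "\<gamma> us = vol (us @ map E J)" for us
    have "is_form_at p k \<gamma>"
    proof (rule is_form_atI)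
      show "skew k \<gamma>"
        unfolding skew_def
      proof (intro allI impI)
        fix xs ys :: "H2 list" and x y assume "length xs + length ys + 2 = k"
        then show "\<gamma> (xs @ x # y # ys) = - \<gamma> (xs @ y # x # ys)"
          using skewD[OF sv, of xs "ys @ map E J" x y] J kl by (simp add: \<gamma>_def)
      qed
      show "mlin k \<gamma>"
        unfolding mlin_def
      proof (intro allI impI)
        fix xs ys :: "H2 list" and u w :: H2 and a b :: real assume "length xs + length ys + 1 = k"
        then show "\<gamma> (xs @ (a *\<^sub>R u + b *\<^sub>R w) # ys) = a * \<gamma> (xs @ u # ys) + b * \<gamma> (xs @ w # ys)"
          using mlinD[OF mv, of xs "ys @ map E J" a u b w] J kl by (simp add: \<gamma>_def)
      qed
      show "\<gamma> vs = 0" if "length vs \<noteq> k" for vs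
        using is_form_at_len[OF vol(1), of "vs @ map E J"] that J kl by (simp add: \<gamma>_def)
      show "\<gamma> vs = \<gamma> (map (tproj p) vs)" for vs
        using is_form_at_tproj[OF vol(1), of "vs @ map E J"] map_tproj_tangent[OF TE[OF J(2)]]
        by (simp only: \<gamma>_def map_append)
    qed
    then have w0: "wedge k l \<gamma> \<delta> (map E [0..<7]) = 0" by (rule z)
    let ?P = "{\<sigma>. \<sigma> permutes {..<7::nat}}"
    let ?t = "\<lambda>\<sigma>. of_int (sign \<sigma>) * \<gamma> (take k (perm_list (map E [0..<7]) \<sigma>)) * \<delta> (drop k (perm_list (map E [0..<7]) \<sigma>))"
    have len: "length (map E [0..<7]) = k + l" using kl by simp
    have s0: "(\<Sum>\<sigma>\<in>?P. ?t \<sigma>) = 0"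
      using w0 unfolding wedge_perm_list[OF len] by simp
    \<comment> \<open>If the last l indices rearrange \<open>J\<close>, the sign of the
      rearrangement occurs once through \<gamma> and once through \<delta>, and the sign of \<sigma>
      occurs in the wedge and in \<open>vol\<close>. All such permutations therefore contribute the
      same amount; for the others \<open>vol\<close> sees a repeated index.\<close>
    have t: "?t \<sigma> = (if set (map \<sigma> [k..<7]) = set J then vol (map E [0..<7]) * \<delta> (map E J) else 0)"
      if s: "\<sigma> permutes {..<7}" for \<sigma>
    proof -
      let ?I = "map \<sigma> [0..<k]" and ?J = "map \<sigma> [k..<7]"
      have split: "[0..<7] = [0..<k] @ [k..<7]" using kl upt_add_eq_append[of 0 k l] by simp
      have tk: "take k (perm_list (map E [0..<7]) \<sigma>) = map E ?I" "drop k (perm_list (map E [0..<7]) \<sigma>) = map E ?J"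
        unfolding perm_list_map_upt[OF s] unfolding split by simp_all
      have inj: "inj \<sigma>" using s by (rule permutes_inj)
      have dJ: "distinct ?J" using inj by (auto simp: distinct_map inj_on_def)
      have uni: "set ?I \<union> set ?J = {..<7}"
        using permutes_image[OF s] kl by (auto simp: image_Un[symmetric] ivl_disj_un atLeast0LessThan)
      show ?thesis
      proof (cases "set ?J = set J")
        case True
        then have ms: "mset ?J = mset J" using set_eq_iff_mset_eq_distinct[OF dJ \<open>distinct J\<close>] by blast
        obtain c :: real where c: "c * c = 1"
          "\<And>f A. skew (length A + length J) f \<Longrightarrow> f (A @ map E ?J) = c * f (A @ map E J)"
          using mset_eq_imp_skew_sign[OF ms, of E] by blast
        have 1: "\<delta> (map E ?J) = c * \<delta> (map E J)" using c(2)[of "[]" \<delta>] sd J by simp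
        have 2: "vol (map E ?I @ map E ?J) = c * vol (map E ?I @ map E J)"
          by (rule c(2)) (use sv J kl in simp)
        have "map E ?I @ map E ?J = map (\<lambda>i. map E [0..<7] ! \<sigma> i) [0..<7]"
        proof -
          have "map E ?I @ map E ?J = map E (map \<sigma> [0..<7])" unfolding split by simp
          also have "\<dots> = perm_list (map E [0..<7]) \<sigma>" by (rule perm_list_map_upt[OF s, symmetric])
          finally show ?thesis by (simp only: perm_list_def length_map length_upt minus_nat.diff_0)
        qed
        then have 3: "vol (map E ?I @ map E ?J) = of_int (sign \<sigma>) * vol (map E [0..<7])"
          using skew_permutes[OF sv, of "map E [0..<7]" \<sigma>] s by simp
        have "vol (map E ?I @ map E J) = c * (of_int (sign \<sigma>) * vol (map E [0..<7]))"
          using 2 3 c(1) by (metis mult.assoc mult_1)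
        then have "?t \<sigma> = of_int (sign \<sigma>) * (c * (of_int (sign \<sigma>) * vol (map E [0..<7]))) * (c * \<delta> (map E J))"
          unfolding tk \<gamma>_def 1 by simp
        also have "\<dots> = (of_int (sign \<sigma>) * of_int (sign \<sigma>)) * (c * c) * (vol (map E [0..<7]) * \<delta> (map E J))"
          by (simp add: algebra_simps)
        also have "\<dots> = vol (map E [0..<7]) * \<delta> (map E J)"
          using c(1) by (simp flip: of_int_mult)
        finally show ?thesis using True by simp
      next
        case False
        have "length ?J = length J" using J kl by simp
        then have "card (set ?J) = card (set J)"
          unfolding distinct_card[OF dJ] distinct_card[OF \<open>distinct J\<close>] .
        then have "\<not> set J \<subseteq> set ?J" using False card_subset_eq[of "set ?J" "set J"] by auto
        then obtain j where "j \<in> set J" "j \<in> set ?I" using uni J(2) by blast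
        then have "\<not> distinct (?I @ J)" by auto
        then have "vol (map E (?I @ J)) = 0"
          by (intro skew_not_distinct[OF sv]) (use J kl in auto)
        then show ?thesis using False by (simp add: tk \<gamma>_def)
      qed
    qed
    have finP: "finite ?P" by (rule finite_permutations) simp
    let ?Q = "{\<sigma>\<in>?P. set (map \<sigma> [k..<7]) = set J}"
    have "(\<Sum>\<sigma>\<in>?P. ?t \<sigma>) = (\<Sum>\<sigma>\<in>?P. if set (map \<sigma> [k..<7]) = set J then vol (map E [0..<7]) * \<delta> (map E J) else 0)"
      by (rule sum.cong[OF refl]) (rule t, simp)
    also have "\<dots> = real (card ?Q) * (vol (map E [0..<7]) * \<delta> (map E J))"
      using finP by (simp add: sum.If_cases Int_def)
    finally have sQ: "(\<Sum>\<sigma>\<in>?P. ?t \<sigma>) = real (card ?Q) * (vol (map E [0..<7]) * \<delta> (map E J))" .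
    have "?Q \<noteq> {}"
    proof -
      \<comment> \<open>Listing the complement of \<open>J\<close> before \<open>J\<close> yields a
        permutation of this kind, so the common amount is counted at least once.\<close>
      define xs where "xs = filter (\<lambda>i. i \<notin> set J) [0..<7] @ J"
      have dx: "distinct xs" and sx: "set xs = set [0..<7]" using True J by (auto simp: xs_def)
      then have "mset xs = mset [0..<7]"
        using set_eq_iff_mset_eq_distinct[OF dx distinct_upt] by blast
      then obtain \<sigma> where s: "\<sigma> permutes {..<7}" "permute_list \<sigma> [0..<7] = xs"
        using mset_eq_permutation[of xs "[0..<7]"] by auto
      have "length xs = 7" using s(2) by auto
      have "\<sigma> i < 7" if "i < 7" for i using permutes_in_image[OF s(1), of i] that by simp
      then have "xs = map \<sigma> [0..<7]" using s(2) by (auto simp: permute_list_def)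
      then have "map \<sigma> [k..<7] = drop k xs" by (simp add: drop_map)
      also have "\<dots> = J" using \<open>length xs = 7\<close> J kl by (simp add: xs_def)
      finally show ?thesis using s(1) by auto
    qed
    then have "card ?Q > 0" using finP by (simp add: card_gt_0_iff)
    then show ?thesis using sQ s0 vol(2) by simp
  qed
  note zero = this
  have m0: "mlin l (\<lambda>_. 0)" by (simp add: mlin_def)
  have "\<delta> (map (tproj p) vs) = 0" if "length vs = l"
    by (rule mlin_ext[OF md m0 T zero]) (use that tproj_in_tangent[OF p] in auto)
  then show ?thesis
    using is_form_at_tproj[OF \<delta>, of vs] is_form_at_len[OF \<delta>, of vs] by metis
qed

lemma is_form_at_scale:
  assumes "p \<in> S7" "is_form_at p k f"
  shows "is_form_at p k (\<lambda>vs. c * f vs)"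
proof (rule is_form_atI)
  show "skew k (\<lambda>vs. c * f vs)"
    unfolding skew_def
  proof (intro allI impI)
    fix xs ys :: "H2 list" and x y assume "length xs + length ys + 2 = k"
    from skewD[OF is_form_at_skew[OF assms] this, of x y]
    show "c * f (xs @ x # y # ys) = - (c * f (xs @ y # x # ys))" by simp
  qed
  show "mlin k (\<lambda>vs. c * f vs)"
    unfolding mlin_def
  proof (intro allI impI)
    fix xs ys :: "H2 list" and u w :: H2 and a b :: real assume "length xs + length ys + 1 = k"
    from mlinD[OF is_form_at_mlin[OF assms] this, of a u b w]
    show "c * f (xs @ (a *\<^sub>R u + b *\<^sub>R w) # ys) = a * (c * f (xs @ u # ys)) + b * (c * f (xs @ w # ys))"
      by (simp add: algebra_simps)
  qed
  show "c * f vs = 0" if "length vs \<noteq> k" for vs using is_form_at_len[OF assms(2) that] by simp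
  show "c * f vs = c * f (map (tproj p) vs)" for vs using is_form_at_tproj[OF assms(2)] by simp
qed

lemma is_form_at_diff:
  assumes "p \<in> S7" "is_form_at p k f" "is_form_at p k h"
  shows "is_form_at p k (\<lambda>vs. f vs - h vs)"
proof (rule is_form_atI)
  show "skew k (\<lambda>vs. f vs - h vs)"
    unfolding skew_def
  proof (intro allI impI)
    fix xs ys :: "H2 list" and x y assume L: "length xs + length ys + 2 = k"
    show "f (xs @ x # y # ys) - h (xs @ x # y # ys) = - (f (xs @ y # x # ys) - h (xs @ y # x # ys))"
      using skewD[OF is_form_at_skew[OF assms(1,2)] L, of x y] skewD[OF is_form_at_skew[OF assms(1,3)] L, of x y]
      by simp
  qed
  show "mlin k (\<lambda>vs. f vs - h vs)"
    unfolding mlin_def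
  proof (intro allI impI)
    fix xs ys :: "H2 list" and u w :: H2 and a b :: real assume L: "length xs + length ys + 1 = k"
    show "f (xs @ (a *\<^sub>R u + b *\<^sub>R w) # ys) - h (xs @ (a *\<^sub>R u + b *\<^sub>R w) # ys) =
        a * (f (xs @ u # ys) - h (xs @ u # ys)) + b * (f (xs @ w # ys) - h (xs @ w # ys))"
      using mlinD[OF is_form_at_mlin[OF assms(1,2)] L, of a u b w] mlinD[OF is_form_at_mlin[OF assms(1,3)] L, of a u b w]
      by (simp add: algebra_simps)
  qed
  show "f vs - h vs = 0" if "length vs \<noteq> k" for vs
    using is_form_at_len[OF assms(2) that] is_form_at_len[OF assms(3) that] by simp
  show "f vs - h vs = f (map (tproj p) vs) - h (map (tproj p) vs)" for vs
    using is_form_at_tproj[OF assms(2)] is_form_at_tproj[OF assms(3)] by simp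
qed

lemma wedge_diff_right: "wedge k l \<alpha> (\<lambda>vs. \<beta> vs - \<beta>' vs) vs = wedge k l \<alpha> \<beta> vs - wedge k l \<alpha> \<beta>' vs"
  by (simp add: wedge_def right_diff_distrib sum_subtractf diff_divide_distrib)

lemma form_inner_cong:
  assumes g: "metric_at p g" and E: "orthog p g E G"
    and "\<And>vs. length vs = k \<Longrightarrow> set vs \<subseteq> tangent p \<Longrightarrow> \<beta> vs = \<beta>' vs"
  shows "form_inner p g k \<gamma> \<beta> = form_inner p g k \<gamma> \<beta>'"
proof -
  define e where "e = (SOME e. onb p g e)"
  have "onb p g e" unfolding e_def by (rule someI[where P = "onb p g", OF orthog_onb[OF g E]])
  then have "\<beta> (map e is) = \<beta>' (map e is)" if "is \<in> lists_of k {..<7}" for "is"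
    using that by (intro assms(3)) (auto simp: onb_def)
  then show ?thesis by (simp add: form_inner_def Let_def flip: e_def)
qed

text \<open>In a \<open>g\<close>-orthogonal frame the Hodge star is determined by its values on complementary
  increasing index lists, so that a candidate can be checked on finitely many frame entries.\<close>

lemma star_atI:
  assumes p: "p \<in> S7" and g: "metric_at p g" and vol: "is_form_at p 7 vol"
    and E: "orthog p g E G" and T: "tbasis p E" and \<nu>: "vol (map E [0..<7]) = \<nu>" "\<nu> \<noteq> 0"
    and kl: "k + l = 7" and \<beta>': "is_form_at p k \<beta>'"
    and \<beta>: "\<And>vs. length vs = k \<Longrightarrow> set vs \<subseteq> tangent p \<Longrightarrow> \<beta> vs = \<beta>' vs"
    and \<alpha>: "is_form_at p l \<alpha>"
    and ms: "mset (map (fst \<circ> snd) (shuf k l (rev [0..<7]))) = mset (incs k [0..<7])"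
    and chk: "\<And>s I J. (s, I, J) \<in> set (shuf k l (rev [0..<7])) \<Longrightarrow>
      s * \<alpha> (map E J) = \<nu> * \<beta>' (map E I) / prod_list (map G I)"
  shows "star_at p g vol k \<beta> = \<alpha>"
proof -
  have l: "7 - k = l" using kl by simp
  have ex: "wedge k l \<gamma> \<alpha> vs = form_inner p g k \<gamma> \<beta> * vol vs" if \<gamma>: "is_form_at p k \<gamma>" for \<gamma> vs
  proof -
    define h where "h I = \<gamma> (map E I) * \<beta>' (map E I) / prod_list (map G I)" for I
    have "wedge k l \<gamma> \<alpha> (map E (rev (rev [0..<7]))) = (\<Sum>(s, I, J)\<leftarrow>shuf k l (rev [0..<7]). s * \<gamma> (map E I) * \<alpha> (map E J))"
      by (rule wedge_shuf) (use is_form_at_skew[OF p] \<gamma> \<alpha> kl in auto)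
    also have "\<dots> = (\<Sum>(s, I, J)\<leftarrow>shuf k l (rev [0..<7]). \<nu> * h I)"
    proof (rule arg_cong[where f = sum_list], rule map_cong[OF refl], clarify)
      fix s I J assume "(s, I, J) \<in> set (shuf k l (rev [0..<7]))"
      from chk[OF this] have "\<gamma> (map E I) * (s * \<alpha> (map E J)) = \<gamma> (map E I) * (\<nu> * \<beta>' (map E I) / prod_list (map G I))"
        by simp
      then show "s * \<gamma> (map E I) * \<alpha> (map E J) = \<nu> * h I" by (simp add: h_def algebra_simps)
    qed
    also have "\<dots> = sum_list (map (\<lambda>I. \<nu> * h I) (map (fst \<circ> snd) (shuf k l (rev [0..<7]))))"
      by (simp add: case_prod_unfold o_def)
    also have "\<dots> = sum_list (map (\<lambda>I. \<nu> * h I) (incs k [0..<7]))"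
      unfolding sum_mset_sum_list[symmetric] mset_map[of "\<lambda>I. \<nu> * h I"] ms ..
    also have "\<dots> = \<nu> * form_inner p g k \<gamma> \<beta>'"
      unfolding form_inner_orthog[OF p g E \<gamma> \<beta>'] h_def[abs_def] by (rule sum_list_const_mult)
    also have "form_inner p g k \<gamma> \<beta>' = form_inner p g k \<gamma> \<beta>"
      by (rule form_inner_cong[OF g E, symmetric]) (rule \<beta>)
    finally have e: "wedge k l \<gamma> \<alpha> (map E [0..<7]) = form_inner p g k \<gamma> \<beta> * vol (map E [0..<7])"
      using \<nu> by simp
    have "wedge k l \<gamma> \<alpha> = (\<lambda>vs. form_inner p g k \<gamma> \<beta> * vol vs)"
    proof (rule form_ext[OF p _ is_form_at_scale[OF p vol] T])
      show "is_form_at p 7 (wedge k l \<gamma> \<alpha>)" using is_form_at_wedge[OF p \<gamma> \<alpha>] kl by simp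
      have "set (incs 7 [0..<7]) = {[0..<7]}" by (simp add: upt_rec numeral_eq_Suc)
      then show "\<forall>js\<in>set (incs 7 [0..<7]). wedge k l \<gamma> \<alpha> (map E js) = form_inner p g k \<gamma> \<beta> * vol (map E js)"
        using e by simp
    qed
    then show ?thesis by simp
  qed
  show ?thesis
    unfolding star_at_def l
  proof (rule the_equality)
    show "is_form_at p l \<alpha> \<and> (\<forall>\<gamma>. is_form_at p k \<gamma> \<longrightarrow>
        (\<forall>vs. length vs = 7 \<longrightarrow> wedge k l \<gamma> \<alpha> vs = form_inner p g k \<gamma> \<beta> * vol vs))"
      using \<alpha> ex by blast
  next
    fix \<alpha>' assume \<alpha>': "is_form_at p l \<alpha>' \<and> (\<forall>\<gamma>. is_form_at p k \<gamma> \<longrightarrow>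
        (\<forall>vs. length vs = 7 \<longrightarrow> wedge k l \<gamma> \<alpha>' vs = form_inner p g k \<gamma> \<beta> * vol vs))"
    have "\<alpha>' vs - \<alpha> vs = 0" for vs
    proof (rule wedge_left_nondegenerate[OF p vol _ T kl])
      show "vol (map E [0..<7]) \<noteq> 0" using \<nu> by simp
      show "is_form_at p l (\<lambda>vs. \<alpha>' vs - \<alpha> vs)" using p \<alpha> \<alpha>' by (intro is_form_at_diff) auto
      show "wedge k l \<gamma> (\<lambda>vs. \<alpha>' vs - \<alpha> vs) (map E [0..<7]) = 0" if "is_form_at p k \<gamma>" for \<gamma>
        using ex[OF that, of "map E [0..<7]"] \<alpha>' that by (simp add: wedge_diff_right)
    qed
    then show "\<alpha>' = \<alpha>" by (intro ext) simp
  qed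
qed

section \<open>Quaternionic geometry of the sphere\<close>

text \<open>\<open>JJ 1\<close>, \<open>JJ 2\<close>, \<open>JJ 3\<close> are right multiplication by \<open>i\<close>, \<open>j\<close>, \<open>k\<close>. The same symbol \<open>th\<close> gives
  the 1-forms \<open>\<eta>\<^sub>i = th i p\<close> on the sphere and the 2-forms \<open>th i\<close> with \<open>d \<eta>\<^sub>i = 2 th i\<close>.\<close>

definition JJ :: "nat \<Rightarrow> H2 \<Rightarrow> H2" where
  "JJ i v = (case v of ((a, b, c, d), (a', b', c', d')) \<Rightarrow>
     if i = 1 then ((-b, a, d, -c), (-b', a', d', -c'))
     else if i = 2 then ((-c, -d, a, b), (-c', -d', a', b'))
     else ((-d, c, -b, a), (-d', c', -b', a')))"

definition th :: "nat \<Rightarrow> H2 \<Rightarrow> H2 \<Rightarrow> real" where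
  "th i u v = inner v (JJ i u)"

lemma JJ_lin: "JJ i (a *\<^sub>R u + b *\<^sub>R v) = a *\<^sub>R JJ i u + b *\<^sub>R JJ i v"
  by (cases u; cases v) (auto simp: JJ_def algebra_simps split: prod.splits)

lemma th_lin_left: "th i (a *\<^sub>R u + b *\<^sub>R v) w = a * th i u w + b * th i v w"
  by (simp add: th_def JJ_lin inner_add_right)

lemma th_lin_right: "th i w (a *\<^sub>R u + b *\<^sub>R v) = a * th i w u + b * th i w v"
  by (simp add: th_def inner_add_left)

lemma th_skew: "th i v u = - th i u v"
  by (cases u; cases v) (auto simp: th_def JJ_def inner_prod_def algebra_simps split: prod.splits)

lemma th_self [simp]: "th i u u = 0"
  using th_skew[of i u u] by simp

definition p0 :: H2 where "p0 = ((1, 0, 0, 0), (0, 0, 0, 0))"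

definition E0 :: "nat \<Rightarrow> H2" where
  "E0 i = [((0, 1, 0, 0), (0, 0, 0, 0)), ((0, 0, 1, 0), (0, 0, 0, 0)), ((0, 0, 0, 1), (0, 0, 0, 0)),
     ((0, 0, 0, 0), (1, 0, 0, 0)), ((0, 0, 0, 0), (0, 1, 0, 0)), ((0, 0, 0, 0), (0, 0, 1, 0)),
     ((0, 0, 0, 0), (0, 0, 0, 1))] ! i"

lemma E0_simps [simp]:
  "E0 0 = ((0, 1, 0, 0), (0, 0, 0, 0))" "E0 (Suc 0) = ((0, 0, 1, 0), (0, 0, 0, 0))"
  "E0 1 = ((0, 0, 1, 0), (0, 0, 0, 0))"
  "E0 2 = ((0, 0, 0, 1), (0, 0, 0, 0))" "E0 3 = ((0, 0, 0, 0), (1, 0, 0, 0))"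
  "E0 4 = ((0, 0, 0, 0), (0, 1, 0, 0))" "E0 5 = ((0, 0, 0, 0), (0, 0, 1, 0))"
  "E0 6 = ((0, 0, 0, 0), (0, 0, 0, 1))"
  by (simp_all add: E0_def)

lemma less7: "i < (7::nat) \<longleftrightarrow> i = 0 \<or> i = 1 \<or> i = 2 \<or> i = 3 \<or> i = 4 \<or> i = 5 \<or> i = 6"
  by arith

lemma all_less7: "(\<forall>i<7. P i) \<longleftrightarrow> P 0 \<and> P 1 \<and> P 2 \<and> P 3 \<and> P 4 \<and> P 5 \<and> P (6::nat)"
  unfolding less7 by blast

lemma sum_lessThan7: "(\<Sum>i<7. f i) = f 0 + f 1 + f 2 + f 3 + f 4 + f 5 + f (6::nat)"
  by (simp add: numeral_eq_Suc)

lemma upt7: "[0..<7] = [0, 1, 2, 3, 4, 5, 6::nat]"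
  by (simp add: upt_rec)

lemma tbasis_E0: "tbasis p0 E0"
  unfolding tbasis_def
proof (intro conjI ballI)
  show "\<forall>i<7. E0 i \<in> tangent p0"
    unfolding all_less7 by (simp add: tangent_def p0_def inner_prod_def)
  fix v assume v: "v \<in> tangent p0"
  obtain a b c d a' b' c' d' where e: "v = ((a, b, c, d), (a', b', c', d'))" by (metis prod.collapse)
  have "a = 0" using v by (simp add: e tangent_def p0_def inner_prod_def)
  then have "v = (\<Sum>i<7. [b, c, d, a', b', c', d'] ! i *\<^sub>R E0 i)"
    unfolding sum_lessThan7 by (simp add: e)
  then show "\<exists>c. v = (\<Sum>i<7. c i *\<^sub>R E0 i)" by (rule exI[of _ "\<lambda>i. [b, c, d, a', b', c', d'] ! i"])
qed

section \<open>Quaternionic isometries and the transitivity of Sp(2)\<close>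

text \<open>The linear isometries commuting with the three complex structures, that is Sp(2) acting
  from the left. They preserve every \<open>th i\<close>, so a form built from \<open>th\<close>
  alone is invariant without further computation.\<close>

definition hiso :: "(H2 \<Rightarrow> H2) \<Rightarrow> bool" where
  "hiso g \<longleftrightarrow> linear g \<and> (\<forall>u v. inner (g u) (g v) = inner u v) \<and> (\<forall>i u. JJ i (g u) = g (JJ i u))"

lemma hiso_th: "hiso g \<Longrightarrow> th i (g u) (g v) = th i u v"
proof -
  assume g: "hiso g"
  have "th i (g u) (g v) = inner (g v) (g (JJ i u))" using g unfolding hiso_def th_def by metis
  also have "\<dots> = inner v (JJ i u)" using g unfolding hiso_def by blast
  finally show ?thesis by (simp add: th_def)
qed

lemma hiso_bij: "hiso g \<Longrightarrow> bij g"
  using orthogonal_transformation_bij[of g] unfolding hiso_def orthogonal_transformation_def by blast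

lemma hiso_tangent: "hiso g \<Longrightarrow> g v \<in> tangent (g p) \<longleftrightarrow> v \<in> tangent p"
  unfolding hiso_def tangent_def mem_Collect_eq by metis

lemma hiso_norm: "hiso g \<Longrightarrow> norm (g v) = norm v"
  unfolding hiso_def by (metis norm_eq_sqrt_inner)

lemma hiso_tbasis:
  assumes g: "hiso g" and T: "tbasis p E"
  shows "tbasis (g p) (\<lambda>i. g (E i))"
  unfolding tbasis_def
proof (intro conjI ballI allI impI)
  show "g (E i) \<in> tangent (g p)" if "i < 7" for i
    using T that hiso_tangent[OF g] by (simp add: tbasis_def)
  fix v assume v: "v \<in> tangent (g p)"
  obtain w where w: "v = g w" using hiso_bij[OF g] by (metis bij_pointE)
  then have "w \<in> tangent p" using v hiso_tangent[OF g] by simp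
  then obtain c where c: "w = (\<Sum>i<7. c i *\<^sub>R E i)" using T unfolding tbasis_def by blast
  have l: "linear g" using g by (simp add: hiso_def)
  have "v = (\<Sum>i<7. c i *\<^sub>R g (E i))" unfolding w c
    using linear_sum[OF l, of "\<lambda>i. c i *\<^sub>R E i" "{..<7}"] linear_scale[OF l] by simp
  then show "\<exists>c. v = (\<Sum>i<7. c i *\<^sub>R g (E i))" by (rule exI[of _ c])
qed

lemma qmul_assoc: "qmul (qmul a b) c = qmul a (qmul b c)"
  by (cases a; cases b; cases c) (auto simp: qmul_def algebra_simps)

lemma qmul_add_left: "qmul (a + b) c = qmul a c + qmul b c"
  by (cases a; cases b; cases c) (auto simp: qmul_def algebra_simps)

lemma qmul_add_right: "qmul a (b + c) = qmul a b + qmul a c"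
  by (cases a; cases b; cases c) (auto simp: qmul_def algebra_simps)

lemma qmul_scale_left: "qmul (r *\<^sub>R a) b = r *\<^sub>R qmul a b"
  by (cases a; cases b) (auto simp: qmul_def algebra_simps)

lemma qmul_scale_right: "qmul a (r *\<^sub>R b) = r *\<^sub>R qmul a b"
  by (cases a; cases b) (auto simp: qmul_def algebra_simps)

lemma qmul_minus_left [simp]: "qmul (- a) b = - qmul a b"
  using qmul_scale_left[of "- 1" a b] by simp

lemma qmul_minus_right [simp]: "qmul a (- b) = - qmul a b"
  using qmul_scale_right[of a "- 1" b] by simp

lemma qconj_qmul: "qconj (qmul a b) = qmul (qconj b) (qconj a)"
  by (cases a; cases b) (auto simp: qmul_def qconj_def algebra_simps)

lemma qconj_add: "qconj (a + b) = qconj a + qconj b"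
  by (cases a; cases b) (auto simp: qconj_def)

lemma inner_quat: "inner a b = fst (qmul (qconj a) b)"
  by (cases a; cases b) (auto simp: qmul_def qconj_def inner_prod_def algebra_simps)

lemma qmul_qone [simp]: "qmul qone a = a" "qmul a qone = a"
  by (cases a; auto simp: qmul_def qone_def)+

lemma qconj_qone [simp]: "qconj qone = qone"
  by (simp add: qconj_def qone_def)

lemma qmul_zero [simp]: "qmul 0 a = 0" "qmul a 0 = 0"
  by (cases a; auto simp: qmul_def zero_prod_def)+

definition qunit :: "nat \<Rightarrow> quat" where
  "qunit i = (if i = 1 then (0, 1, 0, 0) else if i = 2 then (0, 0, 1, 0) else (0, 0, 0, 1))"

lemma JJ_qmul: "JJ i v = (qmul (fst v) (qunit i), qmul (snd v) (qunit i))"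
  by (cases v) (auto simp: JJ_def qmul_def qunit_def split: prod.splits)

lemma p0_quat: "p0 = (qone, 0)"
  by (simp add: p0_def qone_def zero_prod_def)

text \<open>The four equations of \<open>Sp2\<close> are exactly what remains of the inner product
  after the conjugates are collected; associativity makes left multiplication commute with right
  multiplication by units.\<close>

lemma hiso_act:
  assumes "A \<in> Sp2"
  shows "hiso (act A qone)"
proof -
  obtain a b c d where A: "A = (a, b, c, d)" by (metis prod.collapse)
  have act: "act A qone v = (qmul a (fst v) + qmul b (snd v), qmul c (fst v) + qmul d (snd v))" for v
    by (cases v) (simp add: act_def A)
  have h: "qmul (qconj a) a + qmul (qconj c) c = qone" "qmul (qconj a) b + qmul (qconj c) d = 0"
    "qmul (qconj b) a + qmul (qconj d) c = 0" "qmul (qconj b) b + qmul (qconj d) d = qone"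
    using assms by (simp_all add: A Sp2_def)
  have "linear (act A qone)"
    by (rule linearI) (simp_all add: act qmul_add_right qmul_scale_right algebra_simps)
  moreover have "inner (act A qone u) (act A qone v) = inner u v" for u v
  proof -
    obtain u1 u2 v1 v2 where uv: "u = (u1, u2)" "v = (v1, v2)" by (metis prod.collapse)
    let ?q = "\<lambda>x m y. qmul (qconj x) (qmul m y)"
    have "inner (act A qone u) (act A qone v) =
       fst (?q u1 (qmul (qconj a) a + qmul (qconj c) c) v1 + ?q u1 (qmul (qconj a) b + qmul (qconj c) d) v2
          + ?q u2 (qmul (qconj b) a + qmul (qconj d) c) v1 + ?q u2 (qmul (qconj b) b + qmul (qconj d) d) v2)"
      unfolding act uv inner_Pair fst_conv snd_conv inner_quat qconj_add qconj_qmul qmul_add_left qmul_add_right qmul_assoc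
      by simp
    also have "\<dots> = inner u v" unfolding h uv inner_Pair inner_quat by simp
    finally show ?thesis .
  qed
  moreover have "JJ i (act A qone u) = act A qone (JJ i u)" for i u
    by (simp add: JJ_qmul act qmul_add_left qmul_assoc)
  ultimately show ?thesis unfolding hiso_def by blast
qed

text \<open>The first column of the matrix has to be p = (x, y). The second column is the unit
  vector (|y|, - y conj(x) / |y|), which is orthogonal to it; for y = 0 the matrix is
  diagonal.\<close>

lemma Sp2_transitive:
  assumes "p \<in> S7"
  obtains A where "A \<in> Sp2" "act A qone p0 = p"
proof -
  obtain x y where p: "p = (x, y)" by (metis prod.collapse)
  have n: "inner x x + inner y y = 1"
    using assms by (simp add: p norm_eq_sqrt_inner inner_prod_def)
  then have n': "inner y y + inner x x = 1" by simp
  have qq: "qmul (qconj a) a = inner a a *\<^sub>R qone" for a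
    by (cases a) (auto simp: qmul_def qconj_def qone_def inner_prod_def)
  have qq': "qmul a (qconj a) = inner a a *\<^sub>R qone" for a
    by (cases a) (auto simp: qmul_def qconj_def qone_def inner_prod_def)
  define r where "r = norm y"
  have r2: "r * r = inner y y" by (simp add: r_def dot_square_norm power2_eq_square)
  show ?thesis
  proof (cases "y = 0")
    case True
    then have "(x, 0, 0, qone) \<in> Sp2"
      using n qq[of x] by (auto simp: Sp2_def qq)
        (simp_all add: qone_def qconj_def qmul_def zero_prod_def)
    moreover have "act (x, 0, 0, qone) qone p0 = p"
      using True by (simp add: act_def p0_quat p)
    ultimately show ?thesis using that by blast
  next
    case False
    then have r: "r > 0" by (simp add: r_def)
    define b d where "b = r *\<^sub>R qone" and "d = (- 1 / r) *\<^sub>R qmul y (qconj x)"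
    have cb: "qconj b = b" by (simp add: b_def qconj_def qone_def)
    have cd: "qconj d = (- 1 / r) *\<^sub>R qmul x (qconj y)"
      by (cases x; cases y) (auto simp: d_def qconj_def qmul_def algebra_simps)
    have 1: "qmul (qconj x) x + qmul (qconj y) y = qone"
      using n by (simp add: qq flip: scaleR_left_distrib)
    have "qmul (qconj y) d = (- 1 / r) *\<^sub>R (inner y y *\<^sub>R qconj x)"
      by (simp add: d_def qmul_scale_right qmul_scale_left qq flip: qmul_assoc)
    also have "\<dots> = - r *\<^sub>R qconj x" using r r2 by (simp flip: r2)
    finally have 2: "qmul (qconj x) b + qmul (qconj y) d = 0"
      by (simp add: b_def qmul_scale_right)
    have "qmul (qconj d) y = (- 1 / r) *\<^sub>R (inner y y *\<^sub>R x)"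
      by (simp add: cd qmul_scale_right qmul_scale_left qq qmul_assoc)
    also have "\<dots> = - r *\<^sub>R x" using r r2 by (simp flip: r2)
    finally have 3: "qmul (qconj b) x + qmul (qconj d) y = 0"
      by (simp add: cb) (simp add: b_def qmul_scale_left)
    have "qmul (qconj d) d = (1 / (r * r)) *\<^sub>R qmul x (qmul (qmul (qconj y) y) (qconj x))"
      unfolding cd unfolding d_def by (simp add: qmul_scale_right qmul_scale_left qmul_assoc)
    also have "\<dots> = inner x x *\<^sub>R qone"
      using r by (simp add: qq qmul_scale_left qmul_scale_right qq' flip: r2)
    finally have 4: "qmul (qconj b) b + qmul (qconj d) d = qone"
      using n' r2 unfolding cb by (simp add: b_def qmul_scale_left qmul_scale_right flip: scaleR_left_distrib)
    have "(x, b, y, d) \<in> Sp2" using 1 2 3 4 by (simp add: Sp2_def)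
    moreover have "act (x, b, y, d) qone p0 = p"
      by (simp add: act_def p0_quat p)
    ultimately show ?thesis using that by blast
  qed
qed

section \<open>Criteria for antisymmetry and linearity of explicit forms\<close>

lemma skew2I:
  assumes "\<And>x y. f [x, y] = - f [y, x]"
  shows "skew 2 f"
  unfolding skew_def
proof (intro allI impI)
  fix xs ys :: "'a list" and x y assume "length xs + length ys + 2 = 2"
  then have "xs = []" "ys = []" by auto
  then show "f (xs @ x # y # ys) = - f (xs @ y # x # ys)" using assms[of x y] by simp
qed

lemma skew3I:
  assumes "\<And>x y z. f [x, y, z] = - f [y, x, z]" "\<And>x y z. f [z, x, y] = - f [z, y, x]"
  shows "skew 3 f"
  unfolding skew_def
proof (intro allI impI)
  fix xs ys :: "'a list" and x y assume "length xs + length ys + 2 = 3"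
  then consider z where "xs = []" "ys = [z]" | z where "xs = [z]" "ys = []"
    by (cases xs; cases ys) auto
  then show "f (xs @ x # y # ys) = - f (xs @ y # x # ys)"
    by cases (use assms(1)[of x y] assms(2)[of _ x y] in simp_all)
qed

lemma skew4I:
  assumes "\<And>x y a b. f [x, y, a, b] = - f [y, x, a, b]" "\<And>x y a b. f [a, x, y, b] = - f [a, y, x, b]"
    "\<And>x y a b. f [a, b, x, y] = - f [a, b, y, x]"
  shows "skew 4 f"
  unfolding skew_def
proof (intro allI impI)
  fix xs ys :: "'a list" and x y assume "length xs + length ys + 2 = 4"
  then have "length xs = 0 \<and> length ys = 2 \<or> length xs = 1 \<and> length ys = 1 \<or> length xs = 2 \<and> length ys = 0"
    by arith
  then consider a b where "xs = []" "ys = [a, b]" | a b where "xs = [a]" "ys = [b]"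
    | a b where "xs = [a, b]" "ys = []"
    by (elim disjE) (auto simp: numeral_eq_Suc length_Suc_conv)
  then show "f (xs @ x # y # ys) = - f (xs @ y # x # ys)"
    by cases (use assms(1)[of x y] assms(2)[of _ x y] assms(3)[of _ _ x y] in simp_all)
qed

lemma skew5I:
  assumes "\<And>x y a b c. f [x, y, a, b, c] = - f [y, x, a, b, c]"
    "\<And>x y a b c. f [a, x, y, b, c] = - f [a, y, x, b, c]"
    "\<And>x y a b c. f [a, b, x, y, c] = - f [a, b, y, x, c]"
    "\<And>x y a b c. f [a, b, c, x, y] = - f [a, b, c, y, x]"
  shows "skew 5 f"
  unfolding skew_def
proof (intro allI impI)
  fix xs ys :: "'a list" and x y assume "length xs + length ys + 2 = 5"
  then have "length xs = 0 \<and> length ys = 3 \<or> length xs = 1 \<and> length ys = 2 \<or>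
      length xs = 2 \<and> length ys = 1 \<or> length xs = 3 \<and> length ys = 0"
    by arith
  then consider a b c where "xs = []" "ys = [a, b, c]" | a b c where "xs = [a]" "ys = [b, c]"
    | a b c where "xs = [a, b]" "ys = [c]" | a b c where "xs = [a, b, c]" "ys = []"
    by (elim disjE) (auto simp: numeral_eq_Suc length_Suc_conv)
  then show "f (xs @ x # y # ys) = - f (xs @ y # x # ys)"
    by cases (use assms(1)[of x y] assms(2)[of _ x y] assms(3)[of _ _ x y] assms(4)[of _ _ _ x y] in simp_all)
qed

text \<open>Antisymmetry carries any slot to the front, so linearity has to be checked in the first
  slot only.\<close>

lemma mlin_skewI:
  assumes f: "skew k f"
    and lin: "\<And>a u b w ys. length ys + 1 = k \<Longrightarrow> f ((a *\<^sub>R u + b *\<^sub>R w) # ys) = a * f (u # ys) + b * f (w # ys)"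
  shows "mlin k f"
  unfolding mlin_def
proof (intro allI impI)
  fix xs ys :: "H2 list" and u w :: H2 and a b :: real assume L: "length xs + length ys + 1 = k"
  have r: "f (xs @ z # ys) = (-1) ^ length xs * f (z # xs @ ys)" for z
  proof -
    have "f (z # xs @ ys) = (-1) ^ length xs * f (xs @ z # ys)"
      using skew_rotate[OF f, of "[]" xs ys z] L by simp
    then show ?thesis by (simp add: mult.assoc[symmetric] power_mult_distrib[symmetric])
  qed
  show "f (xs @ (a *\<^sub>R u + b *\<^sub>R w) # ys) = a * f (xs @ u # ys) + b * f (xs @ w # ys)"
    unfolding r using lin[of "xs @ ys" a u b w] L by (simp add: algebra_simps)
qed

lemma is_form_at_nrmI:
  assumes p: "p \<in> S7" and s: "skew k f" and m: "mlin k f"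
  shows "is_form_at p k (nrm p k f)"
proof (rule is_form_at_nrm[OF p])
  show "multilin_on (tangent p) k f" unfolding multilin_on_def using mlin_update[OF m] by blast
  show "alternating_on (tangent p) k f"
    unfolding alternating_on_def
  proof (intro allI impI)
    fix vs :: "H2 list" and i j assume "length vs = k" "i < j" "j < k" "vs ! i = vs ! j"
    then show "f vs = 0" using skew_repeat[OF s, of vs i j] by auto
  qed
qed

section \<open>The invariant forms\<close>

text \<open>Written-out wedge products; the digits are the degrees of the factors.\<close>

definition w111 :: "('a \<Rightarrow> real) \<Rightarrow> ('a \<Rightarrow> real) \<Rightarrow> ('a \<Rightarrow> real) \<Rightarrow> 'a \<Rightarrow> 'a \<Rightarrow> 'a \<Rightarrow> real" where
  "w111 x y z u v w = x u * (y v * z w - y w * z v) - x v * (y u * z w - y w * z u)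
     + x w * (y u * z v - y v * z u)"

definition w12 :: "('a \<Rightarrow> real) \<Rightarrow> ('a \<Rightarrow> 'a \<Rightarrow> real) \<Rightarrow> 'a \<Rightarrow> 'a \<Rightarrow> 'a \<Rightarrow> real" where
  "w12 x t u v w = x u * t v w - x v * t u w + x w * t u v"

definition w211 :: "('a \<Rightarrow> 'a \<Rightarrow> real) \<Rightarrow> ('a \<Rightarrow> real) \<Rightarrow> ('a \<Rightarrow> real) \<Rightarrow> 'a \<Rightarrow> 'a \<Rightarrow> 'a \<Rightarrow> 'a \<Rightarrow> real" where
  "w211 t x y u v w z = t u v * (x w * y z - x z * y w) - t u w * (x v * y z - x z * y v)
     + t u z * (x v * y w - x w * y v) + t v w * (x u * y z - x z * y u)
     - t v z * (x u * y w - x w * y u) + t w z * (x u * y v - x v * y u)"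

definition w22 :: "('a \<Rightarrow> 'a \<Rightarrow> real) \<Rightarrow> ('a \<Rightarrow> 'a \<Rightarrow> real) \<Rightarrow> 'a \<Rightarrow> 'a \<Rightarrow> 'a \<Rightarrow> 'a \<Rightarrow> real" where
  "w22 s t u v w z = s u v * t w z - s u w * t v z + s u z * t v w + s v w * t u z - s v z * t u w + s w z * t u v"

definition w122 :: "('a \<Rightarrow> real) \<Rightarrow> ('a \<Rightarrow> 'a \<Rightarrow> real) \<Rightarrow> ('a \<Rightarrow> 'a \<Rightarrow> real) \<Rightarrow> 'a \<Rightarrow> 'a \<Rightarrow> 'a \<Rightarrow> 'a \<Rightarrow> 'a \<Rightarrow> real" where
  "w122 x s t a b c d e = x a * w22 s t b c d e - x b * w22 s t a c d e + x c * w22 s t a b d e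
     - x d * w22 s t a b c e + x e * w22 s t a b c d"

definition Om2 :: "real \<Rightarrow> real \<Rightarrow> dform" where
  "Om2 x y p vs = x * th 1 (vs ! 0) (vs ! 1)
     + y * (th 2 p (vs ! 0) * th 3 p (vs ! 1) - th 2 p (vs ! 1) * th 3 p (vs ! 0))"

text \<open>With \<open>\<omega>\<^sub>i\<close> the horizontal part of \<open>th i\<close>, this is
  \<open>a \<eta>\<^sub>1\<eta>\<^sub>2\<eta>\<^sub>3 + b \<eta>\<^sub>1\<omega>\<^sub>1 + c (\<eta>\<^sub>2\<omega>\<^sub>2 + \<eta>\<^sub>3\<omega>\<^sub>3) + e (\<eta>\<^sub>2\<omega>\<^sub>3 - \<eta>\<^sub>3\<omega>\<^sub>2)\<close>; replacing \<open>\<omega>\<^sub>i\<close> by \<open>th i\<close> shifts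
  the first coefficient to \<open>a + b + 2 c\<close>.\<close>

definition Phi :: "real \<Rightarrow> real \<Rightarrow> real \<Rightarrow> real \<Rightarrow> dform" where
  "Phi a b c e p vs = (let u = vs ! 0; v = vs ! 1; w = vs ! 2 in
     (a + b + 2 * c) * w111 (th 1 p) (th 2 p) (th 3 p) u v w
     + b * w12 (th 1 p) (th 1) u v w + c * (w12 (th 2 p) (th 2) u v w + w12 (th 3 p) (th 3) u v w)
     + e * (w12 (th 2 p) (th 3) u v w - w12 (th 3 p) (th 2) u v w))"

text \<open>The parameters are redundant on purpose. Since \<open>th i\<close> is its horizontal
  part minus the product of the other two contact forms in cyclic order, and the three horizontal
  parts have equal squares, the values on tangent vectors depend only on z + 2 z', x - z, x' - z'
  and y. The redundancy allows the star and the exterior derivative of \<open>Phi\<close> to be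
  written without converting between \<open>th i\<close> and its horizontal part.\<close>

definition Psi :: "real \<Rightarrow> real \<Rightarrow> real \<Rightarrow> real \<Rightarrow> real \<Rightarrow> dform" where
  "Psi z z' x x' y p vs = (let u = vs ! 0; v = vs ! 1; w = vs ! 2; r = vs ! 3 in
     (z / 2) * w22 (th 1) (th 1) u v w r + (z' / 2) * (w22 (th 2) (th 2) u v w r + w22 (th 3) (th 3) u v w r)
     + x * w211 (th 1) (th 2 p) (th 3 p) u v w r
     + x' * (w211 (th 2) (th 3 p) (th 1 p) u v w r + w211 (th 3) (th 1 p) (th 2 p) u v w r)
     + y * (w211 (th 3) (th 3 p) (th 1 p) u v w r - w211 (th 2) (th 1 p) (th 2 p) u v w r))"

definition Om5 :: "real \<Rightarrow> real \<Rightarrow> dform" where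
  "Om5 x y p vs = (let u = vs ! 0; v = vs ! 1; w = vs ! 2; r = vs ! 3; q = vs ! 4 in
     2 * x * (w122 (th 3 p) (th 1) (th 2) u v w r q - w122 (th 2 p) (th 1) (th 3) u v w r q)
     + 2 * y * (w122 (th 1 p) (th 3) (th 3) u v w r q + w122 (th 1 p) (th 2) (th 2) u v w r q
        - w122 (th 3 p) (th 1) (th 3) u v w r q - w122 (th 2 p) (th 1) (th 2) u v w r q))"

lemma w111_skew: "w111 x y z v u w = - w111 x y z u v w" "w111 x y z u w v = - w111 x y z u v w"
  by (simp_all add: w111_def algebra_simps)

context
  fixes s t :: "'a \<Rightarrow> 'a \<Rightarrow> real"
  assumes t: "\<And>u v. t v u = - t u v" and s: "\<And>u v. s v u = - s u v"
begin

lemma w12_skew: "w12 x t v u w = - w12 x t u v w" "w12 x t u w v = - w12 x t u v w"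
  by (simp_all add: w12_def t[of u v] t[of v w])

lemma w211_skew: "w211 t x y v u w z = - w211 t x y u v w z" "w211 t x y u w v z = - w211 t x y u v w z"
    "w211 t x y u v z w = - w211 t x y u v w z"
  by (simp_all add: w211_def t[of u v] t[of v w] t[of w z] algebra_simps)

lemma w22_skew: "w22 s t v u w z = - w22 s t u v w z" "w22 s t u w v z = - w22 s t u v w z"
    "w22 s t u v z w = - w22 s t u v w z"
  by (simp_all add: w22_def t[of u v] t[of v w] t[of w z] s[of u v] s[of v w] s[of w z] algebra_simps)

lemma w122_skew: "w122 x s t b a c d e = - w122 x s t a b c d e" "w122 x s t a c b d e = - w122 x s t a b c d e"
    "w122 x s t a b d c e = - w122 x s t a b c d e" "w122 x s t a b c e d = - w122 x s t a b c d e"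
  by (simp_all add: w122_def w22_def t[of a b] t[of b c] t[of c d] t[of d e]
      s[of a b] s[of b c] s[of c d] s[of d e] algebra_simps)

end

lemmas th_w12_skew = w12_skew[OF th_skew th_skew]
  and th_w211_skew = w211_skew[OF th_skew th_skew]
  and th_w22_skew = w22_skew[OF th_skew th_skew]
  and th_w122_skew = w122_skew[OF th_skew th_skew]

lemma skew_Om2: "skew 2 (Om2 x y p)"
proof (rule skew2I)
  fix u v show "Om2 x y p [u, v] = - Om2 x y p [v, u]"
    by (simp add: Om2_def th_skew[of _ v u] algebra_simps)
qed

lemma skew_Phi: "skew 3 (Phi a b c e p)"
proof (rule skew3I)
  fix x y z
  show "Phi a b c e p [x, y, z] = - Phi a b c e p [y, x, z]"
    by (simp add: Phi_def w111_skew(1)[where u = x and v = y] th_w12_skew(1)[where u = x and v = y] algebra_simps)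
  show "Phi a b c e p [z, x, y] = - Phi a b c e p [z, y, x]"
    by (simp add: Phi_def w111_skew(2)[where v = x and w = y] th_w12_skew(2)[where v = x and w = y] algebra_simps)
qed

lemma skew_Psi: "skew 4 (Psi z z' x x' y p)"
proof (rule skew4I)
  fix u v a b
  show "Psi z z' x x' y p [u, v, a, b] = - Psi z z' x x' y p [v, u, a, b]"
    by (simp add: Psi_def th_w22_skew(1)[where u = u and v = v] th_w211_skew(1)[where u = u and v = v] algebra_simps)
  show "Psi z z' x x' y p [a, u, v, b] = - Psi z z' x x' y p [a, v, u, b]"
    by (simp add: Psi_def th_w22_skew(2)[where v = u and w = v] th_w211_skew(2)[where v = u and w = v] algebra_simps)
  show "Psi z z' x x' y p [a, b, u, v] = - Psi z z' x x' y p [a, b, v, u]"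
    by (simp add: Psi_def th_w22_skew(3)[where w = u and z = v] th_w211_skew(3)[where w = u and z = v] algebra_simps)
qed

lemma skew_Om5: "skew 5 (Om5 x y p)"
proof (rule skew5I)
  fix u v a b c
  show "Om5 x y p [u, v, a, b, c] = - Om5 x y p [v, u, a, b, c]"
    by (simp add: Om5_def th_w122_skew(1)[where a = u and b = v] algebra_simps)
  show "Om5 x y p [a, u, v, b, c] = - Om5 x y p [a, v, u, b, c]"
    by (simp add: Om5_def th_w122_skew(2)[where b = u and c = v] algebra_simps)
  show "Om5 x y p [a, b, u, v, c] = - Om5 x y p [a, b, v, u, c]"
    by (simp add: Om5_def th_w122_skew(3)[where c = u and d = v] algebra_simps)
  show "Om5 x y p [a, b, c, u, v] = - Om5 x y p [a, b, c, v, u]"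
    by (simp add: Om5_def th_w122_skew(4)[where d = u and e = v] algebra_simps)
qed

lemma w_lin_first:
  fixes x :: "'a::real_vector \<Rightarrow> real"
  assumes x: "\<And>a u b v. x (a *\<^sub>R u + b *\<^sub>R v) = a * x u + b * x v"
    and y: "\<And>a u b v. y (a *\<^sub>R u + b *\<^sub>R v) = a * y u + b * y v"
    and z: "\<And>a u b v. z (a *\<^sub>R u + b *\<^sub>R v) = a * z u + b * z v"
    and t: "\<And>a u b v w. t (a *\<^sub>R u + b *\<^sub>R v) w = a * t u w + b * t v w"
    and s: "\<And>a u b v w. s (a *\<^sub>R u + b *\<^sub>R v) w = a * s u w + b * s v w"
  shows "w111 x y z (\<alpha> *\<^sub>R u + \<beta> *\<^sub>R v) k l = \<alpha> * w111 x y z u k l + \<beta> * w111 x y z v k l"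
    "w12 x t (\<alpha> *\<^sub>R u + \<beta> *\<^sub>R v) k l = \<alpha> * w12 x t u k l + \<beta> * w12 x t v k l"
    "w211 t x y (\<alpha> *\<^sub>R u + \<beta> *\<^sub>R v) k l m = \<alpha> * w211 t x y u k l m + \<beta> * w211 t x y v k l m"
    "w22 s t (\<alpha> *\<^sub>R u + \<beta> *\<^sub>R v) k l m = \<alpha> * w22 s t u k l m + \<beta> * w22 s t v k l m"
    "w122 x s t (\<alpha> *\<^sub>R u + \<beta> *\<^sub>R v) k l m n = \<alpha> * w122 x s t u k l m n + \<beta> * w122 x s t v k l m n"
  by (simp_all add: w111_def w12_def w211_def w22_def w122_def x y z t s algebra_simps)

lemmas th_lin_first = w_lin_first[where x = "th i p" and y = "th j p" and z = "th k p" and t = "th l" and s = "th m"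
    for i j k l m p, OF th_lin_right th_lin_right th_lin_right th_lin_left th_lin_left]

lemma mlin_Om2: "mlin 2 (Om2 x y p)"
  by (rule mlin_skewI[OF skew_Om2])
    (simp add: Om2_def th_lin_left th_lin_right algebra_simps)

lemma mlin_Phi: "mlin 3 (Phi a b c e p)"
  by (rule mlin_skewI[OF skew_Phi])
    (simp add: Phi_def Let_def th_lin_first algebra_simps)

lemma mlin_Psi: "mlin 4 (Psi z z' x x' y p)"
  by (rule mlin_skewI[OF skew_Psi])
    (simp add: Psi_def Let_def th_lin_first add_divide_distrib algebra_simps)

lemma mlin_Om5: "mlin 5 (Om5 x y p)"
  by (rule mlin_skewI[OF skew_Om5])
    (simp add: Om5_def Let_def th_lin_first algebra_simps)

section \<open>Invariance and frame values of the explicit forms\<close>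

lemma th_forms_hiso:
  assumes g: "hiso g"
  shows "length vs = 2 \<Longrightarrow> Om2 x y (g p) (map g vs) = Om2 x y p vs"
    "length vs = 3 \<Longrightarrow> Phi a b c e (g p) (map g vs) = Phi a b c e p vs"
    "length vs = 4 \<Longrightarrow> Psi z z' x x' y (g p) (map g vs) = Psi z z' x x' y p vs"
    "length vs = 5 \<Longrightarrow> Om5 x y (g p) (map g vs) = Om5 x y p vs"
  by (simp_all add: Om2_def Phi_def Psi_def Om5_def Let_def w111_def w12_def w211_def w22_def w122_def hiso_th[OF g])

lemma tproj_hiso: "hiso g \<Longrightarrow> tproj (g p) (g v) = g (tproj p v)"
  unfolding hiso_def tproj_def by (metis linear_diff linear_scale)

lemma nrm_hiso:
  assumes "hiso g" "\<And>vs. length vs = k \<Longrightarrow> F (g p) (map g vs) = F p vs"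
  shows "nrm (g p) k (F (g p)) (map g vs) = nrm p k (F p) vs"
proof -
  have "map (tproj (g p)) (map g vs) = map g (map (tproj p) vs)"
    using tproj_hiso[OF assms(1)] by simp
  then show ?thesis using assms(2)[of "map (tproj p) vs"] by (simp only: nrm_def length_map split: if_split) simp
qed

definition nPhi :: "real \<Rightarrow> real \<Rightarrow> real \<Rightarrow> real \<Rightarrow> dform" where
  "nPhi a b c e p = nrm p 3 (Phi a b c e p)"

definition nPsi :: "real \<Rightarrow> real \<Rightarrow> real \<Rightarrow> real \<Rightarrow> real \<Rightarrow> dform" where
  "nPsi z z' x x' y p = nrm p 4 (Psi z z' x x' y p)"

definition nOm5 :: "real \<Rightarrow> real \<Rightarrow> dform" where
  "nOm5 x y p = nrm p 5 (Om5 x y p)"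

definition nOm2 :: "real \<Rightarrow> real \<Rightarrow> dform" where
  "nOm2 x y p = nrm p 2 (Om2 x y p)"

lemma is_form_at_th_forms:
  assumes "p \<in> S7"
  shows "is_form_at p 2 (nOm2 x y p)" "is_form_at p 3 (nPhi a b c e p)"
    "is_form_at p 4 (nPsi z z' x x' y p)" "is_form_at p 5 (nOm5 x y p)"
  unfolding nOm2_def nPhi_def nPsi_def nOm5_def
  by (intro is_form_at_nrmI assms skew_Om2 skew_Phi skew_Psi skew_Om5 mlin_Om2 mlin_Phi mlin_Psi mlin_Om5)+

lemma nforms_hiso:
  assumes "hiso g"
  shows "nOm2 x y (g p) (map g vs) = nOm2 x y p vs" "nPhi a b c e (g p) (map g vs) = nPhi a b c e p vs"
    "nPsi z z' x x' y (g p) (map g vs) = nPsi z z' x x' y p vs" "nOm5 x y (g p) (map g vs) = nOm5 x y p vs"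
  unfolding nOm2_def nPhi_def nPsi_def nOm5_def
  by (rule nrm_hiso[OF assms], rule th_forms_hiso[OF assms], assumption)+

lemma E0_tangent: "set js \<subseteq> {..<7} \<Longrightarrow> set (map E0 js) \<subseteq> tangent p0"
  using tbasis_E0 by (auto simp: tbasis_def)

text \<open>In the dual frame with indices 0 to 6 the table says that \<open>th 1\<close>,
  \<open>th 2\<close>, \<open>th 3\<close> are e34 - e56 - e12, e35 + e46 + e02 and e36 - e45 - e01.
  The last term of each is the vertical part.\<close>

lemma th_E0:
  shows "th (Suc 0) p0 (E0 0) = 1" "th (Suc 0) p0 (E0 (Suc 0)) = 0" "th (Suc 0) p0 (E0 2) = 0"
    "th (Suc 0) p0 (E0 3) = 0" "th (Suc 0) p0 (E0 4) = 0" "th (Suc 0) p0 (E0 5) = 0"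
    "th (Suc 0) p0 (E0 6) = 0" "th 2 p0 (E0 0) = 0" "th 2 p0 (E0 (Suc 0)) = 1"
    "th 2 p0 (E0 2) = 0" "th 2 p0 (E0 3) = 0" "th 2 p0 (E0 4) = 0"
    "th 2 p0 (E0 5) = 0" "th 2 p0 (E0 6) = 0" "th 3 p0 (E0 0) = 0"
    "th 3 p0 (E0 (Suc 0)) = 0" "th 3 p0 (E0 2) = 1" "th 3 p0 (E0 3) = 0"
    "th 3 p0 (E0 4) = 0" "th 3 p0 (E0 5) = 0" "th 3 p0 (E0 6) = 0"
    "th (Suc 0) (E0 0) (E0 (Suc 0)) = 0" "th (Suc 0) (E0 0) (E0 2) = 0" "th (Suc 0) (E0 0) (E0 3) = 0"
    "th (Suc 0) (E0 0) (E0 4) = 0" "th (Suc 0) (E0 0) (E0 5) = 0" "th (Suc 0) (E0 0) (E0 6) = 0"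
    "th (Suc 0) (E0 (Suc 0)) (E0 2) = - 1" "th (Suc 0) (E0 (Suc 0)) (E0 3) = 0" "th (Suc 0) (E0 (Suc 0)) (E0 4) = 0"
    "th (Suc 0) (E0 (Suc 0)) (E0 5) = 0" "th (Suc 0) (E0 (Suc 0)) (E0 6) = 0" "th (Suc 0) (E0 2) (E0 3) = 0"
    "th (Suc 0) (E0 2) (E0 4) = 0" "th (Suc 0) (E0 2) (E0 5) = 0" "th (Suc 0) (E0 2) (E0 6) = 0"
    "th (Suc 0) (E0 3) (E0 4) = 1" "th (Suc 0) (E0 3) (E0 5) = 0" "th (Suc 0) (E0 3) (E0 6) = 0"
    "th (Suc 0) (E0 4) (E0 5) = 0" "th (Suc 0) (E0 4) (E0 6) = 0" "th (Suc 0) (E0 5) (E0 6) = - 1"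
    "th 2 (E0 0) (E0 (Suc 0)) = 0" "th 2 (E0 0) (E0 2) = 1" "th 2 (E0 0) (E0 3) = 0"
    "th 2 (E0 0) (E0 4) = 0" "th 2 (E0 0) (E0 5) = 0" "th 2 (E0 0) (E0 6) = 0"
    "th 2 (E0 (Suc 0)) (E0 2) = 0" "th 2 (E0 (Suc 0)) (E0 3) = 0" "th 2 (E0 (Suc 0)) (E0 4) = 0"
    "th 2 (E0 (Suc 0)) (E0 5) = 0" "th 2 (E0 (Suc 0)) (E0 6) = 0" "th 2 (E0 2) (E0 3) = 0"
    "th 2 (E0 2) (E0 4) = 0" "th 2 (E0 2) (E0 5) = 0" "th 2 (E0 2) (E0 6) = 0"
    "th 2 (E0 3) (E0 4) = 0" "th 2 (E0 3) (E0 5) = 1" "th 2 (E0 3) (E0 6) = 0"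
    "th 2 (E0 4) (E0 5) = 0" "th 2 (E0 4) (E0 6) = 1" "th 2 (E0 5) (E0 6) = 0"
    "th 3 (E0 0) (E0 (Suc 0)) = - 1" "th 3 (E0 0) (E0 2) = 0" "th 3 (E0 0) (E0 3) = 0"
    "th 3 (E0 0) (E0 4) = 0" "th 3 (E0 0) (E0 5) = 0" "th 3 (E0 0) (E0 6) = 0"
    "th 3 (E0 (Suc 0)) (E0 2) = 0" "th 3 (E0 (Suc 0)) (E0 3) = 0" "th 3 (E0 (Suc 0)) (E0 4) = 0"
    "th 3 (E0 (Suc 0)) (E0 5) = 0" "th 3 (E0 (Suc 0)) (E0 6) = 0" "th 3 (E0 2) (E0 3) = 0"
    "th 3 (E0 2) (E0 4) = 0" "th 3 (E0 2) (E0 5) = 0" "th 3 (E0 2) (E0 6) = 0"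
    "th 3 (E0 3) (E0 4) = 0" "th 3 (E0 3) (E0 5) = 0" "th 3 (E0 3) (E0 6) = 1"
    "th 3 (E0 4) (E0 5) = - 1" "th 3 (E0 4) (E0 6) = 0" "th 3 (E0 5) (E0 6) = 0"
  by (simp_all add: th_def JJ_def p0_def inner_prod_def)

lemma nforms_E0:
  assumes "set js \<subseteq> {..<7}"
  shows "length js = 2 \<Longrightarrow> nOm2 x y p0 (map E0 js) = Om2 x y p0 (map E0 js)"
    "length js = 3 \<Longrightarrow> nPhi a b c e p0 (map E0 js) = Phi a b c e p0 (map E0 js)"
    "length js = 4 \<Longrightarrow> nPsi z z' x x' y p0 (map E0 js) = Psi z z' x x' y p0 (map E0 js)"
    "length js = 5 \<Longrightarrow> nOm5 x y p0 (map E0 js) = Om5 x y p0 (map E0 js)"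
  unfolding nOm2_def nPhi_def nPsi_def nOm5_def
  by (intro nrm_tangent; use E0_tangent[OF assms] in simp)+

lemma shuf_numeral:
  "shuf 2 2 xs = shuf (Suc (Suc 0)) (Suc (Suc 0)) xs"
  "shuf 4 3 xs = shuf (Suc (Suc (Suc (Suc 0)))) (Suc (Suc (Suc 0))) xs"
  "shuf 3 4 xs = shuf (Suc (Suc (Suc 0))) (Suc (Suc (Suc (Suc 0)))) xs"
  "shuf 5 2 xs = shuf (Suc (Suc (Suc (Suc (Suc 0))))) (Suc (Suc 0)) xs"
  by (simp_all add: numeral_eq_Suc)

lemma wedge_2_2:
  assumes "skew 2 \<alpha>" "skew 2 \<beta>"
  shows "wedge 2 2 \<alpha> \<beta> [w, x, y, z] = \<alpha> [w, x] * \<beta> [y, z] - \<alpha> [w, y] * \<beta> [x, z] + \<alpha> [w, z] * \<beta> [x, y]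
    + \<alpha> [x, y] * \<beta> [w, z] - \<alpha> [x, z] * \<beta> [w, y] + \<alpha> [y, z] * \<beta> [w, x]"
  using wedge_shuf[OF assms, of "[z, y, x, w]" "\<lambda>v. v"] unfolding shuf_numeral by simp

lemma p0_S7: "p0 \<in> S7"
  by (simp add: p0_def norm_prod_def)

text \<open>Of the 35 shuffles only those survive whose complementary triple is a component of
  \<open>Phi\<close>.\<close>

lemma wedge_4_3_Phi:
  assumes "skew 4 \<psi>"
  shows "wedge 4 3 \<psi> (nPhi a b c e p0) (map E0 [0..<7]) =
     a * \<psi> (map E0 [3, 4, 5, 6]) + b * (\<psi> (map E0 [1, 2, 5, 6]) - \<psi> (map E0 [1, 2, 3, 4]))
     + c * (\<psi> (map E0 [0, 2, 3, 5]) + \<psi> (map E0 [0, 1, 4, 5]) + \<psi> (map E0 [0, 2, 4, 6]) - \<psi> (map E0 [0, 1, 3, 6]))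
     + e * (\<psi> (map E0 [0, 1, 3, 5]) + \<psi> (map E0 [0, 2, 3, 6]) + \<psi> (map E0 [0, 1, 4, 6]) - \<psi> (map E0 [0, 2, 4, 5]))"
    (is "_ = ?r")
proof -
  have "wedge 4 3 \<psi> (nPhi a b c e p0) (map E0 (rev [6, 5, 4, 3, 2, 1, 0])) =
    (\<Sum>(s, I, J)\<leftarrow>shuf 4 3 [6, 5, 4, 3, 2, 1, 0]. s * \<psi> (map E0 I) * nPhi a b c e p0 (map E0 J))"
    by (rule wedge_shuf[OF assms is_form_at_skew[OF p0_S7 is_form_at_th_forms(2)[OF p0_S7]]]) simp
  also have "(\<Sum>(s, I, J)\<leftarrow>shuf 4 3 [6, 5, 4, 3, 2, 1, 0]. s * \<psi> (map E0 I) * nPhi a b c e p0 (map E0 J)) =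
    (\<Sum>(s, I, J)\<leftarrow>shuf 4 3 [6, 5, 4, 3, 2, 1, 0]. s * \<psi> (map E0 I) * Phi a b c e p0 (map E0 J))"
    unfolding shuf_numeral by (simp add: nforms_E0(2)[of "[_, _, _]", simplified] del: E0_simps)
  also have "\<dots> = ?r"
    unfolding shuf_numeral by (simp add: Phi_def Let_def w111_def w12_def th_E0 del: E0_simps) (simp add: algebra_simps del: E0_simps)
  finally show ?thesis
    by (simp add: upt7 del: E0_simps)
qed

text \<open>The absence of mixed terms is what makes the metric diagonal in \<open>E0\<close>; the
  bilinear form is recovered from X = Y by polarisation. Because of the minus sign the volume form
  takes on this frame the sign opposite to \<open>a\<close>.\<close>

lemma wedge_contraction_Phi:
  assumes X: "X = ((0, x0, x1, x2), (x3, x4, x5, x6))"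
  shows "wedge 4 3 (wedge 2 2 (\<lambda>us. nPhi a b c e p0 (X # us)) (\<lambda>us. nPhi a b c e p0 (X # us))) (nPhi a b c e p0) (map E0 [0..<7])
    = - 6 * (a * b\<^sup>2 * x0\<^sup>2 + a * (c\<^sup>2 + e\<^sup>2) * (x1\<^sup>2 + x2\<^sup>2) + b * (c\<^sup>2 + e\<^sup>2) * (x3\<^sup>2 + x4\<^sup>2 + x5\<^sup>2 + x6\<^sup>2))"
proof -
  let ?\<alpha> = "\<lambda>us. nPhi a b c e p0 (X # us)"
  have XT: "X \<in> tangent p0" by (simp add: X tangent_def p0_def inner_prod_def)
  have s2: "skew 2 ?\<alpha>"
    using is_form_at_skew[OF p0_S7 is_form_at_th_forms(2)[OF p0_S7, of a b c e]]
    by (intro skew_Cons) (simp add: numeral_eq_Suc)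
  have s4: "skew 4 (wedge 2 2 ?\<alpha> ?\<alpha>)" using skew_wedge[of 2 2] by simp
  have n: "nPhi a b c e p0 [X, E0 i, E0 j] = Phi a b c e p0 [X, E0 i, E0 j]" if "i < 7" "j < 7" for i j
    using E0_tangent[of "[i, j]"] that XT unfolding nPhi_def by (intro nrm_tangent) auto
  have t: "th i X v = - th i v X" for i v by (rule th_skew)
  show ?thesis
    unfolding wedge_4_3_Phi[OF s4]
    apply (simp add: wedge_2_2[OF s2 s2] n del: E0_simps)
    apply (simp add: Phi_def Let_def w111_def w12_def th_E0 del: E0_simps)
    apply (simp add: th_def JJ_def p0_def X inner_prod_def)
    apply (simp add: algebra_simps power2_eq_square)
    done
qed

section \<open>The metric of a positive invariant form\<close>

lemma metric_at_sum_right: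
  assumes "metric_at p g"
  shows "g w (\<Sum>i\<in>I. c i *\<^sub>R e i) = (\<Sum>i\<in>I. c i * g w (e i))"
proof -
  have s: "g v u = g u v" for u v using assms unfolding metric_at_def by blast
  show ?thesis unfolding s[of w] by (rule metric_at_lin[OF assms])
qed

lemma metric_at_add:
  assumes "metric_at p g"
  shows "g (u + v) w = g u w + g v w" "g w (u + v) = g w u + g w v" "g (u - v) w = g u w - g v w"
    "g w (u - v) = g w u - g w v" "g (a *\<^sub>R u) w = a * g u w" "g w (a *\<^sub>R u) = a * g w u"
proof -
  have "bilinear g" using assms unfolding metric_at_def by blast
  then show "g (u + v) w = g u w + g v w" "g w (u + v) = g w u + g w v" "g (u - v) w = g u w - g v w"
    "g w (u - v) = g w u - g w v" "g (a *\<^sub>R u) w = a * g u w" "g w (a *\<^sub>R u) = a * g w u"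
    by (simp_all add: bilinear_ladd bilinear_radd bilinear_lsub bilinear_rsub bilinear_lmul bilinear_rmul)
qed

lemma subspace_tangent: "subspace (tangent p)"
  by (auto simp: subspace_def tangent_def inner_add_left)

text \<open>Gram-Schmidt. \<open>volform_at\<close> constrains the volume form only on orthonormal
  frames, so one has to exist before that condition says anything.\<close>

lemma onb_exists:
  assumes p: "p \<in> S7" and g: "metric_at p g"
  shows "\<exists>e. onb p g e"
proof -
  have "\<exists>e. (\<forall>i<k. e i \<in> tangent p) \<and> (\<forall>i<k. \<forall>j<k. g (e i) (e j) = (if i = j then 1 else 0))" if "k \<le> 7" for k :: nat
    using that
  proof (induction k)
    case (Suc k)
    then obtain e where e: "\<And>i. i < k \<Longrightarrow> e i \<in> tangent p"
      "\<And>i j. i < k \<Longrightarrow> j < k \<Longrightarrow> g (e i) (e j) = (if i = j then 1 else 0)" by auto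
    let ?B = "e ` {..<k}"
    have "dim (span ?B) \<le> k"
      using dim_le_card'[of ?B] card_image_le[of "{..<k}" e] by (simp add: dim_span)
    then have "\<not> tangent p \<subseteq> span ?B"
      using dim_subset[of "tangent p" "span ?B"] tangent_dim[OF p] Suc.prems by auto
    then obtain v where v: "v \<in> tangent p" "v \<notin> span ?B" by blast
    define w where "w = v - (\<Sum>i<k. g v (e i) *\<^sub>R e i)"
    have wT: "w \<in> tangent p"
      unfolding w_def by (intro subspace_diff subspace_sum subspace_scale subspace_tangent v e) auto
    have "(\<Sum>i<k. g v (e i) *\<^sub>R e i) \<in> span ?B" by (intro span_sum span_scale span_base) auto
    then have "w \<noteq> 0" using v(2) by (auto simp: w_def)
    then have ww: "g w w > 0" using g wT unfolding metric_at_def by blast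
    have sym: "g x y = g y x" for x y using g unfolding metric_at_def by blast
    have we: "g w (e j) = 0" if "j < k" for j
    proof -
      have "g (\<Sum>i<k. g v (e i) *\<^sub>R e i) (e j) = (\<Sum>i<k. if i = j then g v (e j) else 0)"
        unfolding metric_at_lin[OF g] using that by (intro sum.cong refl) (auto simp: e(2))
      then show ?thesis using that by (simp add: w_def metric_at_add[OF g])
    qed
    define e' where "e' = e(k := (1 / sqrt (g w w)) *\<^sub>R w)"
    have "e' i \<in> tangent p" if "i < Suc k" for i
      using that e(1) wT by (auto simp: e'_def less_Suc_eq intro!: subspace_scale[OF subspace_tangent])
    moreover have "g (e' i) (e' j) = (if i = j then 1 else 0)" if "i < Suc k" "j < Suc k" for i j
    proof -
      have ew: "g (e j) w = 0" if "j < k" for j using we[OF that] sym[of w "e j"] by simp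
      have ww1: "g ((1 / sqrt (g w w)) *\<^sub>R w) ((1 / sqrt (g w w)) *\<^sub>R w) = 1"
        using ww by (simp add: metric_at_add[OF g])
      show ?thesis
      proof (cases "i = k"; cases "j = k")
        assume "i = k" "j = k" then show ?thesis using ww1 by (simp add: e'_def)
      next
        assume "i = k" "j \<noteq> k" then show ?thesis using that we by (simp add: e'_def metric_at_add[OF g])
      next
        assume "i \<noteq> k" "j = k" then show ?thesis using that ew by (simp add: e'_def metric_at_add[OF g])
      next
        assume "i \<noteq> k" "j \<noteq> k" then show ?thesis using that e(2)[of i j] by (simp add: e'_def)
      qed
    qed
    ultimately show ?case by blast
  qed simp
  from this[of 7] show ?thesis unfolding onb_def by blast
qed

lemma wedge_map: "wedge k l \<alpha> \<beta> (map h vs) = wedge k l (\<lambda>us. \<alpha> (map h us)) (\<lambda>us. \<beta> (map h us)) vs"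
proof (cases "length vs = k + l")
  case True
  have 2: "perm_list (map h vs) \<sigma> = map h (perm_list vs \<sigma>)" if "\<sigma> permutes {..<k + l}" for \<sigma>
    using True that by (simp add: perm_list_map)
  show ?thesis using True by (simp add: wedge_perm_list 2 take_map drop_map)
qed (simp add: wedge_def)

text \<open>In the frame \<^const>\<open>E0\<close> the metric of \<open>Phi a b c e\<close> is diagonal with entries \<open>diag a b c e\<close>, found
  by solving \<open>\<iota>\<^sub>X\<phi> \<and> \<iota>\<^sub>Y\<phi> \<and> \<phi> = 6 g(X,Y) vol\<close> on frame vectors.\<close>

definition rad :: "real \<Rightarrow> real \<Rightarrow> real \<Rightarrow> real \<Rightarrow> real" where
  "rad a b c e = root 3 (b * (c\<^sup>2 + e\<^sup>2) / a)"

definition diag :: "real \<Rightarrow> real \<Rightarrow> real \<Rightarrow> real \<Rightarrow> nat \<Rightarrow> real" where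
  "diag a b c e i = (let T = rad a b c e in
     if i = 0 then b\<^sup>2 / T\<^sup>2 else if i < 3 then (c\<^sup>2 + e\<^sup>2) / T\<^sup>2 else T)"

lemma cube_inject:
  assumes "x ^ 3 = (y::real) ^ 3"
  shows "x = y"
proof -
  have "x = root 3 (x ^ 3)" by (rule odd_real_root_power_cancel[symmetric]) simp
  also have "\<dots> = root 3 (y ^ 3)" unfolding assms ..
  also have "\<dots> = y" by (rule odd_real_root_power_cancel) simp
  finally show ?thesis .
qed

text \<open>The defining identity fixes the metric up to one unknown \<nu>, the value of the volume
  form on the frame: with r = c^2 + e^2 the squared lengths are - a b^2, - a r and - b r, each
  divided by \<nu>. That \<open>vol\<close> is a unit volume form for this metric then gives an
  equation for \<nu> alone.\<close>

lemma pos_frame: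
  assumes h: "hiso h" and p: "p = h p0" and pos: "pos_at p (nPhi a b c e p) g vol"
  defines "E \<equiv> (\<lambda>i. h (E0 i))"
  shows "a * b > 0" "c\<^sup>2 + e\<^sup>2 > 0" "orthog p g E (diag a b c e)" "vol (map E [0..<7]) = - (a * (rad a b c e)\<^sup>2)"
proof -
  have pS: "p \<in> S7" using hiso_norm[OF h, of p0] p0_S7 by (simp add: p)
  have g: "metric_at p g" and vol: "is_form_at p 7 vol"
    and vol1: "\<And>e. onb p g e \<Longrightarrow> \<bar>vol (map e [0..<7])\<bar> = 1"
    using pos unfolding pos_at_def volform_at_def by blast+
  have T: "tbasis p E" unfolding E_def p by (rule hiso_tbasis[OF h tbasis_E0])
  then have ET: "E i \<in> tangent p" if "i < 7" for i using that by (simp add: tbasis_def)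
  define \<nu> where "\<nu> = vol (map E [0..<7])"
  define r where "r = c\<^sup>2 + e\<^sup>2"
  note mv = is_form_at_mlin[OF pS vol] and sv = is_form_at_skew[OF pS vol]
  \<comment> \<open>A top-degree form vanishing on the frame is zero, against its value on an
    orthonormal frame.\<close>
  have \<nu>0: "\<nu> \<noteq> 0"
  proof
    assume "\<nu> = 0"
    have "vol = (\<lambda>vs. 0 * vol vs)"
    proof (rule form_ext[OF pS vol is_form_at_scale[OF pS vol] T])
      have "set (incs 7 [0..<7]) = {[0..<7]}" by (simp add: upt_rec numeral_eq_Suc)
      then show "\<forall>js\<in>set (incs 7 [0..<7]). vol (map E js) = 0 * vol (map E js)"
        using \<open>\<nu> = 0\<close> by (simp add: \<nu>_def)
    qed
    then have "vol vs = 0" for vs by (metis mult_zero_left)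
    moreover obtain e where "onb p g e" using onb_exists[OF pS g] by blast
    ultimately show False using vol1[of e] by simp
  qed
  have Q: "g (h X) (h X) * \<nu> = - (a * b\<^sup>2 * x0\<^sup>2 + a * r * (x1\<^sup>2 + x2\<^sup>2) + b * r * (x3\<^sup>2 + x4\<^sup>2 + x5\<^sup>2 + x6\<^sup>2))"
    if X: "X = ((0, x0, x1, x2), (x3, x4, x5, x6))" for X x0 x1 x2 x3 x4 x5 x6
  proof -
    have "X \<in> tangent p0" by (simp add: X tangent_def p0_def inner_prod_def)
    then have hX: "h X \<in> tangent p" using hiso_tangent[OF h] by (simp add: p)
    have "set (map E [0..<7]) \<subseteq> tangent p" using ET by auto
    then have "g (h X) (h X) * \<nu> = (1/6) * wedge 4 3 (wedge 2 2 (\<lambda>us. nPhi a b c e p (h X # us)) (\<lambda>us. nPhi a b c e p (h X # us))) (nPhi a b c e p) (map E [0..<7])"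
      using pos hX unfolding pos_at_def \<nu>_def by (metis length_map length_upt minus_nat.diff_0)
    also have "map E [0..<7] = map h (map E0 [0..<7])" by (simp add: E_def)
    also have "wedge 4 3 (wedge 2 2 (\<lambda>us. nPhi a b c e p (h X # us)) (\<lambda>us. nPhi a b c e p (h X # us))) (nPhi a b c e p) (map h (map E0 [0..<7]))
      = wedge 4 3 (wedge 2 2 (\<lambda>us. nPhi a b c e p0 (X # us)) (\<lambda>us. nPhi a b c e p0 (X # us))) (nPhi a b c e p0) (map E0 [0..<7])"
    proof -
      have 1: "nPhi a b c e p (map h us) = nPhi a b c e p0 us" for us
        unfolding p by (rule nforms_hiso(2)[OF h])
      have 2: "nPhi a b c e p (h X # map h us) = nPhi a b c e p0 (X # us)" for us
        using 1[of "X # us"] by simp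
      have 3: "wedge 2 2 (\<lambda>us. nPhi a b c e p (h X # us)) (\<lambda>us. nPhi a b c e p (h X # us)) (map h us)
          = wedge 2 2 (\<lambda>us. nPhi a b c e p0 (X # us)) (\<lambda>us. nPhi a b c e p0 (X # us)) us" for us
        unfolding wedge_map 2 ..
      show ?thesis unfolding wedge_map[of 4 3 _ _ h "map E0 [0..<7]"] 3 1 ..
    qed
    also have "\<dots> = - 6 * (a * b\<^sup>2 * x0\<^sup>2 + a * r * (x1\<^sup>2 + x2\<^sup>2) + b * r * (x3\<^sup>2 + x4\<^sup>2 + x5\<^sup>2 + x6\<^sup>2))"
      unfolding r_def by (rule wedge_contraction_Phi[OF X])
    finally show ?thesis by simp
  qed
  define D where "D i = (if i = 0 then - (a * b\<^sup>2) / \<nu> else if i < 3 then - (a * r) / \<nu> else - (b * r) / \<nu>)" for i :: nat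
  have lin: "linear h" using h by (simp add: hiso_def)
  have sym: "g u v = g v u" for u v using g unfolding metric_at_def by blast
  have Q7: "g (\<Sum>i<7. x i *\<^sub>R E i) (\<Sum>i<7. x i *\<^sub>R E i) = (\<Sum>i<7. D i * (x i)\<^sup>2)" for x
  proof -
    have "(\<Sum>i<7. x i *\<^sub>R E i) = h (\<Sum>i<7. x i *\<^sub>R E0 i)"
      using linear_sum[OF lin, of "\<lambda>i. x i *\<^sub>R E0 i" "{..<7}"] linear_scale[OF lin] by (simp add: E_def)
    also have "(\<Sum>i<7. x i *\<^sub>R E0 i) = ((0, x 0, x 1, x 2), (x 3, x 4, x 5, x 6))"
      unfolding sum_lessThan7 by simp
    finally have e: "(\<Sum>i<7. x i *\<^sub>R E i) = h ((0, x 0, x 1, x 2), (x 3, x 4, x 5, x 6))" .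
    have D\<nu>: "D i * \<nu> = (if i = 0 then - (a * b\<^sup>2) else if i < 3 then - (a * r) else - (b * r))" for i
      using \<nu>0 by (simp add: D_def)
    have "(\<Sum>i<7. D i * (x i)\<^sup>2) * \<nu> = (\<Sum>i<7. (D i * \<nu>) * (x i)\<^sup>2)"
      unfolding sum_distrib_right by (intro sum.cong refl) simp
    also have "\<dots> = g (\<Sum>i<7. x i *\<^sub>R E i) (\<Sum>i<7. x i *\<^sub>R E i) * \<nu>"
      unfolding D\<nu> e Q[OF refl] unfolding sum_lessThan7 by (simp add: algebra_simps)
    finally show ?thesis using \<nu>0 by simp
  qed
  have delta: "(\<Sum>k<7. (if k = i then 1 else 0) *\<^sub>R E k) = E i" if "i < 7" for i
    using that by (simp add: if_distrib[of "\<lambda>x. x *\<^sub>R _"] cong: if_cong)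
  have diagD: "g (E i) (E i) = D i" if "i < 7" for i
    using Q7[of "\<lambda>k. if k = i then 1 else 0"] that unfolding delta[OF that]
    by (simp add: if_distrib[of "\<lambda>x. x\<^sup>2"] if_distrib[of "\<lambda>x. _ * x"] cong: if_cong)
  have off: "g (E i) (E j) = 0" if "i \<noteq> j" "i < 7" "j < 7" for i j
  proof -
    \<comment> \<open>Polarisation: the vector E i + E j isolates the mixed entry.\<close>
    define x where "x k = (if k = i then 1 else 0) + (if k = j then 1 else (0::real))" for k
    have 1: "(\<Sum>k<7. x k *\<^sub>R E k) = E i + E j"
      unfolding x_def scaleR_left_distrib sum.distrib delta[OF that(2)] delta[OF that(3)] ..
    have "D k * (x k)\<^sup>2 = (if k = i then D i else 0) + (if k = j then D j else 0)" for k
      using that by (auto simp: x_def)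
    then have 2: "(\<Sum>k<7. D k * (x k)\<^sup>2) = D i + D j"
      using that by (simp add: sum.distrib)
    have "g (E i + E j) (E i + E j) = D i + D j" using Q7[of x] unfolding 1 2 .
    then have "g (E i) (E i) + 2 * g (E i) (E j) + g (E j) (E j) = D i + D j"
      using sym[of "E j" "E i"] by (simp add: metric_at_add[OF g])
    then show ?thesis using diagD that by simp
  qed
  have E0n: "E i \<noteq> 0" if "i < 7" for i
  proof
    assume "E i = 0"
    then have "norm (E0 i) = 0" using hiso_norm[OF h, of "E0 i"] by (simp add: E_def)
    then show False using that unfolding less7 by (elim disjE) (simp_all add: zero_prod_def)
  qed
  have Dpos: "D i > 0" if "i < 7" for i
    using g ET[OF that] E0n[OF that] diagD[OF that] unfolding metric_at_def by metis
  have orth: "orthog p g E D"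
    unfolding orthog_def using ET Dpos diagD off by auto
  have d0: "- (a * b\<^sup>2) / \<nu> > 0" "- (a * r) / \<nu> > 0" "- (b * r) / \<nu> > 0"
    using Dpos[of 0] Dpos[of 1] Dpos[of 3] by (simp_all add: D_def)
  have r0: "r \<ge> 0" by (simp add: r_def)
  have nz: "a \<noteq> 0" "b \<noteq> 0" "r \<noteq> 0" using d0 by auto
  have rp: "r > 0" using r0 nz by simp
  then show "c\<^sup>2 + e\<^sup>2 > 0" by (simp add: r_def)
  \<comment> \<open>The product of these two squared lengths is a b (r / \<nu>)^2, which reveals the
    sign of a b although that of \<nu> is still unknown.\<close>
  have "(- (a * r) / \<nu>) * (- (b * r) / \<nu>) > 0" using d0 by (intro mult_pos_pos) auto
  then have "(a * b) * (r / \<nu>)\<^sup>2 > 0" by (simp add: field_simps power2_eq_square)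
  then show ab: "a * b > 0" by (simp add: zero_less_mult_iff)
  let ?e = "\<lambda>i. (1 / sqrt (D i)) *\<^sub>R E i"
  let ?P = "prod_list (map (\<lambda>i. 1 / sqrt (D i)) [0..<7])"
  have v1: "\<bar>vol (map ?e [0..<7])\<bar> = 1" by (rule vol1[OF orthog_onb[OF g orth]])
  have v2: "vol (map ?e [0..<7]) = ?P * \<nu>"
    unfolding \<nu>_def by (rule mlin_map_scale[OF mv]) simp
  \<comment> \<open>On the normalised frame \<open>vol\<close> is 1 or -1; squaring removes the
    unknown orientation.\<close>
  have "(?P * \<nu>)\<^sup>2 = \<bar>?P * \<nu>\<bar>\<^sup>2" by (rule power2_abs[symmetric])
  also have "\<bar>?P * \<nu>\<bar> = 1" using v1 unfolding v2 .
  finally have "(?P * ?P) * \<nu>\<^sup>2 = 1" by (simp only: power2_eq_square mult_ac mult_1_right)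
  then have "\<nu>\<^sup>2 = prod_list (map D [0..<7])"
    using Dpos by (subst (asm) prod_list_sqrt_inv) (auto simp: field_simps)
  also have "prod_list (map D [0..<7]) = D 0 * D 1 * D 2 * D 3 * D 4 * D 5 * D 6"
    by (simp add: upt7)
  finally have "\<nu>\<^sup>2 = (- (a * b\<^sup>2) / \<nu>) * (- (a * r) / \<nu>) ^ 2 * (- (b * r) / \<nu>) ^ 4"
    by (simp add: D_def power_numeral_reduce)
  \<comment> \<open>Seven factors 1 / \<nu> stand on the right, so \<nu>^9 = - (a b^2 r^2)^3. Odd
    powers are injective, hence the orientation lost by squaring comes back.\<close>
  then have "(\<nu> ^ 3) ^ 3 = (- (a * b\<^sup>2 * r\<^sup>2)) ^ 3"
    using \<nu>0 by (simp add: field_simps power_numeral_reduce)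
  then have n3: "\<nu> ^ 3 = - (a * b\<^sup>2 * r\<^sup>2)" by (rule cube_inject)
  define T where "T = rad a b c e"
  have T3: "T ^ 3 = b * r / a" unfolding T_def rad_def r_def by (simp add: odd_real_root_pow)
  have Tn: "T = - (b * r) / \<nu>"
  proof (rule cube_inject)
    show "T ^ 3 = (- (b * r) / \<nu>) ^ 3"
      unfolding T3 power_divide n3 using nz by (simp add: field_simps power_numeral_reduce)
  qed
  have nT: "\<nu> = - (a * T\<^sup>2)"
  proof (rule cube_inject)
    have "(- (a * T\<^sup>2)) ^ 3 = - (a ^ 3 * (T ^ 3)\<^sup>2)" by (simp add: power_numeral_reduce)
    also have "\<dots> = - (a * b\<^sup>2 * r\<^sup>2)" unfolding T3 using nz by (simp add: field_simps power_numeral_reduce)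
    finally show "\<nu> ^ 3 = (- (a * T\<^sup>2)) ^ 3" using n3 by simp
  qed
  then show "vol (map E [0..<7]) = - (a * (rad a b c e)\<^sup>2)" by (simp add: \<nu>_def T_def)
  have T0: "T \<noteq> 0" using T3 nz by auto
  have "D i = diag a b c e i" for i
    unfolding D_def diag_def Let_def T_def[symmetric] r_def[symmetric]
    using Tn nz T0 by (auto simp: nT field_simps power2_eq_square)
  then have "D = diag a b c e" by blast
  then show "orthog p g E (diag a b c e)" using orth by simp
qed

section \<open>Enumeration of shuffles and stars of the explicit forms\<close>

lemma incs_short: "length xs < k \<Longrightarrow> incs k xs = []"
  by (induction k xs rule: incs.induct) auto

text \<open>Pascal's rule at the far end: \<open>incs\<close> recurses on the first element whereas
  \<open>shuf\<close> peels off the last.\<close>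

lemma incs_snoc: "mset (incs (Suc k) (xs @ [x])) = mset (incs (Suc k) xs) + mset (map (\<lambda>I. I @ [x]) (incs k xs))"
proof (induction xs arbitrary: k)
  case Nil
  then show ?case by (cases k) simp_all
next
  case (Cons y xs)
  show ?case
  proof (cases k)
    case 0
    then show ?thesis using Cons[of 0] by simp
  next
    case (Suc k')
    have "mset (incs (Suc k) ((y # xs) @ [x])) = image_mset ((#) y) (mset (incs k (xs @ [x]))) + mset (incs (Suc k) (xs @ [x]))"
      by simp
    also have "\<dots> = image_mset ((#) y) (mset (incs k xs) + mset (map (\<lambda>I. I @ [x]) (incs k' xs)))
        + (mset (incs (Suc k) xs) + mset (map (\<lambda>I. I @ [x]) (incs k xs)))"
      unfolding Cons[of k] using Cons[of k'] Suc by simp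
    also have "\<dots> = mset (incs (Suc k) (y # xs)) + mset (map (\<lambda>I. I @ [x]) (incs k (y # xs)))"
      unfolding Suc by (simp add: multiset.map_comp o_def)
    finally show ?thesis .
  qed
qed

lemma mset_shuf: "length xs = k + l \<Longrightarrow> mset (map (fst \<circ> snd) (shuf k l xs)) = mset (incs k (rev xs))"
proof (induction k l xs rule: shuf.induct)
  case (2 l x xs)
  then have "mset (map (fst \<circ> snd) (shuf 0 l xs)) = {#[]#}" by (simp add: o_def)
  then show ?case by (simp add: o_def case_prod_unfold)
next
  case (3 k x xs)
  then have "incs (Suc k) (rev xs) = []" by (intro incs_short) simp
  moreover have "mset (map (fst \<circ> snd) (shuf k 0 xs)) = mset (incs k (rev xs))" using 3 by (simp add: o_def)
  then have "image_mset (\<lambda>I. I @ [x]) (mset (map (fst \<circ> snd) (shuf k 0 xs))) = image_mset (\<lambda>I. I @ [x]) (mset (incs k (rev xs)))"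
    by simp
  ultimately show ?case
    using incs_snoc[of k "rev xs" x] by (simp add: o_def case_prod_unfold multiset.map_comp)
next
  case (4 k l x xs)
  have 1: "mset (map (fst \<circ> snd) (shuf (Suc k) l xs)) = mset (incs (Suc k) (rev xs))" using 4 by (simp add: o_def)
  have "mset (map (fst \<circ> snd) (shuf k (Suc l) xs)) = mset (incs k (rev xs))" using 4 by (simp add: o_def)
  then have "image_mset (\<lambda>I. I @ [x]) (mset (map (fst \<circ> snd) (shuf k (Suc l) xs))) = image_mset (\<lambda>I. I @ [x]) (mset (incs k (rev xs)))"
    by simp
  then show ?case
    using incs_snoc[of k "rev xs" x] 1 by (simp add: o_def case_prod_unfold multiset.map_comp)
qed auto

lemma shuf_set:
  "\<forall>t\<in>set (shuf k l xs). set (fst (snd t)) \<subseteq> set xs \<and> set (snd (snd t)) \<subseteq> set xs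
     \<and> length (fst (snd t)) = k \<and> length (snd (snd t)) = l"
  by (induction k l xs rule: shuf.induct) (simp_all add: case_prod_unfold ball_Un, blast+)

text \<open>The isometry \<open>h\<close> transports the check to \<open>p0\<close>, and clearing
  the denominators leaves in \<open>chk\<close> a polynomial identity over finitely many
  shuffles.\<close>

lemma star_at_hiso:
  assumes h: "hiso h" and p: "p = h p0" and g: "metric_at p g" and vol: "is_form_at p 7 vol"
    and E: "orthog p g (\<lambda>i. h (E0 i)) G" and \<nu>: "vol (map (\<lambda>i. h (E0 i)) [0..<7]) = \<nu>" "\<nu> \<noteq> 0"
    and kl: "k + l = 7" and \<beta>': "is_form_at p k \<beta>'"
    and \<beta>: "\<And>vs. length vs = k \<Longrightarrow> set vs \<subseteq> tangent p \<Longrightarrow> \<beta> vs = \<beta>' vs"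
    and \<alpha>: "is_form_at p l \<alpha>"
    and \<alpha>0: "\<And>js. length js = l \<Longrightarrow> set js \<subseteq> {..<7} \<Longrightarrow> \<alpha> (map h (map E0 js)) = \<alpha>0 (map E0 js)"
    and \<beta>0: "\<And>js. length js = k \<Longrightarrow> set js \<subseteq> {..<7} \<Longrightarrow> \<beta>' (map h (map E0 js)) = \<beta>0 (map E0 js)"
    and chk: "\<forall>(s, I, J)\<in>set (shuf k l [6, 5, 4, 3, 2, 1, 0]).
      s * \<alpha>0 (map E0 J) * prod_list (map G I) = \<nu> * \<beta>0 (map E0 I)"
  shows "star_at p g vol k \<beta> = \<alpha>"
proof -
  have pS: "p \<in> S7" using hiso_norm[OF h, of p0] p0_S7 by (simp add: p)
  have T: "tbasis p (\<lambda>i. h (E0 i))" unfolding p by (rule hiso_tbasis[OF h tbasis_E0])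
  show ?thesis
  proof (rule star_atI[OF pS g vol E T \<nu> kl \<beta>' \<beta> \<alpha>])
    show "mset (map (fst \<circ> snd) (shuf k l (rev [0..<7]))) = mset (incs k [0..<7])"
      using mset_shuf[of "rev [0..<7]" k l] kl by simp
    fix s I J assume m: "(s, I, J) \<in> set (shuf k l (rev [0..<7]))"
    from bspec[OF shuf_set m] have IJ: "set I \<subseteq> {..<7}" "set J \<subseteq> {..<7}" "length I = k" "length J = l"
      by (auto simp: atLeast0LessThan)
    have "G i \<noteq> 0" if "i \<in> set I" for i
      using E IJ(1) that unfolding orthog_def by (metis lessThan_iff less_irrefl subsetD)
    then have "prod_list (map G I) \<noteq> 0" by (auto simp: prod_list_zero_iff)
    moreover have "s * \<alpha>0 (map E0 J) * prod_list (map G I) = \<nu> * \<beta>0 (map E0 I)"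
      using bspec[OF chk, of "(s, I, J)"] m by (simp add: upt7)
    ultimately show "s * \<alpha> (map (\<lambda>i. h (E0 i)) J) = \<nu> * \<beta>' (map (\<lambda>i. h (E0 i)) I) / prod_list (map G I)"
      using \<alpha>0[OF IJ(4) IJ(2)] \<beta>0[OF IJ(3) IJ(1)] by (simp add: field_simps o_def)
  qed
qed

text \<open>The cube root in \<^const>\<open>diag\<close> disappears in the parameters \<open>T\<close>, \<open>s = b / T\<close> and \<open>\<rho> = (c\<^sup>2 + e\<^sup>2) / b\<^sup>2\<close>.\<close>

definition Gdiag :: "real \<Rightarrow> real \<Rightarrow> real \<Rightarrow> nat \<Rightarrow> real" where
  "Gdiag s \<rho> T i = (if i = 0 then s\<^sup>2 else if i < 3 then \<rho> * s\<^sup>2 else T)"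

text \<open>Here s^3 \<rho> and s T stand for a and b, and - s^3 \<rho> T^2 for the value of the
  volume form on the frame. With z = T^2 the third argument of \<open>Psi\<close> has to be T^2 +
  s^2 \<rho> T, because its difference from z is the coefficient at the horizontal part of
  \<open>th 1\<close>.\<close>

lemma star_Phi_check:
  "\<forall>(sg, I, J)\<in>set (shuf 3 4 [6, 5, 4, 3, 2, 1, 0]).
      sg * Psi (T\<^sup>2) 0 (T\<^sup>2 + s\<^sup>2 * \<rho> * T) (s * c) (s * e) p0 (map E0 J) * prod_list (map (Gdiag s \<rho> T) I)
      = - (s ^ 3 * \<rho> * T\<^sup>2) * Phi (s ^ 3 * \<rho>) (s * T) c e p0 (map E0 I)"
  unfolding shuf_numeral
  by (simp add: Phi_def Psi_def Let_def w111_def w12_def w22_def w211_def th_E0 Gdiag_def del: E0_simps)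
    (simp add: power2_eq_square power3_eq_cube power4_eq_xxxx algebra_simps)

text \<open>Parametrised by the coefficients \<open>A\<close>, \<open>B\<close>, \<open>C\<close> of
  the answer, which keeps the identity free of division; \<open>z\<close> is the redundant parameter
  of \<open>Psi\<close>.\<close>

lemma star_Psi_check:
  "\<forall>(sg, I, J)\<in>set (shuf 4 3 [6, 5, 4, 3, 2, 1, 0]).
      sg * Phi (A * s ^ 3 * \<rho>) B C 0 p0 (map E0 J) * prod_list (map (Gdiag s \<rho> T) I)
      = - (s ^ 3 * \<rho> * T\<^sup>2) * Psi (A * T\<^sup>2 - 2 * z) z (B * s * \<rho> + (A * T\<^sup>2 - 2 * z)) (C * s + z) 0 p0 (map E0 I)"
  unfolding shuf_numeral
  by (simp add: Phi_def Psi_def Let_def w111_def w12_def w22_def w211_def th_E0 Gdiag_def del: E0_simps)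
    (simp add: power2_eq_square power3_eq_cube power4_eq_xxxx add_divide_distrib diff_divide_distrib algebra_simps)

lemma power6_eq_prod: "x ^ 6 = x * x * x * x * x * (x::real)"
  by (simp add: power_numeral_reduce)

text \<open>The answer is independent of \<open>x\<close>: products of two different horizontal
  parts vanish, so the first bracket of \<open>Om5\<close> is zero on tangent vectors.\<close>

lemma star_Om5_check:
  "\<forall>(sg, I, J)\<in>set (shuf 5 2 [6, 5, 4, 3, 2, 1, 0]).
      sg * Om2 (4 * y * T\<^sup>2) (4 * y * T\<^sup>2 + 8 * y * s ^ 4 * \<rho>\<^sup>2) p0 (map E0 J) * prod_list (map (Gdiag s \<rho> T) I)
      = - (s ^ 3 * \<rho> * T\<^sup>2) * Om5 x (y * T\<^sup>2 * s ^ 3 * \<rho>) p0 (map E0 I)"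
  unfolding shuf_numeral
  by (simp add: Om2_def Om5_def Let_def w122_def w22_def th_E0 Gdiag_def del: E0_simps)
    (simp add: power2_eq_square power3_eq_cube power4_eq_xxxx power6_eq_prod algebra_simps)

lemma metric_ext:
  assumes p: "p \<in> S7" and g: "metric_at p g" "metric_at p g'" and T: "tbasis p E"
    and e: "\<And>i j. i < 7 \<Longrightarrow> j < 7 \<Longrightarrow> g (E i) (E j) = g' (E i) (E j)"
  shows "g = g'"
proof (intro ext)
  fix v w
  have t: "g v w = g (tproj p v) (tproj p w)" "g' v w = g' (tproj p v) (tproj p w)"
    using g unfolding metric_at_def by blast+
  obtain c where c: "tproj p v = (\<Sum>i<7. c i *\<^sub>R E i)"
    using T tproj_in_tangent[OF p, of v] unfolding tbasis_def by blast
  obtain d where d: "tproj p w = (\<Sum>i<7. d i *\<^sub>R E i)"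
    using T tproj_in_tangent[OF p, of w] unfolding tbasis_def by blast
  show "g v w = g' v w"
    unfolding t c d metric_at_lin[OF g(1)] metric_at_sum_right[OF g(1)] metric_at_lin[OF g(2)] metric_at_sum_right[OF g(2)]
    by (intro sum.cong refl arg_cong2[where f = "(*)"]) (simp add: e)
qed

lemma pos_at_cong:
  assumes "\<And>vs. length vs = 3 \<Longrightarrow> set vs \<subseteq> tangent p \<Longrightarrow> f vs = f' vs"
  shows "pos_at p f g vol \<longleftrightarrow> pos_at p f' g vol"
proof -
  have "wedge 4 3 (wedge 2 2 (\<lambda>us. f (X # us)) (\<lambda>us. f (Y # us))) f vs =
      wedge 4 3 (wedge 2 2 (\<lambda>us. f' (X # us)) (\<lambda>us. f' (Y # us))) f' vs"
    if "X \<in> tangent p" "Y \<in> tangent p" "set vs \<subseteq> tangent p" for X Y vs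
    by (intro wedge_cong_set assms) (use that in auto)
  then show ?thesis unfolding pos_at_def by auto
qed

lemma S7_hiso:
  assumes "p \<in> S7"
  obtains h where "hiso h" "p = h p0"
  using Sp2_transitive[OF assms] hiso_act by metis

text \<open>\<open>g_phi\<close> and \<open>vol_phi\<close> are definite descriptions. Since
  \<open>pos_frame\<close> computes the frame values of any admissible pair, all such pairs
  coincide, and the computed values belong to the described objects.\<close>

lemma hstar_frame:
  assumes pos: "positive_form \<phi>" and eq: "form_eq 3 \<phi> (Phi a b c e)" and p: "p = h p0" and h: "hiso h"
  shows "metric_at p (g_phi \<phi> p)" "is_form_at p 7 (vol_phi \<phi> p)"
    "orthog p (g_phi \<phi> p) (\<lambda>i. h (E0 i)) (diag a b c e)"
    "vol_phi \<phi> p (map (\<lambda>i. h (E0 i)) [0..<7]) = - (a * (rad a b c e)\<^sup>2)" "a * b > 0" "c\<^sup>2 + e\<^sup>2 > 0"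
proof -
  have pS: "p \<in> S7" using hiso_norm[OF h, of p0] p0_S7 by (simp add: p)
  have T: "tbasis p (\<lambda>i. h (E0 i))" unfolding p by (rule hiso_tbasis[OF h tbasis_E0])
  have iff: "pos_at p (\<phi> p) g vol \<longleftrightarrow> pos_at p (nPhi a b c e p) g vol" for g vol
    by (rule pos_at_cong) (use eq pS in \<open>simp add: form_eq_def nPhi_def nrm_tangent\<close>)
  obtain g vol where gv: "pos_at p (\<phi> p) g vol" using pos pS unfolding positive_form_def by blast
  have uniq: "g' = g \<and> vol' = vol" if gv': "pos_at p (\<phi> p) g' vol'" for g' vol'
  proof -
    note F = pos_frame[OF h p gv[unfolded iff]] and F' = pos_frame[OF h p gv'[unfolded iff]]
    have m: "metric_at p g" "metric_at p g'" "is_form_at p 7 vol" "is_form_at p 7 vol'"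
      using gv gv' unfolding pos_at_def volform_at_def by blast+
    have "g' = g"
      by (rule metric_ext[OF pS m(2,1) T]) (use F(3) F'(3) in \<open>simp add: orthog_def\<close>)
    moreover have "vol' = vol"
    proof (rule form_ext[OF pS m(4,3) T])
      have "set (incs 7 [0..<7]) = {[0..<7]}" by (simp add: upt_rec numeral_eq_Suc)
      then show "\<forall>js\<in>set (incs 7 [0..<7]). vol' (map (\<lambda>i. h (E0 i)) js) = vol (map (\<lambda>i. h (E0 i)) js)"
        using F(4) F'(4) by simp
    qed
    ultimately show ?thesis by blast
  qed
  have g: "g_phi \<phi> p = g" unfolding g_phi_def using gv uniq by (intro the_equality) blast+
  have v: "vol_phi \<phi> p = vol" unfolding vol_phi_def g using gv uniq by (intro the_equality) blast+
  show "metric_at p (g_phi \<phi> p)" "is_form_at p 7 (vol_phi \<phi> p)"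
    unfolding g v using gv unfolding pos_at_def volform_at_def by blast+
  note F = pos_frame[OF h p gv[unfolded iff]]
  show "orthog p (g_phi \<phi> p) (\<lambda>i. h (E0 i)) (diag a b c e)"
    "vol_phi \<phi> p (map (\<lambda>i. h (E0 i)) [0..<7]) = - (a * (rad a b c e)\<^sup>2)" "a * b > 0" "c\<^sup>2 + e\<^sup>2 > 0"
    unfolding g v by (rule F)+
qed

locale pos_form =
  fixes \<phi> :: dform and a b c e :: real
  assumes pos: "positive_form \<phi>" and eq: "form_eq 3 \<phi> (Phi a b c e)"
begin

definition "T = rad a b c e"
definition "s = b / T"
definition "\<rho> = (c\<^sup>2 + e\<^sup>2) / b\<^sup>2"

lemma id_hiso: "hiso (\<lambda>v. v)"
  by (simp add: hiso_def linear_id[unfolded id_def])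

lemma ab: "a * b > 0" and ce: "c\<^sup>2 + e\<^sup>2 > 0"
  using hstar_frame(5,6)[OF pos eq _ id_hiso] by auto

lemma nz: "a \<noteq> 0" "b \<noteq> 0"
  using ab by auto

lemma T3: "T ^ 3 = b * (c\<^sup>2 + e\<^sup>2) / a"
  by (simp add: T_def rad_def odd_real_root_pow)

lemma T_pos: "T > 0"
proof -
  have "b / a > 0" using ab by (auto simp: zero_less_divide_iff zero_less_mult_iff)
  then have "b * (c\<^sup>2 + e\<^sup>2) / a > 0" using mult_pos_pos[OF _ ce, of "b / a"] by simp
  then show ?thesis by (simp add: T_def rad_def)
qed

lemma s_nz: "s \<noteq> 0" and \<rho>_pos: "\<rho> > 0"
  using nz T_pos ce by (simp_all add: s_def \<rho>_def)

lemma b_eq: "b = s * T" and r_eq: "c\<^sup>2 + e\<^sup>2 = \<rho> * b\<^sup>2"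
  using nz T_pos by (simp_all add: s_def \<rho>_def)

lemma a_eq: "a = s ^ 3 * \<rho>"
proof -
  have "s ^ 3 * \<rho> = b * (c\<^sup>2 + e\<^sup>2) / T ^ 3"
    using nz by (simp add: s_def \<rho>_def power2_eq_square power3_eq_cube)
  also have "\<dots> = a" unfolding T3 using nz less_imp_neq[OF ce] by simp
  finally show ?thesis by simp
qed

lemma diag_eq: "diag a b c e = Gdiag s \<rho> T"
proof
  fix i show "diag a b c e i = Gdiag s \<rho> T i"
    using nz T_pos unfolding diag_def Gdiag_def Let_def T_def[symmetric] r_eq
    by (simp add: s_def power_divide)
qed

lemma hstar_star:
  assumes p: "p \<in> S7" and h: "hiso h" "p = h p0" and kl: "k + l = 7" and \<beta>': "is_form_at p k \<beta>'"
    and \<beta>: "\<And>vs. length vs = k \<Longrightarrow> set vs \<subseteq> tangent p \<Longrightarrow> \<beta> p vs = \<beta>' vs"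
    and \<alpha>: "is_form_at p l \<alpha>"
    and \<alpha>0: "\<And>js. length js = l \<Longrightarrow> set js \<subseteq> {..<7} \<Longrightarrow> \<alpha> (map h (map E0 js)) = \<alpha>0 (map E0 js)"
    and \<beta>0: "\<And>js. length js = k \<Longrightarrow> set js \<subseteq> {..<7} \<Longrightarrow> \<beta>' (map h (map E0 js)) = \<beta>0 (map E0 js)"
    and chk: "\<forall>(sg, I, J)\<in>set (shuf k l [6, 5, 4, 3, 2, 1, 0]).
      sg * \<alpha>0 (map E0 J) * prod_list (map (Gdiag s \<rho> T) I) = - (s ^ 3 * \<rho> * T\<^sup>2) * \<beta>0 (map E0 I)"
  shows "hstar \<phi> k \<beta> p = \<alpha>"
proof -
  note F = hstar_frame[OF pos eq h(2,1)]
  have "hstar \<phi> k \<beta> p = star_at p (g_phi \<phi> p) (vol_phi \<phi> p) k (\<beta> p)"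
    using p by (simp add: hstar_def)
  also have "\<dots> = \<alpha>"
  proof (rule star_at_hiso[OF h F(1) F(2) F(3)[unfolded diag_eq] F(4)[folded T_def] _ kl \<beta>' \<beta> \<alpha> \<alpha>0 \<beta>0])
    show "- (a * T\<^sup>2) \<noteq> 0" using T_pos nz by simp
    show "\<forall>(sg, I, J)\<in>set (shuf k l [6, 5, 4, 3, 2, 1, 0]).
      sg * \<alpha>0 (map E0 J) * prod_list (map (Gdiag s \<rho> T) I) = - (a * T\<^sup>2) * \<beta>0 (map E0 I)"
      using chk unfolding a_eq[symmetric] .
  qed
  finally show ?thesis .
qed

lemma hstar_3:
  assumes p: "p \<in> S7"
  shows "hstar \<phi> 3 \<phi> p = nPsi (T\<^sup>2) 0 (T\<^sup>2 + s\<^sup>2 * \<rho> * T) (s * c) (s * e) p"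
proof -
  obtain h where h: "hiso h" "p = h p0" using S7_hiso[OF p] .
  show ?thesis
  proof (rule hstar_star[OF p h _ is_form_at_th_forms(2)[OF p] _ is_form_at_th_forms(3)[OF p] _ _ star_Phi_check[of T s \<rho> c e]])
    show "\<phi> p vs = nPhi (s ^ 3 * \<rho>) (s * T) c e p vs" if "length vs = 3" "set vs \<subseteq> tangent p" for vs
      using eq p that unfolding form_eq_def nPhi_def a_eq[symmetric] b_eq[symmetric] by (simp add: nrm_tangent)
  qed (simp, (simp only: h(2) nforms_hiso[OF h(1)] nforms_E0)+)
qed

text \<open>The combinations z + 2 z', x - z and x' - z' are those on which the 4-form depends once
  \<open>th i\<close> is replaced by its horizontal part.\<close>

lemma hstar_4:
  assumes p: "p \<in> S7" and \<beta>: "\<And>vs. length vs = 4 \<Longrightarrow> set vs \<subseteq> tangent p \<Longrightarrow> \<beta> p vs = Psi z z' x x' 0 p vs"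
  shows "hstar \<phi> 4 \<beta> p = nPhi ((z + 2 * z') / T\<^sup>2 * s ^ 3 * \<rho>) ((x - z) / (s * \<rho>)) ((x' - z') / s) 0 p"
proof -
  obtain h where h: "hiso h" "p = h p0" using S7_hiso[OF p] .
  define A B C where "A = (z + 2 * z') / T\<^sup>2" and "B = (x - z) / (s * \<rho>)" and "C = (x' - z') / s"
  have e: "z = A * T\<^sup>2 - 2 * z'" "x = B * s * \<rho> + (A * T\<^sup>2 - 2 * z')" "x' = C * s + z'"
    using T_pos s_nz \<rho>_pos by (simp_all add: A_def B_def C_def)
  show ?thesis
    unfolding A_def[symmetric] B_def[symmetric] C_def[symmetric]
  proof (rule hstar_star[OF p h _ is_form_at_th_forms(3)[OF p] _ is_form_at_th_forms(2)[OF p] _ _ star_Psi_check[of A s \<rho> B C T z']])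
    show "\<beta> p vs = nPsi (A * T\<^sup>2 - 2 * z') z' (B * s * \<rho> + (A * T\<^sup>2 - 2 * z')) (C * s + z') 0 p vs"
      if "length vs = 4" "set vs \<subseteq> tangent p" for vs
    proof -
      have "B * s * \<rho> + z = x" using e by simp
      then show ?thesis unfolding nPsi_def e[symmetric] using \<beta> that by (simp add: nrm_tangent)
    qed
  qed (simp, (simp only: h(2) nforms_hiso[OF h(1)] nforms_E0)+)
qed

lemma hstar_5:
  assumes p: "p \<in> S7" and \<beta>: "\<And>vs. length vs = 5 \<Longrightarrow> set vs \<subseteq> tangent p \<Longrightarrow> \<beta> p vs = Om5 x y p vs"
  defines "y' \<equiv> y / (T\<^sup>2 * s ^ 3 * \<rho>)"
  shows "hstar \<phi> 5 \<beta> p = nOm2 (4 * y' * T\<^sup>2) (4 * y' * T\<^sup>2 + 8 * y' * s ^ 4 * \<rho>\<^sup>2) p"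
proof -
  obtain h where h: "hiso h" "p = h p0" using S7_hiso[OF p] .
  have e: "y = y' * T\<^sup>2 * s ^ 3 * \<rho>" using T_pos s_nz \<rho>_pos unfolding y'_def by (simp add: field_simps)
  show ?thesis
  proof (rule hstar_star[OF p h _ is_form_at_th_forms(4)[OF p] _ is_form_at_th_forms(1)[OF p] _ _ star_Om5_check[of y' T s \<rho> x]])
    show "\<beta> p vs = nOm5 x (y' * T\<^sup>2 * s ^ 3 * \<rho>) p vs" if "length vs = 5" "set vs \<subseteq> tangent p" for vs
      unfolding nOm5_def e[symmetric] using \<beta> that by (simp add: nrm_tangent)
  qed (simp, (simp only: h(2) nforms_hiso[OF h(1)] nforms_E0)+)
qed

end

section \<open>Exterior derivatives and the Laplacian\<close>

lemma line_norm:
  assumes "p \<in> S7" "v \<in> tangent p"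
  shows "inner (p + t *\<^sub>R v) (p + t *\<^sub>R v) = 1 + t\<^sup>2 * inner v v" "(norm (p + t *\<^sub>R v))\<^sup>2 = 1 + t\<^sup>2 * inner v v"
    "norm (p + t *\<^sub>R v) \<noteq> 0"
proof -
  have "inner p p = 1" "inner v p = 0" "inner p v = 0"
    using assms by (simp_all add: tangent_def dot_square_norm inner_commute)
  then show i: "inner (p + t *\<^sub>R v) (p + t *\<^sub>R v) = 1 + t\<^sup>2 * inner v v"
    by (simp add: inner_add_left inner_add_right power2_eq_square)
  then show n: "(norm (p + t *\<^sub>R v))\<^sup>2 = 1 + t\<^sup>2 * inner v v" by (simp add: dot_square_norm)
  have "1 + t\<^sup>2 * inner v v > 0" by (intro add_pos_nonneg) auto
  then show "norm (p + t *\<^sub>R v) \<noteq> 0" using n by auto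
qed

lemma th_zero [simp]: "th i 0 v = 0" "th i v 0 = 0"
  using th_lin_left[of i 0 0 0 0 v] th_lin_right[of i v 0 0 0 0] by simp_all

lemma th_bilin:
  "th i (u + v) w = th i u w + th i v w" "th i w (u + v) = th i w u + th i w v"
  "th i (u - v) w = th i u w - th i v w" "th i w (u - v) = th i w u - th i w v"
  "th i (a *\<^sub>R u) w = a * th i u w" "th i w (a *\<^sub>R u) = a * th i w u"
  using th_lin_left[of i 1 u 1 v w] th_lin_right[of i w 1 u 1 v] th_lin_left[of i 1 u "-1" v w]
    th_lin_right[of i w 1 u "-1" v] th_lin_left[of i a u 0 0 w] th_lin_right[of i w a u 0 0] by simp_all

lemma dr_in_tangent: "x \<noteq> 0 \<Longrightarrow> dr x v \<in> tangent (x /\<^sub>R norm x)"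
  by (simp add: dr_def tangent_def inner_diff_left dot_square_norm power2_eq_square)

lemma th_dr:
  assumes "x \<noteq> 0"
  shows "th i (x /\<^sub>R norm x) (dr x w) = th i x w / (norm x)\<^sup>2"
    "th i (dr x u) (dr x w) = (th i u w - inner w x / (norm x)\<^sup>2 * th i u x - inner u x / (norm x)\<^sup>2 * th i x w) / (norm x)\<^sup>2"
  using assms by (simp_all add: dr_def th_bilin power2_eq_square field_simps)

text \<open>Along a tangent line the squared norm is 1 + O(t^2), so the radial rescaling does not
  affect the first derivative.\<close>

lemma deriv_eta:
  assumes "p \<in> S7" "v \<in> tangent p"
  shows "((\<lambda>t. th i ((p + t *\<^sub>R v) /\<^sub>R norm (p + t *\<^sub>R v)) (dr (p + t *\<^sub>R v) w)) has_real_derivative th i v w) (at 0)"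
proof -
  have "(\<lambda>t. th i ((p + t *\<^sub>R v) /\<^sub>R norm (p + t *\<^sub>R v)) (dr (p + t *\<^sub>R v) w)) =
      (\<lambda>t. (th i p w + t * th i v w) / (1 + t\<^sup>2 * inner v v))"
  proof
    fix t
    have nz: "p + t *\<^sub>R v \<noteq> 0" using line_norm(3)[OF assms, of t] by auto
    show "th i ((p + t *\<^sub>R v) /\<^sub>R norm (p + t *\<^sub>R v)) (dr (p + t *\<^sub>R v) w) = (th i p w + t * th i v w) / (1 + t\<^sup>2 * inner v v)"
      unfolding th_dr(1)[OF nz] unfolding line_norm(2)[OF assms] unfolding th_bilin ..
  qed
  moreover have "((\<lambda>t. (th i p w + t * th i v w) / (1 + t\<^sup>2 * inner v v)) has_real_derivative th i v w) (at 0)"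
    by (auto intro!: derivative_eq_intros)
  ultimately show ?thesis by simp
qed

text \<open>\<open>th i\<close> has constant coefficients on the ambient space; the derivative comes
  solely from the tangential projection inside \<open>dr\<close>, which turns with the base
  point.\<close>

lemma deriv_theta:
  assumes "p \<in> S7" "v \<in> tangent p" and u: "u \<in> tangent p" and w: "w \<in> tangent p"
  shows "((\<lambda>t. th i (dr (p + t *\<^sub>R v) u) (dr (p + t *\<^sub>R v) w)) has_real_derivative
    (inner w v * th i p u - inner u v * th i p w)) (at 0)"
proof -
  have z: "inner u p = 0" "inner w p = 0" using u w by (simp_all add: tangent_def)
  have "(\<lambda>t. th i (dr (p + t *\<^sub>R v) u) (dr (p + t *\<^sub>R v) w)) =
      (\<lambda>t. (th i u w - t * inner w v / (1 + t\<^sup>2 * inner v v) * (th i u p + t * th i u v)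
         - t * inner u v / (1 + t\<^sup>2 * inner v v) * (th i p w + t * th i v w)) / (1 + t\<^sup>2 * inner v v))"
  proof
    fix t
    have nz: "p + t *\<^sub>R v \<noteq> 0" using line_norm(3)[OF assms(1,2), of t] by auto
    show "th i (dr (p + t *\<^sub>R v) u) (dr (p + t *\<^sub>R v) w) =
      (th i u w - t * inner w v / (1 + t\<^sup>2 * inner v v) * (th i u p + t * th i u v)
         - t * inner u v / (1 + t\<^sup>2 * inner v v) * (th i p w + t * th i v w)) / (1 + t\<^sup>2 * inner v v)"
      unfolding th_dr(2)[OF nz] unfolding line_norm(2)[OF assms(1,2)] unfolding th_bilin
      by (simp add: z inner_add_right)
  qed
  moreover have "((\<lambda>t. (th i u w - t * inner w v / (1 + t\<^sup>2 * inner v v) * (th i u p + t * th i u v)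
         - t * inner u v / (1 + t\<^sup>2 * inner v v) * (th i p w + t * th i v w)) / (1 + t\<^sup>2 * inner v v))
     has_real_derivative (inner w v * th i p u - inner u v * th i p w)) (at 0)"
    by (auto intro!: derivative_eq_intros simp: th_skew[of i u p])
  ultimately show ?thesis by simp
qed

section \<open>Derivatives of the products and their antisymmetrisation\<close>

definition dth :: "H2 \<Rightarrow> nat \<Rightarrow> H2 \<Rightarrow> H2 \<Rightarrow> H2 \<Rightarrow> real" where
  "dth p i v u w = inner w v * th i p u - inner u v * th i p w"

abbreviation rth1 :: "H2 \<Rightarrow> nat \<Rightarrow> H2 \<Rightarrow> real" where
  "rth1 y i u \<equiv> th i (y /\<^sub>R norm y) (dr y u)"

abbreviation rth2 :: "H2 \<Rightarrow> nat \<Rightarrow> H2 \<Rightarrow> H2 \<Rightarrow> real" where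
  "rth2 y i u w \<equiv> th i (dr y u) (dr y w)"

context
  fixes p v :: H2
  assumes p: "p \<in> S7" and v: "v \<in> tangent p"
begin

lemma dr_line0: "u \<in> tangent p \<Longrightarrow> dr p u = u" "p /\<^sub>R norm p = p"
  using p by (simp_all add: dr_def tangent_def)

lemma rth1_deriv: "((\<lambda>t. rth1 (p + t *\<^sub>R v) i u) has_real_derivative th i v u) (at 0)"
  by (rule deriv_eta[OF p v])

lemma rth2_deriv: "u \<in> tangent p \<Longrightarrow> w \<in> tangent p \<Longrightarrow>
    ((\<lambda>t. rth2 (p + t *\<^sub>R v) i u w) has_real_derivative dth p i v u w) (at 0)"
  unfolding dth_def by (rule deriv_theta[OF p v])

lemma w12_deriv:
  assumes "u \<in> tangent p" "w \<in> tangent p" "z \<in> tangent p"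
  shows "((\<lambda>t. w12 (rth1 (p + t *\<^sub>R v) i) (rth2 (p + t *\<^sub>R v) j) u w z) has_real_derivative
     w12 (th i v) (th j) u w z + w12 (th i p) (dth p j v) u w z) (at 0)"
  unfolding w12_def
  by (rule derivative_eq_intros rth1_deriv rth2_deriv assms refl)+ (simp add: dr_line0 assms algebra_simps)

lemma w111_deriv:
  assumes "u \<in> tangent p" "w \<in> tangent p" "z \<in> tangent p"
  shows "((\<lambda>t. w111 (rth1 (p + t *\<^sub>R v) i) (rth1 (p + t *\<^sub>R v) j) (rth1 (p + t *\<^sub>R v) k) u w z) has_real_derivative
     w111 (th i v) (th j p) (th k p) u w z + w111 (th i p) (th j v) (th k p) u w z + w111 (th i p) (th j p) (th k v) u w z) (at 0)"
  unfolding w111_def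
  by (rule derivative_eq_intros rth1_deriv rth2_deriv assms refl)+ (simp add: dr_line0 assms algebra_simps)

lemma w22_deriv:
  assumes "u \<in> tangent p" "w \<in> tangent p" "z \<in> tangent p" "r \<in> tangent p"
  shows "((\<lambda>t. w22 (rth2 (p + t *\<^sub>R v) i) (rth2 (p + t *\<^sub>R v) j) u w z r) has_real_derivative
     w22 (dth p i v) (th j) u w z r + w22 (th i) (dth p j v) u w z r) (at 0)"
  unfolding w22_def
  by (rule derivative_eq_intros rth1_deriv rth2_deriv assms refl)+ (simp add: dr_line0 assms algebra_simps)

lemma w211_deriv:
  assumes "u \<in> tangent p" "w \<in> tangent p" "z \<in> tangent p" "r \<in> tangent p"
  shows "((\<lambda>t. w211 (rth2 (p + t *\<^sub>R v) i) (rth1 (p + t *\<^sub>R v) j) (rth1 (p + t *\<^sub>R v) k) u w z r) has_real_derivative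
     w211 (dth p i v) (th j p) (th k p) u w z r + w211 (th i) (th j v) (th k p) u w z r + w211 (th i) (th j p) (th k v) u w z r) (at 0)"
  unfolding w211_def
  by (rule derivative_eq_intros rth1_deriv rth2_deriv assms refl)+ (simp add: dr_line0 assms algebra_simps)

end

definition alt3 :: "(H2 \<Rightarrow> H2 \<Rightarrow> H2 \<Rightarrow> real) \<Rightarrow> H2 \<Rightarrow> H2 \<Rightarrow> H2 \<Rightarrow> real" where
  "alt3 D u v w = D u v w - D v u w + D w u v"

definition alt4 :: "(H2 \<Rightarrow> H2 \<Rightarrow> H2 \<Rightarrow> H2 \<Rightarrow> real) \<Rightarrow> H2 \<Rightarrow> H2 \<Rightarrow> H2 \<Rightarrow> H2 \<Rightarrow> real" where
  "alt4 D u v w z = D u v w z - D v u w z + D w u v z - D z u v w"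

definition alt5 :: "(H2 \<Rightarrow> H2 \<Rightarrow> H2 \<Rightarrow> H2 \<Rightarrow> H2 \<Rightarrow> real) \<Rightarrow> H2 \<Rightarrow> H2 \<Rightarrow> H2 \<Rightarrow> H2 \<Rightarrow> H2 \<Rightarrow> real" where
  "alt5 D u v w z r = D u v w z r - D v u w z r + D w u v z r - D z u v w r + D r u v w z"

text \<open>This is the product rule for \<eta>_i \<and> th j with th j closed: the
  \<open>dth\<close> terms carry the symmetric \<open>inner\<close> and cancel under
  antisymmetrisation.\<close>

lemma alt4_w12:
  "alt4 (\<lambda>v u w z. w12 (th i v) (th j) u w z + w12 (th i p) (dth p j v) u w z) a b c d = 2 * w22 (th i) (th j) a b c d"
  by (simp add: alt4_def w12_def w22_def dth_def th_skew[of _ b a] th_skew[of _ c a] th_skew[of _ d a] th_skew[of _ c b]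
      th_skew[of _ d b] th_skew[of _ d c] inner_commute[of b a] inner_commute[of c a] inner_commute[of d a]
      inner_commute[of c b] inner_commute[of d b] inner_commute[of d c] algebra_simps)

lemma alt4_w111:
  "alt4 (\<lambda>v u w z. w111 (th i v) (th j p) (th k p) u w z + w111 (th i p) (th j v) (th k p) u w z + w111 (th i p) (th j p) (th k v) u w z) a b c d
    = 2 * (w211 (th i) (th j p) (th k p) a b c d - w211 (th j) (th i p) (th k p) a b c d + w211 (th k) (th i p) (th j p) a b c d)"
  by (simp add: alt4_def w111_def w211_def th_skew[of _ b a] th_skew[of _ c a] th_skew[of _ d a] th_skew[of _ c b]
      th_skew[of _ d b] th_skew[of _ d c] algebra_simps)

lemma alt5_w22:
  "alt5 (\<lambda>v u w z r. w22 (dth p i v) (th j) u w z r + w22 (th i) (dth p j v) u w z r) a b c d e = 0"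
  by (simp add: alt5_def w22_def dth_def
      inner_commute[of b a] inner_commute[of c a] inner_commute[of d a] inner_commute[of e a]
      inner_commute[of c b] inner_commute[of d b] inner_commute[of e b] inner_commute[of d c] inner_commute[of e c]
      inner_commute[of e d] algebra_simps)

text \<open>The product rule once more: only the derivatives of the two contact factors survive, and
  the factor 2 is that of d \<eta>_i = 2 th i.\<close>

lemma alt5_w211:
  "alt5 (\<lambda>v u w z r. w211 (dth p i v) (th j p) (th k p) u w z r + w211 (th i) (th j v) (th k p) u w z r + w211 (th i) (th j p) (th k v) u w z r) a b c d e
    = 2 * (w122 (th k p) (th i) (th j) a b c d e - w122 (th j p) (th i) (th k) a b c d e)"
  by (simp add: alt5_def w211_def w122_def w22_def dth_def
      th_skew[of _ b a] th_skew[of _ c a] th_skew[of _ d a] th_skew[of _ e a] th_skew[of _ c b]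
      th_skew[of _ d b] th_skew[of _ e b] th_skew[of _ d c] th_skew[of _ e c] th_skew[of _ e d]
      inner_commute[of b a] inner_commute[of c a] inner_commute[of d a] inner_commute[of e a]
      inner_commute[of c b] inner_commute[of d b] inner_commute[of e b] inner_commute[of d c] inner_commute[of e c]
      inner_commute[of e d] algebra_simps)

lemma radial_ext_eq:
  assumes "form_eq k \<omega> F" "y \<noteq> 0" "length ws = k"
  shows "radial_ext \<omega> y ws = F (y /\<^sub>R norm y) (map (dr y) ws)"
proof -
  have "y /\<^sub>R norm y \<in> S7" using assms(2) by simp
  moreover have "set (map (dr y) ws) \<subseteq> tangent (y /\<^sub>R norm y)" using dr_in_tangent[OF assms(2)] by auto
  ultimately show ?thesis using assms(1,3) unfolding form_eq_def radial_ext_def by simp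
qed

lemma dirderiv_radial_ext:
  assumes "form_eq k \<omega> F" "p \<in> S7" "v \<in> tangent p" "length ws = k"
    and "((\<lambda>t. F ((p + t *\<^sub>R v) /\<^sub>R norm (p + t *\<^sub>R v)) (map (dr (p + t *\<^sub>R v)) ws)) has_real_derivative D) (at 0)"
  shows "dirderiv (\<lambda>y. radial_ext \<omega> y ws) p v = D"
proof -
  have "(\<lambda>t. radial_ext \<omega> (p + t *\<^sub>R v) ws) = (\<lambda>t. F ((p + t *\<^sub>R v) /\<^sub>R norm (p + t *\<^sub>R v)) (map (dr (p + t *\<^sub>R v)) ws))"
  proof
    fix t
    have "p + t *\<^sub>R v \<noteq> 0" using line_norm(3)[OF assms(2,3), of t] by auto
    then show "radial_ext \<omega> (p + t *\<^sub>R v) ws = F ((p + t *\<^sub>R v) /\<^sub>R norm (p + t *\<^sub>R v)) (map (dr (p + t *\<^sub>R v)) ws)"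
      by (rule radial_ext_eq[OF assms(1) _ assms(4)])
  qed
  then show ?thesis unfolding dirderiv_def using assms(5) by (simp add: DERIV_imp_deriv)
qed

lemma w_dr:
  "w111 (th i q) (th j q) (th k q) (dr y u) (dr y v) (dr y w) =
     w111 (\<lambda>u. th i q (dr y u)) (\<lambda>u. th j q (dr y u)) (\<lambda>u. th k q (dr y u)) u v w"
  "w12 (th i q) (th j) (dr y u) (dr y v) (dr y w) = w12 (\<lambda>u. th i q (dr y u)) (rth2 y j) u v w"
  "w22 (th i) (th j) (dr y u) (dr y v) (dr y w) (dr y z) = w22 (rth2 y i) (rth2 y j) u v w z"
  "w211 (th i) (th j q) (th k q) (dr y u) (dr y v) (dr y w) (dr y z) =
     w211 (rth2 y i) (\<lambda>u. th j q (dr y u)) (\<lambda>u. th k q (dr y u)) u v w z"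
  by (simp_all add: w111_def w12_def w22_def w211_def)

definition Dw12 :: "H2 \<Rightarrow> nat \<Rightarrow> nat \<Rightarrow> H2 \<Rightarrow> H2 \<Rightarrow> H2 \<Rightarrow> H2 \<Rightarrow> real" where
  "Dw12 p i j v u w z = w12 (th i v) (th j) u w z + w12 (th i p) (dth p j v) u w z"

definition Dw111 :: "H2 \<Rightarrow> nat \<Rightarrow> nat \<Rightarrow> nat \<Rightarrow> H2 \<Rightarrow> H2 \<Rightarrow> H2 \<Rightarrow> H2 \<Rightarrow> real" where
  "Dw111 p i j k v u w z = w111 (th i v) (th j p) (th k p) u w z + w111 (th i p) (th j v) (th k p) u w z + w111 (th i p) (th j p) (th k v) u w z"

definition Dw22 :: "H2 \<Rightarrow> nat \<Rightarrow> nat \<Rightarrow> H2 \<Rightarrow> H2 \<Rightarrow> H2 \<Rightarrow> H2 \<Rightarrow> H2 \<Rightarrow> real" where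
  "Dw22 p i j v u w z r = w22 (dth p i v) (th j) u w z r + w22 (th i) (dth p j v) u w z r"

definition Dw211 :: "H2 \<Rightarrow> nat \<Rightarrow> nat \<Rightarrow> nat \<Rightarrow> H2 \<Rightarrow> H2 \<Rightarrow> H2 \<Rightarrow> H2 \<Rightarrow> H2 \<Rightarrow> real" where
  "Dw211 p i j k v u w z r = w211 (dth p i v) (th j p) (th k p) u w z r + w211 (th i) (th j v) (th k p) u w z r + w211 (th i) (th j p) (th k v) u w z r"

text \<open>The parameter \<open>e\<close> drops out, because its two terms give th 2 \<and> th 3 -
  th 3 \<and> th 2 and 2-forms commute. The 4 in the first two arguments arises since
  \<open>Psi\<close> carries the squares with a factor 1/2.\<close>

lemma extd_Phi:
  assumes \<omega>: "form_eq 3 \<omega> (Phi a b c e)" and p: "p \<in> S7" and vs: "length vs = 4" "set vs \<subseteq> tangent p"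
  shows "extd 3 \<omega> p vs = Psi (4 * b) (4 * c) (2 * (a + b + 2 * c)) (2 * (a + b + 2 * c)) 0 p vs"
proof -
  obtain v0 v1 v2 v3 where v: "vs = [v0, v1, v2, v3]"
    using vs(1) by (auto simp: numeral_eq_Suc length_Suc_conv)
  have t: "v0 \<in> tangent p" "v1 \<in> tangent p" "v2 \<in> tangent p" "v3 \<in> tangent p" using vs(2) v by auto
  define D where "D v u w z = (a + b + 2 * c) * Dw111 p 1 2 3 v u w z + 1 * (b * Dw12 p 1 1 v u w z
     + c * (1 * Dw12 p 2 2 v u w z + 1 * Dw12 p 3 3 v u w z) + e * (1 * Dw12 p 2 3 v u w z + - 1 * Dw12 p 3 2 v u w z))" for v u w z
  have d: "dirderiv (\<lambda>y. radial_ext \<omega> y [u, w, z]) p v = D v u w z"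
    if T: "v \<in> tangent p" "u \<in> tangent p" "w \<in> tangent p" "z \<in> tangent p" for v u w z
  proof (rule dirderiv_radial_ext[OF \<omega> p T(1)])
    show "((\<lambda>t. Phi a b c e ((p + t *\<^sub>R v) /\<^sub>R norm (p + t *\<^sub>R v)) (map (dr (p + t *\<^sub>R v)) [u, w, z])) has_real_derivative D v u w z) (at 0)"
      unfolding D_def Dw12_def Dw111_def Phi_def Let_def
      by (simp add: w_dr) (rule derivative_eq_intros w12_deriv[OF p T] w111_deriv[OF p T] refl | simp add: algebra_simps)+
  qed simp
  have "extd 3 \<omega> p vs = alt4 D v0 v1 v2 v3"
    using t by (simp add: extd_def v alt4_def d numeral_eq_Suc lessThan_Suc)
  also have "\<dots> = (a + b + 2 * c) * alt4 (Dw111 p 1 2 3) v0 v1 v2 v3 + (b * alt4 (Dw12 p 1 1) v0 v1 v2 v3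
     + c * (alt4 (Dw12 p 2 2) v0 v1 v2 v3 + alt4 (Dw12 p 3 3) v0 v1 v2 v3)
     + e * (alt4 (Dw12 p 2 3) v0 v1 v2 v3 - alt4 (Dw12 p 3 2) v0 v1 v2 v3))"
    by (simp add: alt4_def D_def algebra_simps)
  also have "\<dots> = Psi (4 * b) (4 * c) (2 * (a + b + 2 * c)) (2 * (a + b + 2 * c)) 0 p vs"
    unfolding Dw111_def[abs_def] Dw12_def[abs_def] alt4_w12 alt4_w111 v Psi_def Let_def
    by (simp add: w22_def w211_def algebra_simps)
  finally show ?thesis .
qed

text \<open>The square of th 1 is closed. In the x'-terms the products \<eta>_1 \<and> th 2 \<and>
  th 3 cancel and the rest is the negative of the x-term, so that only x - x' appears.\<close>

lemma extd_Psi: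
  assumes \<omega>: "form_eq 4 \<omega> (Psi z 0 x x' y)" and p: "p \<in> S7" and vs: "length vs = 5" "set vs \<subseteq> tangent p"
  shows "extd 4 \<omega> p vs = Om5 (x - x') y p vs"
proof -
  obtain v0 v1 v2 v3 v4 where v: "vs = [v0, v1, v2, v3, v4]"
    using vs(1) by (auto simp: numeral_eq_Suc length_Suc_conv)
  have t: "v0 \<in> tangent p" "v1 \<in> tangent p" "v2 \<in> tangent p" "v3 \<in> tangent p" "v4 \<in> tangent p" using vs(2) v by auto
  define D where "D v u w q r = (z / 2) * Dw22 p 1 1 v u w q r + x * Dw211 p 1 2 3 v u w q r
     + x' * (Dw211 p 2 3 1 v u w q r + Dw211 p 3 1 2 v u w q r) + y * (Dw211 p 3 3 1 v u w q r - Dw211 p 2 1 2 v u w q r)" for v u w q r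
  have d: "dirderiv (\<lambda>y. radial_ext \<omega> y [u, w, q, r]) p v = D v u w q r"
    if T: "v \<in> tangent p" "u \<in> tangent p" "w \<in> tangent p" "q \<in> tangent p" "r \<in> tangent p" for v u w q r
  proof (rule dirderiv_radial_ext[OF \<omega> p T(1)])
    show "((\<lambda>t. Psi z 0 x x' y ((p + t *\<^sub>R v) /\<^sub>R norm (p + t *\<^sub>R v)) (map (dr (p + t *\<^sub>R v)) [u, w, q, r])) has_real_derivative D v u w q r) (at 0)"
      unfolding D_def Dw22_def Dw211_def Psi_def Let_def
      by (simp add: w_dr) (rule derivative_eq_intros w22_deriv[OF p T] w211_deriv[OF p T] refl | simp add: algebra_simps)+
  qed simp
  have "extd 4 \<omega> p vs = alt5 D v0 v1 v2 v3 v4"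
    using t by (simp add: extd_def v alt5_def d numeral_eq_Suc lessThan_Suc)
  also have "\<dots> = (z / 2) * alt5 (Dw22 p 1 1) v0 v1 v2 v3 v4 + x * alt5 (Dw211 p 1 2 3) v0 v1 v2 v3 v4
     + x' * (alt5 (Dw211 p 2 3 1) v0 v1 v2 v3 v4 + alt5 (Dw211 p 3 1 2) v0 v1 v2 v3 v4)
     + y * (alt5 (Dw211 p 3 3 1) v0 v1 v2 v3 v4 - alt5 (Dw211 p 2 1 2) v0 v1 v2 v3 v4)"
    by (simp add: alt5_def D_def algebra_simps)
  also have "\<dots> = Om5 (x - x') y p vs"
  proof -
    have sym: "w122 h s t k l m n r = w122 h t s k l m n r" for h :: "H2 \<Rightarrow> real" and s t k l m n r
      by (simp add: w122_def w22_def algebra_simps)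
    show ?thesis
      unfolding Dw22_def[abs_def] Dw211_def[abs_def] alt5_w22 alt5_w211 v Om5_def Let_def
      by (simp add: sym[of _ "th 2" "th 1"] sym[of _ "th 3" "th 1"] sym[of _ "th 3" "th 2"]
         sym[of _ "th 2" "th (Suc 0)"] sym[of _ "th 3" "th (Suc 0)"] algebra_simps)
  qed
  finally show ?thesis .
qed

lemma extd_Om2:
  assumes \<omega>: "form_eq 2 \<omega> (Om2 x y)" and p: "p \<in> S7" and vs: "length vs = 3" "set vs \<subseteq> tangent p"
  shows "extd 2 \<omega> p vs = Phi 0 0 0 (- 2 * y) p vs"
proof -
  obtain v0 v1 v2 where v: "vs = [v0, v1, v2]"
    using vs(1) by (auto simp: numeral_eq_Suc length_Suc_conv)
  have t: "v0 \<in> tangent p" "v1 \<in> tangent p" "v2 \<in> tangent p" using vs(2) v by auto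
  define D where "D v u w = x * dth p 1 v u w + y * (th 2 v u * th 3 p w + th 2 p u * th 3 v w - (th 2 v w * th 3 p u + th 2 p w * th 3 v u))" for v u w
  have d: "dirderiv (\<lambda>y. radial_ext \<omega> y [u, w]) p v = D v u w"
    if T: "v \<in> tangent p" "u \<in> tangent p" "w \<in> tangent p" for v u w
  proof (rule dirderiv_radial_ext[OF \<omega> p T(1)])
    show "((\<lambda>t. Om2 x y ((p + t *\<^sub>R v) /\<^sub>R norm (p + t *\<^sub>R v)) (map (dr (p + t *\<^sub>R v)) [u, w])) has_real_derivative D v u w) (at 0)"
      unfolding D_def Om2_def
      by simp (rule derivative_eq_intros rth1_deriv[OF p T(1)] rth2_deriv[OF p T] refl
          | simp add: algebra_simps dr_line0[OF p T(1)] T)+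
  qed simp
  have "extd 2 \<omega> p vs = alt3 D v0 v1 v2"
    using t by (simp add: extd_def v alt3_def d numeral_eq_Suc lessThan_Suc)
  also have "\<dots> = Phi 0 0 0 (- 2 * y) p vs"
    by (simp add: v alt3_def D_def dth_def Phi_def Let_def w12_def th_skew[of _ v1 v0] th_skew[of _ v2 v0] th_skew[of _ v2 v1]
       inner_commute[of v1 v0] inner_commute[of v2 v0] inner_commute[of v2 v1] algebra_simps)
  finally show ?thesis .
qed

context pos_form
begin

text \<open>The composite of d and the star maps the family \<open>Phi\<close> to itself and kills
  e'; applying it twice gives the first half of the Laplacian.\<close>

lemma hstar_extd_Phi:
  assumes \<omega>: "form_eq 3 \<omega> (Phi a' b' c' e')" and p: "p \<in> S7"
  shows "hstar \<phi> 4 (extd 3 \<omega>) p = nPhi (4 * (b' + 2 * c') * s ^ 3 * \<rho> / T\<^sup>2) (2 * (a' - b' + 2 * c') / (s * \<rho>)) (2 * (a' + b') / s) 0 p"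
proof -
  have "hstar \<phi> 4 (extd 3 \<omega>) p = nPhi ((4 * b' + 2 * (4 * c')) / T\<^sup>2 * s ^ 3 * \<rho>)
     ((2 * (a' + b' + 2 * c') - 4 * b') / (s * \<rho>)) ((2 * (a' + b' + 2 * c') - 4 * c') / s) 0 p"
    by (rule hstar_4[OF p]) (rule extd_Phi[OF \<omega> p])
  also have "(4 * b' + 2 * (4 * c')) / T\<^sup>2 * s ^ 3 * \<rho> = 4 * (b' + 2 * c') * s ^ 3 * \<rho> / T\<^sup>2" by (simp add: algebra_simps)
  also have "2 * (a' + b' + 2 * c') - 4 * b' = 2 * (a' - b' + 2 * c')" by simp
  also have "2 * (a' + b' + 2 * c') - 4 * c' = 2 * (a' + b')" by simp
  finally show ?thesis .
qed

definition "a1 = 4 * (b + 2 * c) * s ^ 3 * \<rho> / T\<^sup>2"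
definition "b1 = 2 * (a - b + 2 * c) / (s * \<rho>)"
definition "c1 = 2 * (a + b) / s"

text \<open>The two halves decouple. The first one has no e-part, because d annihilates it, and the
  second one is a pure e-part. Thus \<open>e\<close> is only multiplied by a positive factor, which
  depends on the metric.\<close>

theorem g2_laplacian_eq:
  "form_eq 3 (g2_laplacian \<phi>) (Phi (4 * (b1 + 2 * c1) * s ^ 3 * \<rho> / T\<^sup>2)
     (2 * (a1 - b1 + 2 * c1) / (s * \<rho>)) (2 * (a1 + b1) / s) (8 * e * (1 + 2 * s ^ 4 * \<rho>\<^sup>2 / T\<^sup>2) / (s\<^sup>2 * \<rho>)))"
  unfolding form_eq_def
proof (intro ballI allI impI)
  fix p vs assume p: "p \<in> S7" and vs: "length vs = 3" "set vs \<subseteq> tangent p"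
  let ?A = "4 * (b1 + 2 * c1) * s ^ 3 * \<rho> / T\<^sup>2" and ?B = "2 * (a1 - b1 + 2 * c1) / (s * \<rho>)" and ?C = "2 * (a1 + b1) / s"
  have "form_eq 3 (hstar \<phi> 4 (extd 3 \<phi>)) (Phi a1 b1 c1 0)"
    unfolding form_eq_def using hstar_extd_Phi[OF eq] by (simp add: nPhi_def nrm_tangent a1_def b1_def c1_def)
  from hstar_extd_Phi[OF this p]
  have 1: "hstar \<phi> 4 (extd 3 (hstar \<phi> 4 (extd 3 \<phi>))) p vs = Phi ?A ?B ?C 0 p vs"
    using vs by (simp add: nPhi_def nrm_tangent)
  have f4: "form_eq 4 (hstar \<phi> 3 \<phi>) (Psi (T\<^sup>2) 0 (T\<^sup>2 + s\<^sup>2 * \<rho> * T) (s * c) (s * e))"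
    unfolding form_eq_def using hstar_3 by (simp add: nPsi_def nrm_tangent)
  define y where "y = s * e / (T\<^sup>2 * s ^ 3 * \<rho>)"
  have "form_eq 2 (hstar \<phi> 5 (extd 4 (hstar \<phi> 3 \<phi>))) (Om2 (4 * y * T\<^sup>2) (4 * y * T\<^sup>2 + 8 * y * s ^ 4 * \<rho>\<^sup>2))"
    unfolding form_eq_def
  proof (intro ballI allI impI)
    fix q us assume q: "q \<in> S7" and us: "length us = 2" "set us \<subseteq> tangent q"
    have "hstar \<phi> 5 (extd 4 (hstar \<phi> 3 \<phi>)) q = nOm2 (4 * y * T\<^sup>2) (4 * y * T\<^sup>2 + 8 * y * s ^ 4 * \<rho>\<^sup>2) q"
      unfolding y_def by (rule hstar_5[OF q]) (rule extd_Psi[OF f4 q])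
    then show "hstar \<phi> 5 (extd 4 (hstar \<phi> 3 \<phi>)) q us = Om2 (4 * y * T\<^sup>2) (4 * y * T\<^sup>2 + 8 * y * s ^ 4 * \<rho>\<^sup>2) q us"
      using us by (simp add: nOm2_def nrm_tangent)
  qed
  from extd_Om2[OF this p vs]
  have 2: "extd 2 (hstar \<phi> 5 (extd 4 (hstar \<phi> 3 \<phi>))) p vs = Phi 0 0 0 (- 2 * (4 * y * T\<^sup>2 + 8 * y * s ^ 4 * \<rho>\<^sup>2)) p vs" .
  have "2 * (4 * y * T\<^sup>2 + 8 * y * s ^ 4 * \<rho>\<^sup>2) = 8 * e * (1 + 2 * s ^ 4 * \<rho>\<^sup>2 / T\<^sup>2) / (s\<^sup>2 * \<rho>)"
    unfolding y_def using T_pos s_nz \<rho>_pos by (simp add: field_simps power2_eq_square power3_eq_cube)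
  then have 3: "- 2 * (4 * y * T\<^sup>2 + 8 * y * s ^ 4 * \<rho>\<^sup>2) = - (8 * e * (1 + 2 * s ^ 4 * \<rho>\<^sup>2 / T\<^sup>2) / (s\<^sup>2 * \<rho>))" by simp
  have add: "Phi A B C 0 p vs - Phi 0 0 0 (- E) p vs = Phi A B C E p vs" for A B C E
    by (simp add: Phi_def Let_def algebra_simps)
  show "g2_laplacian \<phi> p vs = Phi ?A ?B ?C (8 * e * (1 + 2 * s ^ 4 * \<rho>\<^sup>2 / T\<^sup>2) / (s\<^sup>2 * \<rho>)) p vs"
    unfolding g2_laplacian_def 1 2 3 by (rule add)
qed

end

section \<open>Classification of the invariant 3-forms\<close>

text \<open>The sine and cosine of pi / 4: conjugation by the unit (1 + i) / sqrt 2 is a quarter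
  turn, which permutes frame vectors up to sign.\<close>

definition r2 :: real where "r2 = sqrt 2 / 2"

lemma r2_sq: "r2 * r2 = 1 / 2"
  by (simp add: r2_def)

text \<open>Isotropy of \<open>p0\<close> = (1, 0): the diagonal matrix with entries q, d is paired
  with q itself, so that the first coordinate is conjugated and 1 stays fixed.\<close>

definition stab :: "quat \<Rightarrow> quat \<Rightarrow> H2 \<Rightarrow> H2" where
  "stab q d = act (q, 0, 0, d) q"

lemma stab_eq: "stab q d (v, w) = (qmul (qmul q v) (qconj q), qmul (qmul d w) (qconj q))"
  by (simp add: stab_def act_def)

lemma qconj_zero [simp]: "qconj 0 = 0"
  by (simp add: qconj_def zero_prod_def)

lemma Sp2_diag: "qmul (qconj q) q = qone \<Longrightarrow> qmul (qconj d) d = qone \<Longrightarrow> (q, 0, 0, d) \<in> Sp2"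
  by (simp add: Sp2_def)

lemma U1_qone: "qone \<in> U1"
  unfolding U1_def qone_def by (auto intro!: exI[of _ 0])

lemma U1_r2: "(r2, r2, 0, 0) \<in> U1"
  unfolding U1_def by (auto intro!: exI[of _ "pi / 4"] simp: cos_45 sin_45 r2_def)

lemma stab_G_U1:
  assumes "qmul (qconj d) d = qone"
  shows "stab qone d \<in> G_U1" "stab (r2, r2, 0, 0) qone \<in> G_U1"
proof -
  show "stab qone d \<in> G_U1" using assms Sp2_diag[of qone d] U1_qone unfolding G_U1_def stab_def mem_Collect_eq by (metis qconj_qone qmul_qone(1))
  have "(((r2, r2, 0, 0), 0, 0, qone) :: quat \<times> quat \<times> quat \<times> quat) \<in> Sp2"
    by (rule Sp2_diag) (simp_all add: qmul_def qconj_def qone_def r2_sq)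
  then show "stab (r2, r2, 0, 0) qone \<in> G_U1" using U1_r2 unfolding G_U1_def stab_def by blast
qed

lemma stab_G_Sp1: "stab (r2, 0, 0, r2) qone \<in> G_Sp1"
proof -
  have "(((r2, 0, 0, r2), 0, 0, qone) :: quat \<times> quat \<times> quat \<times> quat) \<in> Sp2"
    by (rule Sp2_diag) (simp_all add: qmul_def qconj_def qone_def r2_sq)
  moreover have "(r2, 0, 0, r2) \<in> Sp1"
    using r2_sq by (simp add: Sp1_def norm_prod_def power2_eq_square)
  ultimately show ?thesis unfolding G_Sp1_def stab_def by blast
qed

lemma G_U1_subset: "G_U1 \<subseteq> G_Sp1"
proof -
  have "U1 \<subseteq> Sp1" by (auto simp: U1_def Sp1_def norm_prod_def)
  then show ?thesis unfolding G_U1_def G_Sp1_def by blast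
qed

lemma stab_E0:
  "stab qone d (E0 0) = E0 0" "stab qone d (E0 1) = E0 1" "stab qone d (E0 2) = E0 2"
  "stab qone (- qone) (E0 3) = - E0 3" "stab qone (- qone) (E0 4) = - E0 4"
  "stab qone (- qone) (E0 5) = - E0 5" "stab qone (- qone) (E0 6) = - E0 6"
  "stab qone (0, 1, 0, 0) (E0 3) = E0 4" "stab qone (0, 1, 0, 0) (E0 4) = - E0 3"
  "stab qone (0, 1, 0, 0) (E0 5) = E0 6" "stab qone (0, 1, 0, 0) (E0 6) = - E0 5"
  "stab qone (0, 0, 1, 0) (E0 3) = E0 5" "stab qone (0, 0, 1, 0) (E0 4) = - E0 6"
  "stab qone (0, 0, 1, 0) (E0 5) = - E0 3" "stab qone (0, 0, 1, 0) (E0 6) = E0 4"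
  "stab (r2, r2, 0, 0) qone (E0 0) = E0 0" "stab (r2, r2, 0, 0) qone (E0 1) = E0 2"
  "stab (r2, r2, 0, 0) qone (E0 2) = - E0 1"
  "stab (r2, r2, 0, 0) qone (E0 3) = r2 *\<^sub>R (E0 3 - E0 4)" "stab (r2, r2, 0, 0) qone (E0 4) = r2 *\<^sub>R (E0 3 + E0 4)"
  "stab (r2, r2, 0, 0) qone (E0 5) = r2 *\<^sub>R (E0 5 + E0 6)" "stab (r2, r2, 0, 0) qone (E0 6) = r2 *\<^sub>R (E0 6 - E0 5)"
  "stab (r2, 0, 0, r2) qone (E0 0) = E0 1" "stab (r2, 0, 0, r2) qone (E0 1) = - E0 0"
  "stab (r2, 0, 0, r2) qone (E0 2) = E0 2"
  "stab (r2, 0, 0, r2) qone (E0 3) = r2 *\<^sub>R (E0 3 - E0 6)" "stab (r2, 0, 0, r2) qone (E0 4) = r2 *\<^sub>R (E0 4 + E0 5)"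
  "stab (r2, 0, 0, r2) qone (E0 5) = r2 *\<^sub>R (E0 5 - E0 4)" "stab (r2, 0, 0, r2) qone (E0 6) = r2 *\<^sub>R (E0 6 + E0 3)"
  by (simp_all add: stab_eq qmul_def qconj_def qone_def r2_sq zero_prod_def split: prod.splits)

context
  fixes f :: "H2 list \<Rightarrow> real"
  assumes f: "is_form_at p0 3 f"
begin

lemma tri_lin:
  "f [u + v, x, y] = f [u, x, y] + f [v, x, y]" "f [x, u + v, y] = f [x, u, y] + f [x, v, y]" "f [x, y, u + v] = f [x, y, u] + f [x, y, v]"
  "f [u - v, x, y] = f [u, x, y] - f [v, x, y]" "f [x, u - v, y] = f [x, u, y] - f [x, v, y]" "f [x, y, u - v] = f [x, y, u] - f [x, y, v]"
  "f [- u, x, y] = - f [u, x, y]" "f [x, - u, y] = - f [x, u, y]" "f [x, y, - u] = - f [x, y, u]"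
  "f [c *\<^sub>R u, x, y] = c * f [u, x, y]" "f [x, c *\<^sub>R u, y] = c * f [x, u, y]" "f [x, y, c *\<^sub>R u] = c * f [x, y, u]"
proof -
  note m = is_form_at_mlin[OF p0_S7 f]
  have 1: "f [a *\<^sub>R u + b *\<^sub>R v, x, y] = a * f [u, x, y] + b * f [v, x, y]" for a b u v x y
    using mlinD[OF m, of "[]" "[x, y]"] by simp
  have 2: "f [x, a *\<^sub>R u + b *\<^sub>R v, y] = a * f [x, u, y] + b * f [x, v, y]" for a b u v x y
    using mlinD[OF m, of "[x]" "[y]"] by simp
  have 3: "f [x, y, a *\<^sub>R u + b *\<^sub>R v] = a * f [x, y, u] + b * f [x, y, v]" for a b u v x y
    using mlinD[OF m, of "[x, y]" "[]"] by simp
  show "f [u + v, x, y] = f [u, x, y] + f [v, x, y]" "f [x, u + v, y] = f [x, u, y] + f [x, v, y]" "f [x, y, u + v] = f [x, y, u] + f [x, y, v]"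
    using 1[of 1 u 1 v x y] 2[of x 1 u 1 v y] 3[of x y 1 u 1 v] by simp_all
  show "f [u - v, x, y] = f [u, x, y] - f [v, x, y]" "f [x, u - v, y] = f [x, u, y] - f [x, v, y]" "f [x, y, u - v] = f [x, y, u] - f [x, y, v]"
    using 1[of 1 u "-1" v x y] 2[of x 1 u "-1" v y] 3[of x y 1 u "-1" v] by simp_all
  show "f [- u, x, y] = - f [u, x, y]" "f [x, - u, y] = - f [x, u, y]" "f [x, y, - u] = - f [x, y, u]"
    using 1[of "-1" u 0 0 x y] 2[of x "-1" u 0 0 y] 3[of x y "-1" u 0 0] by simp_all
  show "f [c *\<^sub>R u, x, y] = c * f [u, x, y]" "f [x, c *\<^sub>R u, y] = c * f [x, u, y]" "f [x, y, c *\<^sub>R u] = c * f [x, y, u]"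
    using 1[of c u 0 0 x y] 2[of x c u 0 0 y] 3[of x y c u 0 0] by simp_all
qed

lemma tri_skew: "f [x, z, y] = - f [x, y, z]" "f [x, y, y] = 0"
proof -
  show s: "f [x, z, y] = - f [x, y, z]" for z y
    using skewD[OF is_form_at_skew[OF p0_S7 f], of "[x]" "[]" z y] by simp
  show "f [x, y, y] = 0" using s[of y y] by simp
qed

text \<open>Four isotropy elements suffice. d = -1 kills the entries with an odd number of
  horizontal vectors. d = i and d = j leave three free horizontal pairs for each vertical vector.
  The quarter turn of the plane of \<open>E0 1\<close> and \<open>E0 2\<close> links the entries of
  these two vectors and clears the remaining ones except a, b, c, e.\<close>

lemma invariant_form_values:
  assumes m: "\<And>us. f (map (stab qone (- qone)) us) = f us"
    and i: "\<And>us. f (map (stab qone (0, 1, 0, 0)) us) = f us"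
    and j: "\<And>us. f (map (stab qone (0, 0, 1, 0)) us) = f us"
    and q: "\<And>us. f (map (stab (r2, r2, 0, 0) qone) us) = f us"
    and abce: "f [E0 0, E0 1, E0 2] = a" "f [E0 0, E0 3, E0 4] = b" "f [E0 1, E0 3, E0 5] = c" "f [E0 1, E0 3, E0 6] = e"
  shows "f = nPhi a b c e p0"
proof -
  have H: "f [E0 X, E0 5, E0 6] = - f [E0 X, E0 3, E0 4]" "f [E0 X, E0 4, E0 6] = f [E0 X, E0 3, E0 5]"
      "f [E0 X, E0 4, E0 5] = - f [E0 X, E0 3, E0 6]"
    if X: "\<And>d. stab qone d (E0 X) = E0 X" for X
    using i[of "[E0 X, E0 3, E0 5]"] i[of "[E0 X, E0 3, E0 6]"] j[of "[E0 X, E0 3, E0 4]"]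
    unfolding list.map X stab_E0 tri_lin by (simp_all del: E0_simps)
  note H = H[OF stab_E0(1)] H[OF stab_E0(2)] H[OF stab_E0(3)]
  have odd1: "f [E0 X, E0 Y, E0 Z] = 0"
    if "stab qone (- qone) (E0 X) = E0 X" "stab qone (- qone) (E0 Y) = E0 Y" "stab qone (- qone) (E0 Z) = - E0 Z" for X Y Z
    using m[of "[E0 X, E0 Y, E0 Z]"] unfolding list.map that tri_lin by simp
  have odd3: "f [E0 X, E0 Y, E0 Z] = 0"
    if "stab qone (- qone) (E0 X) = - E0 X" "stab qone (- qone) (E0 Y) = - E0 Y" "stab qone (- qone) (E0 Z) = - E0 Z" for X Y Z
    using m[of "[E0 X, E0 Y, E0 Z]"] unfolding list.map that tri_lin by simp
  \<comment> \<open>The quarter turn puts a factor r2 on both horizontal arguments, and r2^2 =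
    1/2.\<close>
  have rr: "f [x, r2 *\<^sub>R u, r2 *\<^sub>R v] = f [x, u, v] / 2" for x u v
    unfolding tri_lin mult.assoc[symmetric] r2_sq by simp
  note qr = q[of "[E0 1, E0 3, E0 4]", unfolded list.map stab_E0, unfolded rr, unfolded tri_lin tri_skew(2) tri_skew(1)[of _ "E0 4" "E0 3"]]
    q[of "[E0 2, E0 3, E0 4]", unfolded list.map stab_E0, unfolded rr, unfolded tri_lin tri_skew(2) tri_skew(1)[of _ "E0 4" "E0 3"]]
    q[of "[E0 0, E0 3, E0 5]", unfolded list.map stab_E0, unfolded rr, unfolded tri_lin H]
    q[of "[E0 0, E0 3, E0 6]", unfolded list.map stab_E0, unfolded rr, unfolded tri_lin H]
    q[of "[E0 1, E0 3, E0 5]", unfolded list.map stab_E0, unfolded rr, unfolded tri_lin H]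
    q[of "[E0 1, E0 3, E0 6]", unfolded list.map stab_E0, unfolded rr, unfolded tri_lin H]
  have Q: "f [E0 1, E0 3, E0 4] = 0" "f [E0 2, E0 3, E0 4] = 0" "f [E0 0, E0 3, E0 5] = 0" "f [E0 0, E0 3, E0 6] = 0"
     "f [E0 2, E0 3, E0 6] = c" "f [E0 2, E0 3, E0 5] = - e"
    using qr abce by (simp_all del: E0_simps One_nat_def)
  \<comment> \<open>The 35 values in the lexicographic order in which \<open>incs\<close> produces
    the triples.\<close>
  let ?vals = "[a, 0, 0, 0, 0, 0, 0, 0, 0, b, 0, 0, 0, 0, - b, 0, 0, 0, 0, 0, c, e, - e, c, 0, 0, - e, c, - c, - e, 0, 0, 0, 0, 0]"
  have inc: "incs 3 [0..<7] = incs (Suc (Suc (Suc 0))) [0, 1, 2, 3, 4, 5, 6::nat]"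
    unfolding upt7 by (simp add: numeral_3_eq_3)
  have 1: "map (\<lambda>js. f (map E0 js)) (incs 3 [0..<7]) = ?vals"
    unfolding inc by (simp add: H Q odd1 odd3 abce stab_E0 del: E0_simps One_nat_def)
  have 2: "map (\<lambda>js. Phi a b c e p0 (map E0 js)) (incs 3 [0..<7]) = ?vals"
    unfolding inc by (simp add: Phi_def Let_def w111_def w12_def th_E0 del: E0_simps)
  have 3: "js \<in> set (incs 3 [0..<7]) \<Longrightarrow> length js = 3 \<and> set js \<subseteq> {..<7}" for js
    unfolding inc by auto
  show ?thesis
  proof (rule form_ext[OF p0_S7 f is_form_at_th_forms(2)[OF p0_S7] tbasis_E0])
    show "\<forall>js\<in>set (incs 3 [0..<7]). f (map E0 js) = nPhi a b c e p0 (map E0 js)"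
    proof
      fix js assume js: "js \<in> set (incs 3 [0..<7])"
      have "map (\<lambda>js. f (map E0 js)) (incs 3 [0..<7]) = map (\<lambda>js. Phi a b c e p0 (map E0 js)) (incs 3 [0..<7])"
        unfolding 1 2 ..
      then have "f (map E0 js) = Phi a b c e p0 (map E0 js)" using js unfolding map_eq_conv by blast
      then show "f (map E0 js) = nPhi a b c e p0 (map E0 js)" using 3[OF js] nforms_E0(2)[of js a b c e] by simp
    qed
  qed
qed

end

lemma nrm_stab:
  assumes inv: "invariant_form G 3 \<phi>" and g: "g \<in> G" "g p0 = p0"
    and lin: "\<And>v. g (tproj p0 v) = tproj p0 (g v)"
  shows "nrm p0 3 (\<phi> p0) (map g us) = nrm p0 3 (\<phi> p0) us"
proof (cases "length us = 3")
  case True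
  let ?vs = "map (tproj p0) us"
  have "\<phi> (g p0) (map g ?vs) = \<phi> p0 ?vs"
    using inv g(1) p0_S7 True tproj_in_tangent[OF p0_S7] unfolding invariant_form_def
    by (metis (no_types, lifting) image_subset_iff length_map list.set_map)
  moreover have m: "map (tproj p0) (map g us) = map g ?vs" using lin by simp
  ultimately have "\<phi> p0 (map (tproj p0) (map g us)) = \<phi> p0 ?vs" unfolding m g(2) by simp
  then show ?thesis using True by (simp only: nrm_def length_map if_True simp_thms)
qed (simp add: nrm_def)

lemma stab_tproj:
  assumes "qmul q (qconj q) = qone"
  shows "stab q d p0 = p0" "stab q d (tproj p0 v) = tproj p0 (stab q d v)"
proof -
  show "stab q d p0 = p0" by (simp add: p0_quat stab_eq assms)
  obtain v1 v2 where v: "v = (v1, v2)" by (cases v)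
  have t: "tproj p0 (x, y) = (x - fst x *\<^sub>R qone, y)" for x y
    by (cases x) (simp add: tproj_def p0_def qone_def inner_prod_def zero_prod_def[symmetric])
  have re: "fst (qmul (qmul q x) (qconj q)) = fst x" for x
  proof -
    obtain a b c d where q: "q = (a, b, c, d)" by (metis prod.collapse)
    obtain x0 x1 x2 x3 where x: "x = (x0, x1, x2, x3)" by (metis prod.collapse)
    have n: "a * a + b * b + c * c + d * d = 1" using assms by (simp add: q qmul_def qconj_def qone_def)
    have "fst (qmul (qmul q x) (qconj q)) = (a * a + b * b + c * c + d * d) * x0"
      by (simp add: q x qmul_def qconj_def algebra_simps)
    then show ?thesis by (simp add: n x)
  qed
  have lin: "qmul (qmul q (x - r *\<^sub>R qone)) (qconj q) = qmul (qmul q x) (qconj q) - r *\<^sub>R qone" for x r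
  proof -
    have "qmul q (x - r *\<^sub>R qone) = qmul q x + (- r) *\<^sub>R q"
      using qmul_add_right[of q x "(- r) *\<^sub>R qone"] by (simp add: qmul_scale_right)
    then show ?thesis
      using assms qmul_add_left[of "qmul q x" "(- r) *\<^sub>R q" "qconj q"] by (simp add: qmul_scale_left)
  qed
  show "stab q d (tproj p0 v) = tproj p0 (stab q d v)"
    unfolding v t stab_eq re lin ..
qed

theorem invariant_form_Phi:
  assumes k: "is_kform 3 \<phi>" and inv: "invariant_form G_U1 3 \<phi>"
  shows "form_eq 3 \<phi> (Phi (\<phi> p0 [E0 0, E0 1, E0 2]) (\<phi> p0 [E0 0, E0 3, E0 4]) (\<phi> p0 [E0 1, E0 3, E0 5]) (\<phi> p0 [E0 1, E0 3, E0 6]))"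
    (is "form_eq 3 \<phi> (Phi ?a ?b ?c ?e)")
proof -
  have f: "is_form_at p0 3 (nrm p0 3 (\<phi> p0))"
    using k p0_S7 unfolding is_kform_def by (intro is_form_at_nrm) auto
  have n: "nrm p0 3 (\<phi> p0) [E0 i, E0 j, E0 k] = \<phi> p0 [E0 i, E0 j, E0 k]" if "i < 7" "j < 7" "k < 7" for i j k
    using E0_tangent[of "[i, j, k]"] that by (intro nrm_tangent) auto
  have q1: "qmul qone (qconj qone) = qone" by simp
  have q2: "qmul (r2, r2, 0, 0) (qconj (r2, r2, 0, 0)) = qone"
    by (simp add: qmul_def qconj_def qone_def r2_sq)
  note inv1 = nrm_stab[OF inv stab_G_U1(1) stab_tproj[OF q1]] and inv2 = nrm_stab[OF inv stab_G_U1(2) stab_tproj[OF q2]]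
  have e: "nrm p0 3 (\<phi> p0) = nPhi ?a ?b ?c ?e p0"
  proof (rule invariant_form_values[OF f])
    show "nrm p0 3 (\<phi> p0) (map (stab qone (- qone)) us) = nrm p0 3 (\<phi> p0) us" for us
      by (rule inv1) (simp add: qmul_def qconj_def qone_def)
    show "nrm p0 3 (\<phi> p0) (map (stab qone (0, 1, 0, 0)) us) = nrm p0 3 (\<phi> p0) us" for us
      by (rule inv1) (simp add: qmul_def qconj_def qone_def)
    show "nrm p0 3 (\<phi> p0) (map (stab qone (0, 0, 1, 0)) us) = nrm p0 3 (\<phi> p0) us" for us
      by (rule inv1) (simp add: qmul_def qconj_def qone_def)
    show "nrm p0 3 (\<phi> p0) (map (stab (r2, r2, 0, 0) qone) us) = nrm p0 3 (\<phi> p0) us" for us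
      by (rule inv2[of qone]) simp
  qed (rule n; simp)+
  show ?thesis
    unfolding form_eq_def
  proof (intro ballI allI impI)
    fix p vs assume p: "p \<in> S7" and vs: "length vs = 3" "set vs \<subseteq> tangent p"
    obtain A where A: "A \<in> Sp2" "act A qone p0 = p" using Sp2_transitive[OF p] .
    define h where "h = act A qone"
    have h: "hiso h" unfolding h_def by (rule hiso_act[OF A(1)])
    have hG: "h \<in> G_U1" using A(1) U1_qone unfolding h_def G_U1_def by blast
    have hp: "h p0 = p" using A(2) by (simp add: h_def)
    define ws where "ws = map (inv h) vs"
    have hw: "map h ws = vs" using hiso_bij[OF h] by (simp add: ws_def o_def bij_is_surj surj_f_inv_f)
    have ws: "length ws = 3" using vs by (simp add: ws_def)
    have wT: "set ws \<subseteq> tangent p0"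
      using vs(2) hiso_tangent[OF h, of _ p0] unfolding hp hw[symmetric] by auto
    have "\<phi> p vs = \<phi> p0 ws" using inv hG p0_S7 ws wT unfolding invariant_form_def by (metis hp hw)
    also have "\<dots> = Phi ?a ?b ?c ?e p0 ws"
      using fun_cong[OF e, of ws] unfolding nPhi_def nrm_tangent[OF ws wT] .
    also have "\<dots> = Phi ?a ?b ?c ?e p vs" using th_forms_hiso(2)[OF h ws, of _ _ _ _ p0] unfolding hp hw by simp
    finally show "\<phi> p vs = Phi ?a ?b ?c ?e p vs" .
  qed
qed

lemma Phi_E0_values:
  "Phi a b c e p0 [E0 0, E0 1, E0 2] = a" "Phi a b c e p0 [E0 0, E0 3, E0 4] = b"
  "Phi a b c e p0 [E0 1, E0 3, E0 5] = c" "Phi a b c e p0 [E0 1, E0 3, E0 6] = e"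
  by (simp_all add: Phi_def Let_def w111_def w12_def th_E0 del: E0_simps)

text \<open>The unit (1 + k) / sqrt 2 turns \<open>E0 0\<close> into \<open>E0 1\<close>, a symmetry
  that \<open>U1\<close> does not provide; comparing two entries under it gives the two
  relations.\<close>

lemma invariant_G_Sp1:
  assumes inv: "invariant_form G_Sp1 3 \<phi>" and eq: "form_eq 3 \<phi> (Phi a b c e)"
  shows "c = b" "e = 0"
proof -
  have q: "qmul (r2, 0, 0, r2) (qconj (r2, 0, 0, r2)) = qone"
    by (simp add: qmul_def qconj_def qone_def r2_sq)
  note inv1 = nrm_stab[OF inv stab_G_Sp1 stab_tproj[OF q]]
  have f: "nrm p0 3 (\<phi> p0) = nPhi a b c e p0"
  proof
    fix us show "nrm p0 3 (\<phi> p0) us = nPhi a b c e p0 us"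
    proof (cases "length us = 3")
      case True
      have "set (map (tproj p0) us) \<subseteq> tangent p0"
        unfolding set_map using tproj_in_tangent[OF p0_S7] by blast
      then have "\<phi> p0 (map (tproj p0) us) = Phi a b c e p0 (map (tproj p0) us)"
        using eq p0_S7 True unfolding form_eq_def by (metis length_map)
      then show ?thesis using True by (simp only: nPhi_def nrm_def if_True simp_thms)
    qed (simp add: nPhi_def nrm_def)
  qed
  let ?f = "nPhi a b c e p0"
  have isf: "is_form_at p0 3 ?f" by (rule is_form_at_th_forms(2)[OF p0_S7])
  have n: "?f [E0 i, E0 j, E0 k] = Phi a b c e p0 [E0 i, E0 j, E0 k]" if "i < 7" "j < 7" "k < 7" for i j k
    using nforms_E0(2)[of "[i, j, k]"] that by simp
  have i: "?f (map (stab (r2, 0, 0, r2) qone) us) = ?f us" for us using inv1[of us] unfolding f .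
  have rr: "?f [x, r2 *\<^sub>R u, r2 *\<^sub>R v] = ?f [x, u, v] / 2" for x u v
    unfolding tri_lin[OF isf] mult.assoc[symmetric] r2_sq by simp
  note iv = i[of "[E0 0, E0 3, E0 4]", unfolded list.map stab_E0, unfolded rr, unfolded tri_lin[OF isf] tri_skew(1)[OF isf, of _ "E0 6" "E0 4"] tri_skew(1)[OF isf, of _ "E0 6" "E0 5"]]
    i[of "[E0 1, E0 3, E0 6]", unfolded list.map stab_E0, unfolded rr, unfolded tri_lin[OF isf] tri_skew(2)[OF isf] tri_skew(1)[OF isf, of _ "E0 6" "E0 3"]]
  show "c = b" using iv(1) by (simp add: n Phi_def Let_def w111_def w12_def th_E0 del: E0_simps)
  show "e = 0" using iv(2) by (simp add: n Phi_def Let_def w111_def w12_def th_E0 del: E0_simps)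
qed

section \<open>Injectivity of the coefficient map\<close>

text \<open>The four coefficients of the Laplacian, up to powers of \<open>\<rho>\<close> and a common scale factor, in the
  coordinates \<open>\<sigma> = s\<^sup>2 / T\<close>, \<open>u = c / b\<close> and \<open>\<rho>\<close>.\<close>

definition Cf :: "real \<Rightarrow> real \<Rightarrow> real \<Rightarrow> real" where
  "Cf \<sigma> u \<rho> = 2 * (1 + 2 * u) * \<rho> * \<sigma>\<^sup>2 + \<sigma> + (2 * u - 1) / \<rho>"

definition Af :: "real \<Rightarrow> real \<Rightarrow> real \<Rightarrow> real" where
  "Af \<sigma> u \<rho> = \<rho> * (1 + 2 * \<rho>) * \<sigma> ^ 3 + (2 * u - 1 + 2 * \<rho>) * \<sigma>\<^sup>2"

definition Bf :: "real \<Rightarrow> real \<Rightarrow> real \<Rightarrow> real" where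
  "Bf \<sigma> u \<rho> = 2 * (1 + 2 * u) * \<rho> * \<sigma>\<^sup>2 + (2 * \<rho> - 1) * \<sigma> + 2 - (2 * u - 1) / \<rho>"

definition Ef :: "real \<Rightarrow> real \<Rightarrow> real \<Rightarrow> real" where
  "Ef \<sigma> u \<rho> = 1 + 2 * \<sigma>\<^sup>2 * \<rho>\<^sup>2"

text \<open>Derivatives in the direction \<open>(X, U, R)\<close> of the coordinates \<open>(ln \<sigma>, u, \<rho>)\<close>.\<close>

definition Cd :: "real \<Rightarrow> real \<Rightarrow> real \<Rightarrow> real \<Rightarrow> real \<Rightarrow> real \<Rightarrow> real" where
  "Cd \<sigma> u \<rho> X U R = X * (4 * (1 + 2 * u) * \<rho> * \<sigma>\<^sup>2 + \<sigma>) + U * (4 * \<rho> * \<sigma>\<^sup>2 + 2 / \<rho>)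
     + R * (2 * (1 + 2 * u) * \<sigma>\<^sup>2 - (2 * u - 1) / \<rho>\<^sup>2)"

definition Ad :: "real \<Rightarrow> real \<Rightarrow> real \<Rightarrow> real \<Rightarrow> real \<Rightarrow> real \<Rightarrow> real" where
  "Ad \<sigma> u \<rho> X U R = X * (3 * (\<rho> * (1 + 2 * \<rho>)) * \<sigma> ^ 3 + 2 * (2 * u - 1 + 2 * \<rho>) * \<sigma>\<^sup>2) + U * (2 * \<sigma>\<^sup>2)
     + R * ((1 + 4 * \<rho>) * \<sigma> ^ 3 + 2 * \<sigma>\<^sup>2)"

definition Bd :: "real \<Rightarrow> real \<Rightarrow> real \<Rightarrow> real \<Rightarrow> real \<Rightarrow> real \<Rightarrow> real" where
  "Bd \<sigma> u \<rho> X U R = X * (4 * (1 + 2 * u) * \<rho> * \<sigma>\<^sup>2 + (2 * \<rho> - 1) * \<sigma>) + U * (4 * \<rho> * \<sigma>\<^sup>2 - 2 / \<rho>)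
     + R * (2 * (1 + 2 * u) * \<sigma>\<^sup>2 + 2 * \<sigma> + (2 * u - 1) / \<rho>\<^sup>2)"

definition Ed :: "real \<Rightarrow> real \<Rightarrow> real \<Rightarrow> real \<Rightarrow> real \<Rightarrow> real \<Rightarrow> real" where
  "Ed \<sigma> u \<rho> X U R = X * (4 * \<sigma>\<^sup>2 * \<rho>\<^sup>2) + R * (4 * \<sigma>\<^sup>2 * \<rho>)"

context
  fixes S u \<rho> :: "real \<Rightarrow> real" and X U R :: real and t :: real
  assumes S: "(S has_real_derivative S t * X) (at t)" and u: "(u has_real_derivative U) (at t)"
    and r: "(\<rho> has_real_derivative R) (at t)" and r0: "\<rho> t \<noteq> 0"
begin

lemma Cf_deriv: "((\<lambda>t. Cf (S t) (u t) (\<rho> t)) has_real_derivative Cd (S t) (u t) (\<rho> t) X U R) (at t)"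
  unfolding Cf_def Cd_def
  by (rule derivative_eq_intros S u r r0 refl)+ (use r0 in \<open>simp add: field_simps power2_eq_square\<close>)

lemma Bf_deriv: "((\<lambda>t. Bf (S t) (u t) (\<rho> t)) has_real_derivative Bd (S t) (u t) (\<rho> t) X U R) (at t)"
  unfolding Bf_def Bd_def
  by (rule derivative_eq_intros S u r r0 refl)+ (use r0 in \<open>simp add: field_simps power2_eq_square\<close>)

lemma Af_deriv: "((\<lambda>t. Af (S t) (u t) (\<rho> t)) has_real_derivative Ad (S t) (u t) (\<rho> t) X U R) (at t)"
  unfolding Af_def Ad_def
  by (rule derivative_eq_intros S u r r0 refl)+ (simp add: algebra_simps power2_eq_square power3_eq_cube)

lemma Ef_deriv: "((\<lambda>t. Ef (S t) (u t) (\<rho> t)) has_real_derivative Ed (S t) (u t) (\<rho> t) X U R) (at t)"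
  unfolding Ef_def Ed_def
  by (rule derivative_eq_intros S u r r0 refl)+ (simp add: algebra_simps power2_eq_square)

end

section \<open>Estimates uniform in \<sigma> near u = \<rho> = 1\<close>

text \<open>With u and w within 1/100000 of 1 and 0, the number u^2 + w^2 is within 3/100000 of 1.
  On a segment \<rho> is interpolated on its own, hence it is a parameter independent of u
  here.\<close>

locale near_one =
  fixes \<sigma> u \<rho> :: real
  assumes s: "\<sigma> > 0" and u: "\<bar>u - 1\<bar> \<le> 3 / 100000" and \<rho>: "\<bar>\<rho> - 1\<bar> \<le> 3 / 100000"
begin

lemma \<rho>_pos: "\<rho> > 0"
  using \<rho> by linarith

text \<open>At u = \<rho> = 1 the five expressions are 6, 3, 1, 2 and 1.\<close>

lemma prod_bounds:
  "599 / 100 \<le> 2 * (1 + 2 * u) * \<rho>" "2 * (1 + 2 * u) * \<rho> \<le> 601 / 100"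
  "299 / 100 \<le> \<rho> * (1 + 2 * \<rho>)" "\<rho> * (1 + 2 * \<rho>) \<le> 301 / 100"
  "99 / 100 \<le> (2 * u - 1) / \<rho>" "(2 * u - 1) / \<rho> \<le> 101 / 100"
  "199 / 100 \<le> 2 / \<rho>" "2 / \<rho> \<le> 201 / 100"
  "99 / 100 \<le> (2 * u - 1) / \<rho>\<^sup>2" "(2 * u - 1) / \<rho>\<^sup>2 \<le> 101 / 100"
proof -
  define x y where "x = u - 1" and "y = \<rho> - 1"
  have xy: "\<bar>x\<bar> \<le> 3 / 100000" "\<bar>y\<bar> \<le> 3 / 100000" using u \<rho> by (simp_all add: x_def y_def)
  have uv: "u = 1 + x" "\<rho> = 1 + y" by (simp_all add: x_def y_def)
  have "\<bar>x * y\<bar> \<le> (3 / 100000) * (3 / 100000)" unfolding abs_mult using xy by (intro mult_mono) auto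
  then have pxy: "\<bar>x * y\<bar> \<le> 1 / 1000000" by linarith
  have "\<bar>y * y\<bar> \<le> (3 / 100000) * (3 / 100000)" unfolding abs_mult using xy by (intro mult_mono) auto
  then have pyy: "\<bar>y * y\<bar> \<le> 1 / 1000000" by linarith
  have e1: "2 * (1 + 2 * u) * \<rho> = 6 + 4 * x + 6 * y + 4 * (x * y)" by (simp add: uv algebra_simps)
  show "599 / 100 \<le> 2 * (1 + 2 * u) * \<rho>" "2 * (1 + 2 * u) * \<rho> \<le> 601 / 100"
    unfolding e1 using xy pxy by linarith+
  have e2: "\<rho> * (1 + 2 * \<rho>) = 3 + 5 * y + 2 * (y * y)" by (simp add: uv algebra_simps)
  show "299 / 100 \<le> \<rho> * (1 + 2 * \<rho>)" "\<rho> * (1 + 2 * \<rho>) \<le> 301 / 100"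
    unfolding e2 using xy pyy by linarith+
  show "99 / 100 \<le> (2 * u - 1) / \<rho>" "(2 * u - 1) / \<rho> \<le> 101 / 100" "199 / 100 \<le> 2 / \<rho>" "2 / \<rho> \<le> 201 / 100"
    using xy \<rho>_pos unfolding uv by (simp_all add: field_simps)
  have e3: "\<rho>\<^sup>2 = 1 + 2 * y + y * y" by (simp add: uv power2_eq_square algebra_simps)
  have "\<rho>\<^sup>2 > 0" using \<rho>_pos by simp
  moreover have "(99 / 100) * \<rho>\<^sup>2 \<le> 2 * u - 1" "2 * u - 1 \<le> (101 / 100) * \<rho>\<^sup>2"
    using e3 uv xy pyy by linarith+
  ultimately show "99 / 100 \<le> (2 * u - 1) / \<rho>\<^sup>2" "(2 * u - 1) / \<rho>\<^sup>2 \<le> 101 / 100"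
    using pos_le_divide_eq[of "\<rho>\<^sup>2" "99 / 100" "2 * u - 1"] pos_divide_le_eq[of "\<rho>\<^sup>2" "2 * u - 1" "101 / 100"]
    by blast+
qed

lemma Cf_lower: "Cf \<sigma> u \<rho> \<ge> (599 / 100) * \<sigma>\<^sup>2 + \<sigma> + 99 / 100"
  unfolding Cf_def using mult_right_mono[OF prod_bounds(1) zero_le_power2[of \<sigma>]] prod_bounds(5) by linarith

lemma Cf_pos: "Cf \<sigma> u \<rho> > 0"
  using Cf_lower s zero_le_power2[of \<sigma>] by linarith

lemma Af_lower: "Af \<sigma> u \<rho> \<ge> (299 / 100) * \<sigma> ^ 3 + (299 / 100) * \<sigma>\<^sup>2"
proof -
  have "299 / 100 \<le> 2 * u - 1 + 2 * \<rho>" using u \<rho> by linarith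
  then show ?thesis
    unfolding Af_def using s prod_bounds(3) by (intro add_mono mult_right_mono) auto
qed

lemma Af_pos: "Af \<sigma> u \<rho> > 0"
proof -
  have "\<sigma> ^ 3 > 0" "\<sigma>\<^sup>2 > 0" using s by simp_all
  then show ?thesis using Af_lower by linarith
qed

text \<open>In other words, the derivative of ln (A / C) with respect to ln \<sigma> is at least 1/5
  for every \<sigma>. The difference of the two sides is a polynomial in \<sigma> with nonnegative
  coefficients. The tightest one is that of \<sigma>^4, at the centre 6 - 21/5, where any constant
  up to 2/7 would do.\<close>

lemma log_slope:
  "(3 * (\<rho> * (1 + 2 * \<rho>)) * \<sigma> ^ 3 + 2 * (2 * u - 1 + 2 * \<rho>) * \<sigma>\<^sup>2) * Cf \<sigma> u \<rho>
    - Af \<sigma> u \<rho> * (4 * (1 + 2 * u) * \<rho> * \<sigma>\<^sup>2 + \<sigma>) \<ge> (1 / 5) * (Af \<sigma> u \<rho> * Cf \<sigma> u \<rho>)"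
proof -
  define p q n m where "p = \<rho> * (1 + 2 * \<rho>)" and "q = 2 * u - 1 + 2 * \<rho>" and "n = 2 * (1 + 2 * u) * \<rho>" and "m = (2 * u - 1) / \<rho>"
  have b: "299 / 100 \<le> p" "p \<le> 301 / 100" "299 / 100 \<le> q" "q \<le> 301 / 100" "599 / 100 \<le> n" "n \<le> 601 / 100" "99 / 100 \<le> m" "m \<le> 101 / 100"
    using prod_bounds u \<rho> unfolding p_def q_def n_def m_def by linarith+
  have "q * n \<le> (301 / 100) * (601 / 100)" using b by (intro mult_mono) auto
  then have qn: "p + q * n \<le> 10 * p" using b by linarith
  have c5: "(4 / 5) * (p * n) \<ge> 0" and c3: "(14 / 5) * (p * m) + (4 / 5) * q \<ge> 0" and c2: "(9 / 5) * (q * m) \<ge> 0"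
    using b by auto
  have "(1 / 5) * (p + q * n) \<le> (1 / 5) * (10 * p)" using qn by (intro mult_left_mono) auto
  then have c4: "2 * p - (1 / 5) * (p + q * n) \<ge> 0" by simp
  have "(3 * p * \<sigma> ^ 3 + 2 * q * \<sigma>\<^sup>2) * (n * \<sigma>\<^sup>2 + \<sigma> + m) - (p * \<sigma> ^ 3 + q * \<sigma>\<^sup>2) * (2 * n * \<sigma>\<^sup>2 + \<sigma>)
      - (1 / 5) * ((p * \<sigma> ^ 3 + q * \<sigma>\<^sup>2) * (n * \<sigma>\<^sup>2 + \<sigma> + m))
    = ((4 / 5) * (p * n)) * \<sigma> ^ 5 + (2 * p - (1 / 5) * (p + q * n)) * \<sigma> ^ 4
      + ((14 / 5) * (p * m) + (4 / 5) * q) * \<sigma> ^ 3 + ((9 / 5) * (q * m)) * \<sigma>\<^sup>2"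
    by (simp add: power_numeral_reduce field_simps)
  also have "\<dots> \<ge> 0"
    by (intro add_nonneg_nonneg mult_nonneg_nonneg[OF c5] mult_nonneg_nonneg[OF c4] mult_nonneg_nonneg[OF c3]
        mult_nonneg_nonneg[OF c2]) (use s in auto)
  finally show ?thesis unfolding Cf_def Af_def p_def q_def n_def m_def by (simp add: algebra_simps)
qed

text \<open>Partial derivatives are bounded by multiples of the functions themselves, so logarithmic
  derivatives are bounded uniformly in \<sigma>.\<close>

lemma coeff_bounds:
  "0 \<le> 2 * \<sigma>\<^sup>2" "2 * \<sigma>\<^sup>2 \<le> Af \<sigma> u \<rho>"
  "0 \<le> (1 + 4 * \<rho>) * \<sigma> ^ 3 + 2 * \<sigma>\<^sup>2" "(1 + 4 * \<rho>) * \<sigma> ^ 3 + 2 * \<sigma>\<^sup>2 \<le> 2 * Af \<sigma> u \<rho>"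
  "0 \<le> 4 * (1 + 2 * u) * \<rho> * \<sigma>\<^sup>2 + \<sigma>" "4 * (1 + 2 * u) * \<rho> * \<sigma>\<^sup>2 + \<sigma> \<le> 2 * Cf \<sigma> u \<rho>"
  "0 \<le> 4 * \<rho> * \<sigma>\<^sup>2 + 2 / \<rho>" "4 * \<rho> * \<sigma>\<^sup>2 + 2 / \<rho> \<le> 3 * Cf \<sigma> u \<rho>"
  "\<bar>2 * (1 + 2 * u) * \<sigma>\<^sup>2 - (2 * u - 1) / \<rho>\<^sup>2\<bar> \<le> 2 * Cf \<sigma> u \<rho>"
proof -
  have s2: "\<sigma>\<^sup>2 \<ge> 0" and s3: "\<sigma> ^ 3 \<ge> 0" using s by simp_all
  show "0 \<le> 2 * \<sigma>\<^sup>2" "2 * \<sigma>\<^sup>2 \<le> Af \<sigma> u \<rho>" using Af_lower s2 s3 by linarith+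
  have "(1 + 4 * \<rho>) * \<sigma> ^ 3 \<le> (501 / 100) * \<sigma> ^ 3" "0 \<le> (1 + 4 * \<rho>) * \<sigma> ^ 3"
    using \<rho> by (intro mult_right_mono mult_nonneg_nonneg s3; linarith)+
  then show "0 \<le> (1 + 4 * \<rho>) * \<sigma> ^ 3 + 2 * \<sigma>\<^sup>2" "(1 + 4 * \<rho>) * \<sigma> ^ 3 + 2 * \<sigma>\<^sup>2 \<le> 2 * Af \<sigma> u \<rho>"
    using Af_lower s2 s3 by linarith+
  have n: "0 \<le> 2 * (1 + 2 * u) * \<rho> * \<sigma>\<^sup>2" by (rule mult_nonneg_nonneg[OF _ s2]) (use prod_bounds(1) in linarith)
  have n2: "4 * (1 + 2 * u) * \<rho> * \<sigma>\<^sup>2 = 2 * (2 * (1 + 2 * u) * \<rho> * \<sigma>\<^sup>2)" by simp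
  show "0 \<le> 4 * (1 + 2 * u) * \<rho> * \<sigma>\<^sup>2 + \<sigma>" "4 * (1 + 2 * u) * \<rho> * \<sigma>\<^sup>2 + \<sigma> \<le> 2 * Cf \<sigma> u \<rho>"
  proof -
    define N M where "N = 2 * (1 + 2 * u) * \<rho> * \<sigma>\<^sup>2" and "M = (2 * u - 1) / \<rho>"
    have N: "0 \<le> N" using n unfolding N_def .
    have M: "0 \<le> M" using prod_bounds(5) unfolding M_def by linarith
    show "0 \<le> 4 * (1 + 2 * u) * \<rho> * \<sigma>\<^sup>2 + \<sigma>"
      unfolding n2 N_def[symmetric] using s N by linarith
    show "4 * (1 + 2 * u) * \<rho> * \<sigma>\<^sup>2 + \<sigma> \<le> 2 * Cf \<sigma> u \<rho>"
      unfolding Cf_def n2 N_def[symmetric] M_def[symmetric] using s M by (simp add: algebra_simps)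
  qed
  have r: "4 * \<rho> * \<sigma>\<^sup>2 \<le> (401 / 100) * \<sigma>\<^sup>2" "0 \<le> 4 * \<rho> * \<sigma>\<^sup>2"
    using \<rho> by (intro mult_right_mono mult_nonneg_nonneg s2; linarith)+
  then show "0 \<le> 4 * \<rho> * \<sigma>\<^sup>2 + 2 / \<rho>" "4 * \<rho> * \<sigma>\<^sup>2 + 2 / \<rho> \<le> 3 * Cf \<sigma> u \<rho>"
    using Cf_lower s prod_bounds(7,8) s2 by linarith+
  have v: "2 * (1 + 2 * u) \<le> 601 / 100" "0 \<le> 2 * (1 + 2 * u)" using u unfolding abs_le_iff by auto
  have "2 * (1 + 2 * u) * \<sigma>\<^sup>2 \<le> (601 / 100) * \<sigma>\<^sup>2" "0 \<le> 2 * (1 + 2 * u) * \<sigma>\<^sup>2"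
    by (rule mult_right_mono[OF v(1) s2], rule mult_nonneg_nonneg[OF v(2) s2])
  then show "\<bar>2 * (1 + 2 * u) * \<sigma>\<^sup>2 - (2 * u - 1) / \<rho>\<^sup>2\<bar> \<le> 2 * Cf \<sigma> u \<rho>"
    using Cf_lower s prod_bounds(9,10) s2 by linarith
qed

text \<open>Both functions are 6 \<sigma>^2 + \<sigma> + 1 at u = \<rho> = 1. The ratio B / (\<rho>
  C) is therefore close to 1 throughout.\<close>

lemma Bf_near: "\<bar>Bf \<sigma> u \<rho> - Cf \<sigma> u \<rho>\<bar> \<le> (1 / 4000) * Cf \<sigma> u \<rho>"
proof -
  define y where "y = \<rho> - 1"
  have "(2 * u - 1) / \<rho> - 1 = (2 * u - 1 - \<rho>) / \<rho>" using \<rho>_pos by (simp add: diff_divide_distrib)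
  then have "\<bar>(2 * u - 1) / \<rho> - 1\<bar> = \<bar>2 * u - 1 - \<rho>\<bar> / \<rho>" using \<rho>_pos by simp
  also have "\<dots> \<le> (9 / 100000) / (9 / 10)" using u \<rho> by (intro frac_le; linarith)
  finally have m: "\<bar>(2 * u - 1) / \<rho> - 1\<bar> \<le> 1 / 10000" by simp
  have y: "\<bar>y * \<sigma>\<bar> \<le> (3 / 100000) * \<sigma>" using mult_right_mono[OF \<rho>, of \<sigma>] s by (simp add: abs_mult y_def)
  have "Bf \<sigma> u \<rho> - Cf \<sigma> u \<rho> = 2 * (y * \<sigma>) - 2 * ((2 * u - 1) / \<rho> - 1)"
    by (simp add: Bf_def Cf_def y_def algebra_simps)
  moreover have "\<bar>d\<bar> \<le> (1 / 4000) * C" if "d = 2 * x - 2 * v" "\<bar>v\<bar> \<le> 1 / 10000" "\<bar>x\<bar> \<le> (3 / 100000) * \<sigma>"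
      "(599 / 100) * t + \<sigma> + 99 / 100 \<le> C" "t \<ge> 0" for d x v C t using that s by linarith
  ultimately show ?thesis using m y Cf_lower zero_le_power2[of \<sigma>] by blast
qed

text \<open>The hypothesis says that A / C is stationary in the direction (X, U, R). Dividing by the
  slope 1/5 turns the bounds 3 and 4 on the other two contributions into 15 and 20.\<close>

lemma variation_A_C:
  assumes "Ad \<sigma> u \<rho> X U R * Cf \<sigma> u \<rho> = Af \<sigma> u \<rho> * Cd \<sigma> u \<rho> X U R"
  shows "\<bar>X\<bar> \<le> 15 * \<bar>U\<bar> + 20 * \<bar>R\<bar>"
proof -
  define ax au ar cx cu cr where "ax = 3 * (\<rho> * (1 + 2 * \<rho>)) * \<sigma> ^ 3 + 2 * (2 * u - 1 + 2 * \<rho>) * \<sigma>\<^sup>2"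
    and "au = 2 * \<sigma>\<^sup>2" and "ar = (1 + 4 * \<rho>) * \<sigma> ^ 3 + 2 * \<sigma>\<^sup>2" and "cx = 4 * (1 + 2 * u) * \<rho> * \<sigma>\<^sup>2 + \<sigma>"
    and "cu = 4 * \<rho> * \<sigma>\<^sup>2 + 2 / \<rho>" and "cr = 2 * (1 + 2 * u) * \<sigma>\<^sup>2 - (2 * u - 1) / \<rho>\<^sup>2"
  define A C where "A = Af \<sigma> u \<rho>" and "C = Cf \<sigma> u \<rho>"
  have pos: "A > 0" "C > 0" using Af_pos Cf_pos by (simp_all add: A_def C_def)
  have slope: "ax * C - A * cx \<ge> (1 / 5) * (A * C)"
    using log_slope unfolding ax_def cx_def A_def C_def .
  have b: "0 \<le> au" "au \<le> A" "0 \<le> ar" "ar \<le> 2 * A" "0 \<le> cu" "cu \<le> 3 * C" "\<bar>cr\<bar> \<le> 2 * C"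
    using coeff_bounds unfolding au_def ar_def cu_def cr_def A_def C_def by blast+
  have "(X * ax + U * au + R * ar) * C = A * (X * cx + U * cu + R * cr)"
    using assms unfolding Ad_def Cd_def A_def C_def ax_def au_def ar_def cx_def cu_def cr_def .
  then have e: "X * (ax * C - A * cx) = U * (A * cu - au * C) + R * (A * cr - ar * C)"
    by (simp add: algebra_simps)
  have 1: "A * cu \<le> A * (3 * C)" "0 \<le> A * cu" "0 \<le> au * C" "au * C \<le> A * C" "0 \<le> ar * C" "ar * C \<le> 2 * A * C"
    using b pos by (auto intro!: mult_left_mono mult_right_mono mult_nonneg_nonneg)
  have 2: "\<bar>A * cr\<bar> \<le> A * (2 * C)" unfolding abs_mult using b pos by (auto intro!: mult_left_mono)
  have m1: "\<bar>A * cu - au * C\<bar> \<le> 3 * (A * C)" using 1 mult_pos_pos[OF pos] by (simp add: algebra_simps abs_le_iff)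
  have m2: "\<bar>A * cr - ar * C\<bar> \<le> 4 * (A * C)" using 1(5,6) 2 by (simp add: algebra_simps abs_le_iff)
  have "\<bar>X\<bar> * ((1 / 5) * (A * C)) \<le> \<bar>X\<bar> * (ax * C - A * cx)" using slope by (intro mult_left_mono) auto
  also have "\<dots> \<le> \<bar>X * (ax * C - A * cx)\<bar>" unfolding abs_mult by (intro mult_left_mono) auto
  also have "\<dots> \<le> \<bar>U * (A * cu - au * C)\<bar> + \<bar>R * (A * cr - ar * C)\<bar>" unfolding e by (rule abs_triangle_ineq)
  also have "\<dots> \<le> \<bar>U\<bar> * (3 * (A * C)) + \<bar>R\<bar> * (4 * (A * C))"
    unfolding abs_mult[of U] abs_mult[of R] using m1 m2 by (intro add_mono mult_left_mono) auto
  finally have "(A * C) * \<bar>X\<bar> \<le> (A * C) * (15 * \<bar>U\<bar> + 20 * \<bar>R\<bar>)" by (simp add: algebra_simps)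
  then show ?thesis using pos by (simp add: mult_le_cancel_left_pos)
qed

text \<open>The hypothesis says that B - \<kappa> \<rho> C is stationary. At the centre the
  coefficient of X vanishes, and that of U along R = 2 U is - (12 \<sigma>^2 - 2 \<sigma> + 2),
  which has no zero. Off the centre this persists as |\<open>gx\<close>| at most 4/1000 C and
  \<open>gu + z * gr\<close> at most - C / 2.\<close>

lemma variation_B_C:
  assumes e: "Bd \<sigma> u \<rho> X U R = \<kappa> * (R * Cf \<sigma> u \<rho> + \<rho> * Cd \<sigma> u \<rho> X U R)"
    and k: "\<bar>\<kappa> - 1\<bar> \<le> 1 / 1000" "\<bar>\<kappa> * \<rho> - 1\<bar> \<le> 1 / 1000" and R: "R = z * U + W" and z: "\<bar>z - 2\<bar> \<le> 1 / 1000"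
  shows "\<bar>U\<bar> \<le> (8 / 1000) * \<bar>X\<bar> + 8 * \<bar>W\<bar>"
proof -
  define l where "l = \<kappa> * \<rho>"
  define n m where "n = 2 * (1 + 2 * u) * \<rho>" and "m = (2 * u - 1) / \<rho>"
  define i j v where "i = 2 / \<rho>" and "j = (2 * u - 1) / \<rho>\<^sup>2" and "v = 2 * (1 + 2 * u)"
  define C where "C = Cf \<sigma> u \<rho>"
  have Cd': "C = n * \<sigma>\<^sup>2 + \<sigma> + m" by (simp add: C_def Cf_def n_def m_def)
  have b: "599 / 100 \<le> n" "n \<le> 601 / 100" "99 / 100 \<le> m" "m \<le> 101 / 100" "199 / 100 \<le> i" "i \<le> 201 / 100"
    "99 / 100 \<le> j" "j \<le> 101 / 100"
    using prod_bounds unfolding n_def m_def i_def j_def by linarith+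
  have vb: "599 / 100 \<le> v" "v \<le> 601 / 100" using u unfolding v_def abs_le_iff by auto
  have kl: "\<bar>l - 1\<bar> \<le> 1 / 1000" using k(2) by (simp add: l_def)
  have Cpos: "C > 0" using Cf_pos by (simp add: C_def)
  have s2: "\<sigma>\<^sup>2 \<ge> 0" by simp
  define gx where "gx = 2 * n * \<sigma>\<^sup>2 * (1 - l) + \<sigma> * (2 * \<rho> - 1 - l)"
  define gr where "gr = v * \<sigma>\<^sup>2 * (1 - l) + 2 * \<sigma> + (1 + l) * j - \<kappa> * C"
  define gu where "gu = 4 * \<rho> * \<sigma>\<^sup>2 * (1 - l) - i * (1 + l)"
  have "X * gx + U * gu + R * gr = 0"
  proof -
    have "Bd \<sigma> u \<rho> X U R = X * (2 * n * \<sigma>\<^sup>2 + (2 * \<rho> - 1) * \<sigma>) + U * (4 * \<rho> * \<sigma>\<^sup>2 - i) + R * (v * \<sigma>\<^sup>2 + 2 * \<sigma> + j)"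
      and "Cd \<sigma> u \<rho> X U R = X * (2 * n * \<sigma>\<^sup>2 + \<sigma>) + U * (4 * \<rho> * \<sigma>\<^sup>2 + i) + R * (v * \<sigma>\<^sup>2 - j)"
      unfolding Bd_def Cd_def n_def i_def j_def v_def by simp_all
    then show ?thesis
      using e unfolding gx_def gu_def gr_def l_def C_def[symmetric] by (simp add: algebra_simps)
  qed
  then have e': "U * (gu + z * gr) = - (X * gx + W * gr)" unfolding R by (simp add: algebra_simps)
  have px: "\<bar>gx\<bar> \<le> (4 / 1000) * C"
  proof -
    have "\<bar>2 * n * \<sigma>\<^sup>2 * (1 - l)\<bar> \<le> (2 * n * \<sigma>\<^sup>2) * (1 / 1000)"
      unfolding abs_mult[of "2 * n * \<sigma>\<^sup>2"] using b kl by (intro mult_mono) (auto simp: abs_minus_commute)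
    moreover have "\<bar>\<sigma> * (2 * \<rho> - 1 - l)\<bar> \<le> \<sigma> * (2 / 1000)"
      unfolding abs_mult using s \<rho> kl by (intro mult_mono; linarith)
    ultimately have "\<bar>gx\<bar> \<le> (2 * n * \<sigma>\<^sup>2) * (1 / 1000) + \<sigma> * (2 / 1000)"
      unfolding gx_def using abs_triangle_ineq[of "2 * n * \<sigma>\<^sup>2 * (1 - l)" "\<sigma> * (2 * \<rho> - 1 - l)"] by linarith
    moreover have "n * \<sigma>\<^sup>2 \<ge> 0" using b s2 by (intro mult_nonneg_nonneg) auto
    ultimately show ?thesis unfolding Cd' using s b by (simp add: algebra_simps)
  qed
  have vs: "\<bar>v * \<sigma>\<^sup>2 * (1 - l)\<bar> \<le> (601 / 100 * \<sigma>\<^sup>2) * (1 / 1000)"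
  proof -
    have "0 \<le> v * \<sigma>\<^sup>2" "v * \<sigma>\<^sup>2 \<le> 601 / 100 * \<sigma>\<^sup>2"
      using vb s2 mult_right_mono[OF vb(2) s2] by auto
    then show ?thesis unfolding abs_mult[of "v * \<sigma>\<^sup>2"] using kl s2 by (intro mult_mono; linarith)
  qed
  have lj: "0 \<le> (1 + l) * j" "(1 + l) * j \<le> (2001 / 1000) * (101 / 100)"
  proof -
    have "0 \<le> 1 + l" "1 + l \<le> 2001 / 1000" "0 \<le> j" using kl b by linarith+
    then show "0 \<le> (1 + l) * j" "(1 + l) * j \<le> (2001 / 1000) * (101 / 100)"
      using b(8) by (intro mult_nonneg_nonneg mult_mono; linarith)+
  qed
  have kC: "\<bar>\<kappa> * C\<bar> \<le> (1001 / 1000) * C" unfolding abs_mult using k(1) Cpos by (intro mult_mono; linarith)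
  have Clow: "C \<ge> (599 / 100) * \<sigma>\<^sup>2 + \<sigma> + 99 / 100" using Cf_lower by (simp add: C_def)
  have pr: "\<bar>gr\<bar> \<le> 4 * C"
    unfolding gr_def using vs lj kC Clow s s2 by linarith
  have G: "gu + z * gr \<le> - (1 / 2) * C"
  proof -
    have a1: "\<bar>4 * \<rho> * \<sigma>\<^sup>2 * (1 - l)\<bar> \<le> (401 / 100 * \<sigma>\<^sup>2) * (1 / 1000)"
    proof -
      have "4 * \<rho> \<le> 401 / 100" "0 \<le> 4 * \<rho>" using \<rho> by linarith+
      then have "0 \<le> 4 * \<rho> * \<sigma>\<^sup>2" "4 * \<rho> * \<sigma>\<^sup>2 \<le> 401 / 100 * \<sigma>\<^sup>2"
        using s2 by (intro mult_nonneg_nonneg mult_right_mono; linarith)+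
      then show ?thesis unfolding abs_mult[of "4 * \<rho> * \<sigma>\<^sup>2"] using kl s2 by (intro mult_mono; linarith)
    qed
    have a2: "(199 / 100) * (1999 / 1000) \<le> i * (1 + l)" using b kl by (intro mult_mono; linarith)
    have kC': "\<kappa> * C \<ge> (999 / 1000) * C" using k(1) Cpos by (intro mult_right_mono; linarith)
    define h where "h = v * \<sigma>\<^sup>2 * (1 - l) + 2 * \<sigma> + (1 + l) * j - \<kappa> * C"
    have h: "h \<le> (601 / 100 * \<sigma>\<^sup>2) * (1 / 1000) + 2 * \<sigma> + (2001 / 1000) * (101 / 100) - (999 / 1000) * C"
      unfolding h_def using vs lj kC' by linarith
    have hh: "h \<le> - (596 / 100) * \<sigma>\<^sup>2 + (1002 / 1000) * \<sigma> + 104 / 100" using h Clow s s2 by linarith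
    have habs: "\<bar>h\<bar> \<le> 4 * C" using pr by (simp add: h_def gr_def)
    have "\<bar>(z - 2) * h\<bar> \<le> (1 / 1000) * (4 * C)" unfolding abs_mult using z habs by (intro mult_mono; linarith)
    moreover have "z * h = 2 * h + (z - 2) * h" by (simp add: algebra_simps)
    ultimately have zh: "z * h \<le> 2 * h + (4 / 1000) * C" by linarith
    have Cup: "C \<le> (601 / 100) * \<sigma>\<^sup>2 + \<sigma> + 101 / 100"
      unfolding Cd' using b mult_right_mono[OF b(2) s2] by linarith
    have "gu + z * h \<le> - (119 / 10) * \<sigma>\<^sup>2 + (201 / 100) * \<sigma> - 188 / 100 + (4 / 1000) * C"
      unfolding gu_def using a1 a2 zh hh s s2 by linarith
    \<comment> \<open>The right-hand side lies below - 504/1000 times the upper bound of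
      \<open>C\<close>: 1/2 for the claim and 4/1000 for the error in \<open>z\<close>.\<close>
    moreover have "- (119 / 10) * \<sigma>\<^sup>2 + (201 / 100) * \<sigma> - 188 / 100 \<le> - (303 / 100) * \<sigma>\<^sup>2 - (505 / 1000) * \<sigma> - 51 / 100"
    proof -
      have "0 \<le> (2 * \<sigma> - 1)\<^sup>2" by simp
      then have "4 * \<sigma> \<le> 4 * \<sigma>\<^sup>2 + 1" by (simp add: power2_eq_square algebra_simps)
      then show ?thesis using s2 by linarith
    qed
    ultimately have "gu + z * h \<le> - (1 / 2) * C" using Cup s s2 by linarith
    then show ?thesis by (simp add: h_def gr_def)
  qed
  have "\<bar>U\<bar> * ((1 / 2) * C) \<le> \<bar>U\<bar> * \<bar>gu + z * gr\<bar>" using G Cpos by (intro mult_left_mono) auto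
  also have "\<dots> = \<bar>X * gx + W * gr\<bar>" unfolding abs_mult[symmetric] e' by simp
  also have "\<dots> \<le> \<bar>X\<bar> * \<bar>gx\<bar> + \<bar>W\<bar> * \<bar>gr\<bar>" unfolding abs_mult[symmetric] by (rule abs_triangle_ineq)
  also have "\<dots> \<le> \<bar>X\<bar> * ((4 / 1000) * C) + \<bar>W\<bar> * (4 * C)" using px pr by (intro add_mono mult_left_mono) auto
  finally have "C * \<bar>U\<bar> \<le> C * ((8 / 1000) * \<bar>X\<bar> + 8 * \<bar>W\<bar>)" by (simp add: algebra_simps)
  then show ?thesis using Cpos by (simp add: mult_le_cancel_left_pos)
qed

text \<open>The left-hand side is the logarithmic derivative of E / (\<rho> C), the factor by which
  w is multiplied in the ratio of the last coefficient to C.\<close>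

lemma variation_E_C: "\<bar>Ed \<sigma> u \<rho> X U R / Ef \<sigma> u \<rho> - R / \<rho> - Cd \<sigma> u \<rho> X U R / Cf \<sigma> u \<rho>\<bar> \<le> 4 * \<bar>X\<bar> + 3 * \<bar>U\<bar> + 6 * \<bar>R\<bar>"
proof -
  define E C where "E = Ef \<sigma> u \<rho>" and "C = Cf \<sigma> u \<rho>"
  define cx cu cr where "cx = 4 * (1 + 2 * u) * \<rho> * \<sigma>\<^sup>2 + \<sigma>"
    and "cu = 4 * \<rho> * \<sigma>\<^sup>2 + 2 / \<rho>" and "cr = 2 * (1 + 2 * u) * \<sigma>\<^sup>2 - (2 * u - 1) / \<rho>\<^sup>2"
  have C: "C > 0" using Cf_pos by (simp add: C_def)
  have sr: "\<sigma>\<^sup>2 * \<rho>\<^sup>2 \<ge> 0" by simp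
  then have E: "E > 0" unfolding E_def Ef_def by (simp add: algebra_simps add_pos_nonneg)
  define q where "q = 4 * \<sigma>\<^sup>2 * \<rho>\<^sup>2 / E"
  have "4 * \<sigma>\<^sup>2 * \<rho>\<^sup>2 \<le> 2 * E" by (simp add: E_def Ef_def)
  then have q: "0 \<le> q" "q \<le> 2"
    unfolding q_def using E sr pos_divide_le_eq[OF E, of "4 * \<sigma>\<^sup>2 * \<rho>\<^sup>2" 2] by auto
  have i: "99 / 100 \<le> 1 / \<rho>" "1 / \<rho> \<le> 101 / 100" using prod_bounds(7,8) by simp_all
  have bc: "0 \<le> cx / C" "cx / C \<le> 2" "0 \<le> cu / C" "cu / C \<le> 3" "\<bar>cr / C\<bar> \<le> 2"
    using coeff_bounds C unfolding cx_def cu_def cr_def C_def by (simp_all add: pos_divide_le_eq)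
  have qr: "0 \<le> q * (1 / \<rho>)" "q * (1 / \<rho>) \<le> 2 * (101 / 100)"
    by (rule mult_nonneg_nonneg mult_mono; use q i in linarith)+
  have "Ed \<sigma> u \<rho> X U R / E = X * q + R * (q * (1 / \<rho>))"
    unfolding Ed_def q_def using \<rho>_pos E by (simp add: field_simps power2_eq_square)
  moreover have "Cd \<sigma> u \<rho> X U R / C = X * (cx / C) + U * (cu / C) + R * (cr / C)"
    unfolding Cd_def cx_def[symmetric] cu_def[symmetric] cr_def[symmetric] by (simp add: add_divide_distrib)
  ultimately have e: "Ed \<sigma> u \<rho> X U R / E - R / \<rho> - Cd \<sigma> u \<rho> X U R / C
      = X * (q - cx / C) + U * (- (cu / C)) + R * (q * (1 / \<rho>) - 1 / \<rho> - cr / C)"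
    by (simp add: algebra_simps)
  have "\<bar>X * (q - cx / C)\<bar> \<le> \<bar>X\<bar> * 4" "\<bar>U * (- (cu / C))\<bar> \<le> \<bar>U\<bar> * 3" "\<bar>R * (q * (1 / \<rho>) - 1 / \<rho> - cr / C)\<bar> \<le> \<bar>R\<bar> * 6"
    unfolding abs_mult[of X] abs_mult[of U] abs_mult[of R] using q bc qr i by (intro mult_left_mono; linarith)+
  then show ?thesis unfolding E_def[symmetric] C_def[symmetric] e by linarith
qed

end

text \<open>\<open>ln\<close> has slope at least 1 / \<delta> on the interval from 0 to \<delta>.
  For tiny arguments a bound on the logarithms is thus improved by the factor \<delta>.\<close>

lemma log_diff_bound:
  fixes a b \<delta> :: real
  assumes "0 < a" "0 < b" "a \<le> \<delta>" "b \<le> \<delta>"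
  shows "\<bar>a - b\<bar> \<le> \<delta> * \<bar>ln a - ln b\<bar>"
proof -
  have *: "x - y \<le> \<delta> * (ln x - ln y)" if "0 < y" "y \<le> x" "x \<le> \<delta>" for x y
  proof -
    have x: "0 < x" using that by linarith
    have "ln (y / x) \<le> y / x - 1" using that x by (intro ln_le_minus_one) auto
    then have "1 - y / x \<le> ln x - ln y" using that x by (simp add: ln_div)
    then have "x * (1 - y / x) \<le> x * (ln x - ln y)" using x by (intro mult_left_mono) auto
    moreover have "x * (1 - y / x) = x - y" using x by (simp add: algebra_simps)
    moreover have "x * (ln x - ln y) \<le> \<delta> * (ln x - ln y)" using that x by (intro mult_right_mono) auto
    ultimately show ?thesis by linarith
  qed
  show ?thesis
  proof (cases "b \<le> a")
    case True
    then have "ln b \<le> ln a" using assms by simp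
    then show ?thesis using *[of b a] True assms by simp
  next
    case False
    then have "ln a \<le> ln b" using assms by simp
    then show ?thesis using *[of a b] False assms by (simp add: abs_minus_commute)
  qed
qed

lemma has_derivative_ln_comp:
  assumes "(g has_real_derivative D) (at t)" "g t > 0"
  shows "((\<lambda>t. ln (g t)) has_real_derivative D / g t) (at t)"
  using DERIV_chain2[OF DERIV_ln_divide[OF assms(2)] assms(1)] by simp

text \<open>Join the two points by a segment in the coordinates \<open>(ln \<sigma>, u, \<rho>)\<close>. Rolle's theorem for the
  ratios \<open>A / C\<close> and \<open>B / (\<rho> C)\<close> bounds \<open>X\<close> and \<open>U\<close> by \<open>W = w2\<^sup>2 - w1\<^sup>2\<close>. The last coefficient bounds
  \<open>ln w1 - ln w2\<close> by \<open>W\<close> as well, and as the \<open>w\<close>s are tiny this is only possible for \<open>w1 = w2\<close>.\<close>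

theorem coefficients_inject:
  fixes \<sigma>1 \<sigma>2 u1 u2 w1 w2 k1 k2 :: real
  defines "\<rho>1 \<equiv> u1\<^sup>2 + w1\<^sup>2" and "\<rho>2 \<equiv> u2\<^sup>2 + w2\<^sup>2"
  assumes \<sigma>: "\<sigma>1 > 0" "\<sigma>2 > 0" and u: "\<bar>u1 - 1\<bar> \<le> 1 / 100000" "\<bar>u2 - 1\<bar> \<le> 1 / 100000"
    and w: "\<bar>w1\<bar> \<le> 1 / 100000" "\<bar>w2\<bar> \<le> 1 / 100000" and k: "k1 \<noteq> 0"
    and A: "k1 * Af \<sigma>1 u1 \<rho>1 = k2 * Af \<sigma>2 u2 \<rho>2"
    and B: "k1 * Bf \<sigma>1 u1 \<rho>1 / \<rho>1 = k2 * Bf \<sigma>2 u2 \<rho>2 / \<rho>2"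
    and C: "k1 * Cf \<sigma>1 u1 \<rho>1 = k2 * Cf \<sigma>2 u2 \<rho>2"
    and E: "k1 * w1 * Ef \<sigma>1 u1 \<rho>1 / \<rho>1 = k2 * w2 * Ef \<sigma>2 u2 \<rho>2 / \<rho>2"
  shows "\<sigma>1 = \<sigma>2 \<and> u1 = u2 \<and> w1 = w2 \<and> k1 = k2"
proof -
  have \<rho>n: "\<bar>u\<^sup>2 + w\<^sup>2 - 1\<bar> \<le> 3 / 100000" if "\<bar>u - 1\<bar> \<le> 1 / 100000" "\<bar>w\<bar> \<le> 1 / 100000" for u w :: real
  proof -
    define x where "x = u - 1"
    have "\<bar>x * x\<bar> \<le> (1 / 100000) * (1 / 100000)" "\<bar>w * w\<bar> \<le> (1 / 100000) * (1 / 100000)"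
      unfolding abs_mult using that by (intro mult_mono; simp add: x_def)+
    moreover have "u\<^sup>2 + w\<^sup>2 - 1 = 2 * x + x * x + w * w" by (simp add: x_def power2_eq_square algebra_simps)
    moreover have "\<bar>x\<bar> \<le> 1 / 100000" using that by (simp add: x_def)
    ultimately show ?thesis by linarith
  qed
  have r: "\<bar>\<rho>1 - 1\<bar> \<le> 3 / 100000" "\<bar>\<rho>2 - 1\<bar> \<le> 3 / 100000" using \<rho>n u w unfolding \<rho>1_def \<rho>2_def by blast+
  define X U R where "X = ln \<sigma>2 - ln \<sigma>1" and "U = u2 - u1" and "R = \<rho>2 - \<rho>1"
  define S uu rr where "S = (\<lambda>t. exp (ln \<sigma>1 + t * X))" and "uu = (\<lambda>t. u1 + t * U)" and "rr = (\<lambda>t. \<rho>1 + t * R)"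
  have ends: "S 0 = \<sigma>1" "S 1 = \<sigma>2" "uu 0 = u1" "uu 1 = u2" "rr 0 = \<rho>1" "rr 1 = \<rho>2"
    using \<sigma> by (simp_all add: S_def uu_def rr_def X_def U_def R_def)
  have conv: "\<bar>a + t * (b - a) - 1\<bar> \<le> c" if "0 \<le> t" "t \<le> 1" "\<bar>a - 1\<bar> \<le> c" "\<bar>b - 1\<bar> \<le> c" for a b c t :: real
  proof -
    have "a + t * (b - a) - 1 = (1 - t) * (a - 1) + t * (b - 1)" by (simp add: algebra_simps)
    also have "\<bar>\<dots>\<bar> \<le> \<bar>(1 - t) * (a - 1)\<bar> + \<bar>t * (b - 1)\<bar>" by (rule abs_triangle_ineq)
    also have "\<dots> \<le> (1 - t) * c + t * c" unfolding abs_mult using that by (intro add_mono mult_mono) auto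
    finally show ?thesis by (simp add: algebra_simps)
  qed
  have near: "near_one (S t) (uu t) (rr t)" if "0 \<le> t" "t \<le> 1" for t
  proof
    show "0 < S t" by (simp add: S_def)
    have "\<bar>uu t - 1\<bar> \<le> 1 / 100000" unfolding uu_def U_def by (rule conv[OF that u])
    then show "\<bar>uu t - 1\<bar> \<le> 3 / 100000" by linarith
    show "\<bar>rr t - 1\<bar> \<le> 3 / 100000" unfolding rr_def R_def by (rule conv[OF that r])
  qed
  have dS: "(S has_real_derivative S t * X) (at t)" and du: "(uu has_real_derivative U) (at t)"
    and dr: "(rr has_real_derivative R) (at t)" for t
    unfolding S_def uu_def rr_def by (auto intro!: derivative_eq_intros)
  have rr0: "rr t \<noteq> 0" if "0 \<le> t" "t \<le> 1" for t using near_one.\<rho>_pos[OF near[OF that]] by simp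
  note D = Af_deriv[OF dS du dr rr0] Bf_deriv[OF dS du dr rr0] Cf_deriv[OF dS du dr rr0] Ef_deriv[OF dS du dr rr0]
  define a b c e where "a = (\<lambda>t. Af (S t) (uu t) (rr t))" and "b = (\<lambda>t. Bf (S t) (uu t) (rr t))"
    and "c = (\<lambda>t. Cf (S t) (uu t) (rr t))" and "e = (\<lambda>t. Ef (S t) (uu t) (rr t))"
  have pos: "a t > 0" "c t > 0" "e t > 0" "rr t > 0" if "0 \<le> t" "t \<le> 1" for t
    using near_one.Af_pos[OF near[OF that]] near_one.Cf_pos[OF near[OF that]] near_one.\<rho>_pos[OF near[OF that]]
    by (auto simp: a_def c_def e_def Ef_def intro!: add_pos_nonneg)
  have k2: "k2 \<noteq> 0" using C k pos(2)[of 0] by (auto simp: c_def ends)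
  have AC: "a 0 * c 1 = a 1 * c 0"
  proof -
    have 1: "k1 * a 0 = k2 * a 1" and 2: "k1 * c 0 = k2 * c 1" using A C by (simp_all add: a_def c_def ends)
    have "(k1 * k2) * (a 0 * c 1) = (k1 * a 0) * (k2 * c 1)" by simp
    also have "\<dots> = (k1 * k2) * (a 1 * c 0)" unfolding 1 2[symmetric] by simp
    finally show ?thesis using k k2 by simp
  qed
  have X1: "\<bar>X\<bar> \<le> 15 * \<bar>U\<bar> + 20 * \<bar>R\<bar>"
  proof -
    define f where "f t = ln (a t) - ln (c t)" for t
    have "\<exists>z. 0 < z \<and> z < 1 \<and> f 1 - f 0 = (1 - 0) * (Ad (S z) (uu z) (rr z) X U R / a z - Cd (S z) (uu z) (rr z) X U R / c z)"
    proof (rule MVT2)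
      fix t :: real assume t: "0 \<le> t" "t \<le> 1"
      show "(f has_real_derivative Ad (S t) (uu t) (rr t) X U R / a t - Cd (S t) (uu t) (rr t) X U R / c t) (at t)"
        unfolding f_def
        by (intro DERIV_diff has_derivative_ln_comp pos[OF t]) (use D[OF t] in \<open>simp_all only: a_def c_def\<close>)
    qed simp
    then obtain z where z: "0 < z" "z < 1" "f 1 - f 0 = Ad (S z) (uu z) (rr z) X U R / a z - Cd (S z) (uu z) (rr z) X U R / c z" by auto
    have "ln (a 0 * c 1) = ln (a 1 * c 0)" using AC by simp
    then have "f 1 = f 0" using pos(1,2)[of 0] pos(1,2)[of 1] by (simp add: f_def ln_mult)
    then have "Ad (S z) (uu z) (rr z) X U R * c z = a z * Cd (S z) (uu z) (rr z) X U R"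
      using z pos(1,2)[of z] by (simp add: field_simps)
    then show ?thesis using near_one.variation_A_C[OF near[of z]] z unfolding a_def c_def by simp
  qed
  \<comment> \<open>The common value of B / (\<rho> C) at both ends. It is used in the product form
    b = \<kappa> \<rho> c, for which the mean value argument asks nothing about the sign of
    \<open>b\<close>.\<close>
  define \<kappa> where "\<kappa> = b 0 / (\<rho>1 * c 0)"
  define W where "W = w2\<^sup>2 - w1\<^sup>2"
  \<comment> \<open>Since u2^2 - u1^2 = (u1 + u2) U, the change of \<rho> is about 2 U up to the
    change W of w^2.\<close>
  have RW: "R = (u1 + u2) * U + W" unfolding R_def \<rho>1_def \<rho>2_def U_def W_def by (simp add: power2_eq_square algebra_simps)
  have kb: "b 0 = \<kappa> * (\<rho>1 * c 0)" "b 1 = \<kappa> * (\<rho>2 * c 1)"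
  proof -
    have p: "\<rho>1 > 0" "\<rho>2 > 0" "c 0 > 0" "c 1 > 0" using pos(2,4)[of 0] pos(2,4)[of 1] by (simp_all add: ends)
    then show "b 0 = \<kappa> * (\<rho>1 * c 0)" by (simp add: \<kappa>_def)
    have 1: "k1 * c 0 = k2 * c 1" using C by (simp add: c_def ends)
    have 2: "k1 * b 0 * \<rho>2 = k2 * b 1 * \<rho>1" using B p by (simp add: b_def ends field_simps)
    have "k2 * (b 1 * (\<rho>1 * c 0)) = (k2 * b 1 * \<rho>1) * c 0" by simp
    also have "\<dots> = (k1 * c 0) * (b 0 * \<rho>2)" unfolding 2[symmetric] by simp
    also have "\<dots> = k2 * (b 0 * (\<rho>2 * c 1))" unfolding 1 by simp
    finally have "b 1 * (\<rho>1 * c 0) = b 0 * (\<rho>2 * c 1)" using k2 by simp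
    then show "b 1 = \<kappa> * (\<rho>2 * c 1)" using p by (simp add: \<kappa>_def field_simps)
  qed
  have \<kappa>1: "\<bar>\<kappa> * \<rho>1 - 1\<bar> \<le> 1 / 4000"
  proof -
    have c0: "c 0 > 0" using pos(2)[of 0] by simp
    have "\<bar>b 0 - c 0\<bar> \<le> (1 / 4000) * c 0" using near_one.Bf_near[OF near[of 0]] by (simp add: b_def c_def)
    moreover have "b 0 - c 0 = (\<kappa> * \<rho>1 - 1) * c 0" unfolding kb(1) by (simp add: algebra_simps)
    ultimately have "\<bar>\<kappa> * \<rho>1 - 1\<bar> * c 0 \<le> (1 / 4000) * c 0" using c0 by (simp add: abs_mult)
    then show ?thesis using c0 by simp
  qed
  have \<kappa>b: "\<bar>\<kappa>\<bar> \<le> 2" 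
  proof -
    have p: "\<rho>1 \<ge> 9 / 10" using r by linarith
    have "\<bar>\<kappa>\<bar> * (9 / 10) \<le> \<bar>\<kappa>\<bar> * \<rho>1" using p by (intro mult_left_mono) auto
    also have "\<dots> = \<bar>\<kappa> * \<rho>1\<bar>" using p by (simp add: abs_mult)
    finally show ?thesis using \<kappa>1 by linarith
  qed
  have \<kappa>r: "\<bar>\<kappa> * \<rho> - 1\<bar> \<le> 1 / 1000" if "\<bar>\<rho> - 1\<bar> \<le> 3 / 100000" for \<rho>
  proof -
    have "\<bar>\<kappa> * (\<rho> - \<rho>1)\<bar> \<le> 2 * (6 / 100000)" unfolding abs_mult using \<kappa>b that r by (intro mult_mono; linarith)
    moreover have "\<kappa> * \<rho> - 1 = (\<kappa> * \<rho>1 - 1) + \<kappa> * (\<rho> - \<rho>1)" by (simp add: algebra_simps)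
    ultimately show ?thesis using \<kappa>1 by linarith
  qed
  have U1: "\<bar>U\<bar> \<le> (8 / 1000) * \<bar>X\<bar> + 8 * \<bar>W\<bar>"
  proof -
    define f where "f t = b t - \<kappa> * (rr t * c t)" for t
    have "\<exists>z. 0 < z \<and> z < 1 \<and> f 1 - f 0 = (1 - 0) * (Bd (S z) (uu z) (rr z) X U R - \<kappa> * (R * c z + rr z * Cd (S z) (uu z) (rr z) X U R))"
    proof (rule MVT2)
      fix t :: real assume t: "0 \<le> t" "t \<le> 1"
      show "(f has_real_derivative Bd (S t) (uu t) (rr t) X U R - \<kappa> * (R * c t + rr t * Cd (S t) (uu t) (rr t) X U R)) (at t)"
        unfolding f_def b_def c_def
        by (rule derivative_eq_intros D[OF t] dr refl)+ (simp add: algebra_simps)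
    qed simp
    then obtain z where z: "0 < z" "z < 1" "f 1 - f 0 = Bd (S z) (uu z) (rr z) X U R - \<kappa> * (R * c z + rr z * Cd (S z) (uu z) (rr z) X U R)" by auto
    have "f 1 = f 0" using kb by (simp add: f_def ends)
    then have e: "Bd (S z) (uu z) (rr z) X U R = \<kappa> * (R * Cf (S z) (uu z) (rr z) + rr z * Cd (S z) (uu z) (rr z) X U R)"
      using z by (simp add: c_def)
    have n: "near_one (S z) (uu z) (rr z)" using near z by simp
    have "\<bar>\<kappa> * rr z - 1\<bar> \<le> 1 / 1000" using \<kappa>r n by (simp add: near_one_def)
    moreover have "\<bar>\<kappa> - 1\<bar> \<le> 1 / 1000" using \<kappa>r[of 1] by simp
    moreover have "\<bar>(u1 + u2) - 2\<bar> \<le> 1 / 1000" using u by linarith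
    ultimately show ?thesis using near_one.variation_B_C[OF n e _ _ RW] by blast
  qed
  have Rb: "\<bar>R\<bar> \<le> (21 / 10) * \<bar>U\<bar> + \<bar>W\<bar>"
  proof -
    have "\<bar>(u1 + u2) * U\<bar> \<le> (21 / 10) * \<bar>U\<bar>" unfolding abs_mult using u by (intro mult_mono; linarith)
    then show ?thesis unfolding RW by linarith
  qed
  \<comment> \<open>Inserting the bounds for X and R gives |U| \<le> 0.456 |U| + 8.16 |W|, hence the
    16; then 932 = 57 * 16 + 20, and 35 exceeds 2.1 * 16 + 1.\<close>
  have UW: "\<bar>U\<bar> \<le> 16 * \<bar>W\<bar>" "\<bar>X\<bar> \<le> 932 * \<bar>W\<bar>" "\<bar>R\<bar> \<le> 35 * \<bar>W\<bar>" using X1 U1 Rb by linarith+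
  have "w1 = w2"
  proof (cases "w1 = 0")
    case True
    have "rr 1 > 0" "e 1 > 0" using pos(3,4)[of 1] by simp_all
    then show ?thesis using E True k2 by (simp add: e_def ends)
  next
    case False
    define f where "f t = ln (e t) - ln (rr t) - ln (c t)" for t
    have "\<exists>z. 0 < z \<and> z < 1 \<and> f 1 - f 0 = (1 - 0) * (Ed (S z) (uu z) (rr z) X U R / e z - R / rr z - Cd (S z) (uu z) (rr z) X U R / c z)"
    proof (rule MVT2)
      fix t :: real assume t: "0 \<le> t" "t \<le> 1"
      show "(f has_real_derivative Ed (S t) (uu t) (rr t) X U R / e t - R / rr t - Cd (S t) (uu t) (rr t) X U R / c t) (at t)"
        unfolding f_def
        by (intro DERIV_diff has_derivative_ln_comp pos[OF t] dr) (use D[OF t] in \<open>simp_all only: e_def c_def\<close>)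
    qed simp
    then obtain z where z: "0 < z" "z < 1" "f 1 - f 0 = Ed (S z) (uu z) (rr z) X U R / e z - R / rr z - Cd (S z) (uu z) (rr z) X U R / c z" by auto
    have "\<bar>f 1 - f 0\<bar> \<le> 4 * \<bar>X\<bar> + 3 * \<bar>U\<bar> + 6 * \<bar>R\<bar>"
      unfolding z(3) e_def c_def by (rule near_one.variation_E_C[OF near]) (use z in auto)
    \<comment> \<open>4 * 932 + 3 * 16 + 6 * 35 = 3986.\<close>
    then have fW: "\<bar>f 1 - f 0\<bar> \<le> 4000 * \<bar>W\<bar>" using UW by linarith
    have p: "\<rho>1 > 0" "\<rho>2 > 0" "c 0 > 0" "c 1 > 0" "e 0 > 0" "e 1 > 0"
      using pos(2-4)[of 0] pos(2-4)[of 1] by (simp_all add: ends)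
    have 1: "k1 * c 0 = k2 * c 1" using C by (simp add: c_def ends)
    have 2: "k1 * w1 * e 0 * \<rho>2 = k2 * w2 * e 1 * \<rho>1" using E p by (simp add: e_def ends field_simps)
    have "k2 * (w1 * (e 0 * \<rho>2 * c 1)) = (k1 * c 0) * (w1 * e 0 * \<rho>2)" unfolding 1 by simp
    also have "\<dots> = (k1 * w1 * e 0 * \<rho>2) * c 0" by simp
    also have "\<dots> = k2 * (w2 * (e 1 * \<rho>1 * c 0))" unfolding 2 by simp
    finally have we: "w1 * (e 0 * \<rho>2 * c 1) = w2 * (e 1 * \<rho>1 * c 0)" using k2 by simp
    have q: "e 0 * \<rho>2 * c 1 > 0" "e 1 * \<rho>1 * c 0 > 0" using p by simp_all
    \<comment> \<open>The factors in \<open>we\<close> are positive, so w1 and w2 have the same sign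
      and the comparison can pass to absolute values and logarithms.\<close>
    have sg: "w1 > 0 \<longleftrightarrow> w2 > 0" "w2 \<noteq> 0" using we q False
      by (metis zero_less_mult_pos2 mult_pos_pos) (use we q False in auto)
    have "\<bar>w1\<bar> * (e 0 * \<rho>2 * c 1) = \<bar>w2\<bar> * (e 1 * \<rho>1 * c 0)"
      using arg_cong[OF we, of abs] p by (simp add: abs_mult)
    then have "ln (\<bar>w1\<bar> * (e 0 * \<rho>2 * c 1)) = ln (\<bar>w2\<bar> * (e 1 * \<rho>1 * c 0))" by simp
    then have "ln \<bar>w1\<bar> - ln \<bar>w2\<bar> = f 1 - f 0" using p False sg(2) by (simp add: ln_mult f_def ends)
    then have l: "\<bar>ln \<bar>w1\<bar> - ln \<bar>w2\<bar>\<bar> \<le> 4000 * \<bar>W\<bar>" using fW by simp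
    have "\<bar>w1 - w2\<bar> = \<bar>\<bar>w1\<bar> - \<bar>w2\<bar>\<bar>" using sg False by (cases "w1 > 0") auto
    also have "\<dots> \<le> (1 / 100000) * \<bar>ln \<bar>w1\<bar> - ln \<bar>w2\<bar>\<bar>" using w False sg(2) by (intro log_diff_bound) auto
    also have "\<dots> \<le> (1 / 100000) * (4000 * \<bar>W\<bar>)" using l by (intro mult_left_mono) auto
    finally have d: "\<bar>w1 - w2\<bar> \<le> (4 / 100) * \<bar>W\<bar>" by simp
    have "W = (w1 + w2) * (w2 - w1)" by (simp add: W_def power2_eq_square algebra_simps)
    then have "\<bar>W\<bar> = \<bar>w1 + w2\<bar> * \<bar>w1 - w2\<bar>" by (simp add: abs_mult abs_minus_commute[of w2])
    also have "\<dots> \<le> (2 / 100000) * \<bar>w1 - w2\<bar>" using w by (intro mult_right_mono; linarith)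
    finally have "\<bar>W\<bar> \<le> (2 / 100000) * \<bar>w1 - w2\<bar>" .
    \<comment> \<open>The two bounds compose to a contraction with factor 8 / 10^7, which forces the
      difference to vanish.\<close>
    moreover have "x \<le> 0" if "y \<le> (2 / 100000) * x" "x \<le> (4 / 100) * y" for x y :: real using that by simp
    ultimately have "\<bar>w1 - w2\<bar> \<le> 0" using d by blast
    then show ?thesis by simp
  qed
  then have "W = 0" by (simp add: W_def)
  then have "U = 0" "X = 0" using UW by auto
  then have "u1 = u2" "\<sigma>1 = \<sigma>2" using \<sigma> by (simp_all add: U_def X_def)
  moreover have "k1 = k2" using C calculation \<open>w1 = w2\<close> pos(2)[of 0] by (simp add: \<rho>1_def \<rho>2_def c_def ends)
  ultimately show ?thesis using \<open>w1 = w2\<close> by simp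
qed

section \<open>The theorem\<close>

lemma JJ_norm: "norm (JJ i v) = norm v"
proof -
  obtain a b c d a' b' c' d' where v: "v = ((a, b, c, d), (a', b', c', d'))" by (metis prod.collapse)
  have "inner (JJ i v) (JJ i v) = inner v v" by (simp add: v JJ_def inner_prod_def)
  then show ?thesis by (simp add: norm_eq_sqrt_inner)
qed

lemma th_le_one: "norm u \<le> 1 \<Longrightarrow> norm v \<le> 1 \<Longrightarrow> \<bar>th i u v\<bar> \<le> 1"
proof -
  assume "norm u \<le> 1" "norm v \<le> 1"
  then have "norm v * norm (JJ i u) \<le> 1 * 1" unfolding JJ_norm by (intro mult_mono) auto
  then show ?thesis using Cauchy_Schwarz_ineq2[of v "JJ i u"] unfolding th_def by linarith
qed

lemma abs_mult_le_one: "\<bar>x\<bar> \<le> 1 \<Longrightarrow> \<bar>y\<bar> \<le> 1 \<Longrightarrow> \<bar>x * y\<bar> \<le> (1::real)"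
  unfolding abs_mult using mult_mono[of "\<bar>x\<bar>" 1 "\<bar>y\<bar>" 1] by simp

lemma w12_bound:
  assumes "\<And>u. norm u \<le> 1 \<Longrightarrow> \<bar>x u\<bar> \<le> 1" "\<And>u v. norm u \<le> 1 \<Longrightarrow> norm v \<le> 1 \<Longrightarrow> \<bar>t u v\<bar> \<le> 1"
    and n: "norm u \<le> 1" "norm v \<le> 1" "norm w \<le> 1"
  shows "\<bar>w12 x t u v w\<bar> \<le> 3"
  unfolding w12_def
  using abs_mult_le_one[OF assms(1)[OF n(1)] assms(2)[OF n(2,3)]] abs_mult_le_one[OF assms(1)[OF n(2)] assms(2)[OF n(1,3)]]
    abs_mult_le_one[OF assms(1)[OF n(3)] assms(2)[OF n(1,2)]]
  by linarith

lemma w111_bound: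
  assumes x: "\<And>u. norm u \<le> 1 \<Longrightarrow> \<bar>x u\<bar> \<le> 1" and y: "\<And>u. norm u \<le> 1 \<Longrightarrow> \<bar>y u\<bar> \<le> 1" and z: "\<And>u. norm u \<le> 1 \<Longrightarrow> \<bar>z u\<bar> \<le> 1"
    and n: "norm u \<le> 1" "norm v \<le> 1" "norm w \<le> 1"
  shows "\<bar>w111 x y z u v w\<bar> \<le> 6"
proof -
  have *: "\<bar>x i * (y j * z k - y k * z j)\<bar> \<le> 2" if "norm i \<le> 1" "norm j \<le> 1" "norm k \<le> 1" for i j k
  proof -
    have "\<bar>y j * z k\<bar> \<le> 1" "\<bar>y k * z j\<bar> \<le> 1" using that y z by (auto intro!: abs_mult_le_one)
    then have "\<bar>y j * z k - y k * z j\<bar> \<le> 2" by linarith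
    then have "\<bar>x i\<bar> * \<bar>y j * z k - y k * z j\<bar> \<le> 1 * 2" using x that by (intro mult_mono) auto
    then show ?thesis by (simp add: abs_mult)
  qed
  show ?thesis unfolding w111_def using *[OF n(1,2,3)] *[OF n(2,1,3)] *[OF n(3,1,2)] by linarith
qed

text \<open>Bounds the set under \<open>Sup\<close> in \<open>form_dist\<close>, so that the
  supremum really dominates the differences of frame coefficients.\<close>

lemma Phi_bound:
  assumes p: "p \<in> S7" and vs: "length vs = 3" "\<forall>v\<in>set vs. norm v \<le> 1"
  shows "\<bar>Phi a b c e p vs\<bar> \<le> \<bar>a + b + 2 * c\<bar> * 6 + \<bar>b\<bar> * 3 + \<bar>c\<bar> * 6 + \<bar>e\<bar> * 6"
proof -
  obtain u v w where v: "vs = [u, v, w]" using vs(1) by (auto simp: numeral_eq_Suc length_Suc_conv)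
  have n: "norm u \<le> 1" "norm v \<le> 1" "norm w \<le> 1" using vs(2) v by auto
  have np: "norm p \<le> 1" using p by simp
  have t1: "norm x \<le> 1 \<Longrightarrow> \<bar>th i p x\<bar> \<le> 1" for i x using th_le_one[OF np] .
  define k where "k i j = w12 (th i p) (th j) u v w" for i j
  have k: "\<bar>k i j\<bar> \<le> 3" for i j unfolding k_def by (rule w12_bound[OF t1 th_le_one n])
  define m where "m = w111 (th 1 p) (th 2 p) (th 3 p) u v w"
  have m: "\<bar>m\<bar> \<le> 6" unfolding m_def by (rule w111_bound[OF t1 t1 t1 n])
  have e: "Phi a b c e p vs = (a + b + 2 * c) * m + b * k 1 1 + c * (k 2 2 + k 3 3) + e * (k 2 3 - k 3 2)"
    by (simp add: Phi_def v k_def m_def)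
  have "\<bar>k 2 2 + k 3 3\<bar> \<le> 6" "\<bar>k 2 3 - k 3 2\<bar> \<le> 6" using k[of 2 2] k[of 3 3] k[of 2 3] k[of 3 2] by linarith+
  then have "\<bar>(a + b + 2 * c) * m\<bar> \<le> \<bar>a + b + 2 * c\<bar> * 6" "\<bar>b * k 1 1\<bar> \<le> \<bar>b\<bar> * 3"
    "\<bar>c * (k 2 2 + k 3 3)\<bar> \<le> \<bar>c\<bar> * 6" "\<bar>e * (k 2 3 - k 3 2)\<bar> \<le> \<bar>e\<bar> * 6"
    unfolding abs_mult using m k by (intro mult_left_mono abs_ge_zero; simp)+
  then show ?thesis unfolding e
    by (intro order_trans[OF abs_triangle_ineq] add_mono)
qed

lemma form_dist_upper:
  assumes \<phi>: "form_eq 3 \<phi> (Phi a b c e)" and \<psi>: "form_eq 3 \<psi> (Phi a' b' c' e')"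
    and p: "p \<in> S7" and vs: "length vs = 3" "set vs \<subseteq> tangent p" "\<forall>v\<in>set vs. norm v \<le> 1"
  shows "\<bar>\<phi> p vs - \<psi> p vs\<bar> \<le> form_dist \<phi> \<psi>"
  unfolding form_dist_def
proof (rule cSup_upper)
  show "\<bar>\<phi> p vs - \<psi> p vs\<bar> \<in> {\<bar>\<phi> p vs - \<psi> p vs\<bar> | p vs. p \<in> S7 \<and> length vs = 3 \<and>
     set vs \<subseteq> tangent p \<and> (\<forall>v\<in>set vs. norm v \<le> 1)}" using p vs by blast
  show "bdd_above {\<bar>\<phi> p vs - \<psi> p vs\<bar> | p vs. p \<in> S7 \<and> length vs = 3 \<and>
     set vs \<subseteq> tangent p \<and> (\<forall>v\<in>set vs. norm v \<le> 1)}"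
  proof (rule bdd_aboveI)
    fix x assume "x \<in> {\<bar>\<phi> p vs - \<psi> p vs\<bar> | p vs. p \<in> S7 \<and> length vs = 3 \<and>
     set vs \<subseteq> tangent p \<and> (\<forall>v\<in>set vs. norm v \<le> 1)}"
    then obtain q us where x: "x = \<bar>\<phi> q us - \<psi> q us\<bar>" and q: "q \<in> S7" "length us = 3" "set us \<subseteq> tangent q" "\<forall>v\<in>set us. norm v \<le> 1"
      by blast
    have "\<phi> q us = Phi a b c e q us" "\<psi> q us = Phi a' b' c' e' q us" using \<phi> \<psi> q(1-3) unfolding form_eq_def by blast+
    then show "x \<le> (\<bar>a + b + 2 * c\<bar> * 6 + \<bar>b\<bar> * 3 + \<bar>c\<bar> * 6 + \<bar>e\<bar> * 6) + (\<bar>a' + b' + 2 * c'\<bar> * 6 + \<bar>b'\<bar> * 3 + \<bar>c'\<bar> * 6 + \<bar>e'\<bar> * 6)"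
      unfolding x by (simp only:) (intro order_trans[OF abs_triangle_ineq4] add_mono Phi_bound q)
  qed
qed

definition frame_coeff :: "dform \<Rightarrow> nat \<times> nat \<times> nat \<Rightarrow> real" where
  "frame_coeff \<phi> t = (case t of (i, j, k) \<Rightarrow> \<phi> p0 [E0 i, E0 j, E0 k])"

lemma frame_coeff_Phi:
  assumes "form_eq 3 \<phi> (Phi a b c e)"
  shows "frame_coeff \<phi> (0, 1, 2) = a" "frame_coeff \<phi> (0, 3, 4) = b" "frame_coeff \<phi> (1, 3, 5) = c" "frame_coeff \<phi> (1, 3, 6) = e"
proof -
  have *: "frame_coeff \<phi> (i, j, k) = Phi a b c e p0 [E0 i, E0 j, E0 k]" if "i < 7" "j < 7" "k < 7" for i j k
    using assms p0_S7 E0_tangent[of "[i, j, k]"] that unfolding form_eq_def frame_coeff_def by (auto simp del: E0_simps)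
  show "frame_coeff \<phi> (0, 1, 2) = a" "frame_coeff \<phi> (0, 3, 4) = b" "frame_coeff \<phi> (1, 3, 5) = c" "frame_coeff \<phi> (1, 3, 6) = e"
    using *[of 0 1 2] *[of 0 3 4] *[of 1 3 5] *[of 1 3 6] unfolding Phi_E0_values by simp_all
qed

lemma frame_coeff_dist:
  assumes \<phi>: "form_eq 3 \<phi> (Phi a b c e)" and \<psi>: "form_eq 3 \<psi> (Phi a' b' c' e')"
  shows "\<bar>b - b'\<bar> \<le> form_dist \<phi> \<psi>" "\<bar>c - c'\<bar> \<le> form_dist \<phi> \<psi>" "\<bar>e - e'\<bar> \<le> form_dist \<phi> \<psi>"
proof -
  have n: "norm (E0 i) \<le> 1" if "i < 7" for i using that unfolding less7 by (elim disjE) (simp_all add: norm_prod_def)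
  have *: "\<bar>frame_coeff \<phi> (i, j, k) - frame_coeff \<psi> (i, j, k)\<bar> \<le> form_dist \<phi> \<psi>" if "i < 7" "j < 7" "k < 7" for i j k
    unfolding frame_coeff_def prod.case
    by (rule form_dist_upper[OF \<phi> \<psi> p0_S7]) (use E0_tangent[of "[i, j, k]"] that n in \<open>auto simp del: E0_simps\<close>)
  show "\<bar>b - b'\<bar> \<le> form_dist \<phi> \<psi>" "\<bar>c - c'\<bar> \<le> form_dist \<phi> \<psi>" "\<bar>e - e'\<bar> \<le> form_dist \<phi> \<psi>"
    using *[of 0 3 4] *[of 1 3 5] *[of 1 3 6] unfolding frame_coeff_Phi[OF \<phi>] frame_coeff_Phi[OF \<psi>] by simp_all
qed

section \<open>Passage to the reduced coefficients, the neighbourhood and its openness\<close>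

text \<open>Scaling a form by \<lambda> multiplies s by \<lambda>^(1/3) and T by \<lambda>^(2/3).
  Thus \<sigma> is scale invariant, and k carries the weight 1/3 of the Laplacian.\<close>

lemma laplacian_coefficients:
  fixes s T \<rho> u w :: real
  assumes s: "s \<noteq> 0" and T: "T > 0" and \<rho>: "\<rho> > 0"
  defines "a \<equiv> s ^ 3 * \<rho>" and "b \<equiv> s * T"
  defines "a1 \<equiv> 4 * (b + 2 * (u * b)) * s ^ 3 * \<rho> / T\<^sup>2" and "b1 \<equiv> 2 * (a - b + 2 * (u * b)) / (s * \<rho>)" and "c1 \<equiv> 2 * (a + b) / s"
  defines "k \<equiv> 4 * T / s" and "\<sigma> \<equiv> s\<^sup>2 / T"
  shows "4 * (b1 + 2 * c1) * s ^ 3 * \<rho> / T\<^sup>2 = 2 * (k * Af \<sigma> u \<rho>)"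
    "2 * (a1 - b1 + 2 * c1) / (s * \<rho>) = k * Bf \<sigma> u \<rho> / \<rho>"
    "2 * (a1 + b1) / s = k * Cf \<sigma> u \<rho>"
    "8 * (w * b) * (1 + 2 * s ^ 4 * \<rho>\<^sup>2 / T\<^sup>2) / (s\<^sup>2 * \<rho>) = 2 * (k * w * Ef \<sigma> u \<rho> / \<rho>)"
  using assms(1-3) unfolding a_def b_def a1_def b1_def c1_def k_def \<sigma>_def Af_def Bf_def Cf_def Ef_def
  by (simp_all add: field_simps power2_eq_square power3_eq_cube power4_eq_xxxx)

text \<open>After the reduced coefficients are matched, k \<sigma> = 4 s returns s, k s = 4 T
  returns T, and u and w return \<rho>; these rebuild a, b, c and e.\<close>

lemma g2_laplacian_inject:
  assumes "pos_form \<phi> a b c e" and "pos_form \<psi> a' b' c' e'"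
    and near: "\<bar>c - b\<bar> < \<bar>b\<bar> / 100000" "\<bar>e\<bar> < \<bar>b\<bar> / 100000" "\<bar>c' - b'\<bar> < \<bar>b'\<bar> / 100000" "\<bar>e'\<bar> < \<bar>b'\<bar> / 100000"
    and eq: "form_eq 3 (g2_laplacian \<phi>) (g2_laplacian \<psi>)"
  shows "form_eq 3 \<phi> \<psi>"
proof -
  interpret F: pos_form \<phi> a b c e by fact
  interpret G: pos_form \<psi> a' b' c' e' by fact
  have close: "\<bar>y / x - 1\<bar> \<le> 1 / 100000" "\<bar>z / x\<bar> \<le> 1 / 100000" "y = y / x * x" "z = z / x * x"
    "y\<^sup>2 + z\<^sup>2 = r * x\<^sup>2 \<Longrightarrow> r = (y / x)\<^sup>2 + (z / x)\<^sup>2"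
    if "x \<noteq> 0" "\<bar>y - x\<bar> < \<bar>x\<bar> / 100000" "\<bar>z\<bar> < \<bar>x\<bar> / 100000" for x y z r :: real
  proof -
    have "y / x - 1 = (y - x) / x" using that(1) by (simp add: diff_divide_distrib)
    then show "\<bar>y / x - 1\<bar> \<le> 1 / 100000" "\<bar>z / x\<bar> \<le> 1 / 100000" "y = y / x * x" "z = z / x * x"
      using that by (simp_all add: pos_divide_le_eq)
    show "r = (y / x)\<^sup>2 + (z / x)\<^sup>2" if "y\<^sup>2 + z\<^sup>2 = r * x\<^sup>2"
      using that \<open>x \<noteq> 0\<close> by (simp add: power_divide add_divide_distrib[symmetric])
  qed
  note f = close[OF F.nz(2) near(1,2)] and g = close[OF G.nz(2) near(3,4)]
  define u w u' w' where uw: "u = c / b" "w = e / b" "u' = c' / b'" "w' = e' / b'"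
  have c: "c = u * b" "e = w * b" "c' = u' * b'" "e' = w' * b'" unfolding uw by (rule f g)+
  have r: "F.\<rho> = u\<^sup>2 + w\<^sup>2" "G.\<rho> = u'\<^sup>2 + w'\<^sup>2" unfolding uw by (rule f(5)[OF F.r_eq] g(5)[OF G.r_eq])+
  define k \<sigma> k' \<sigma>' where k: "k = 4 * F.T / F.s" "\<sigma> = F.s\<^sup>2 / F.T" "k' = 4 * G.T / G.s" "\<sigma>' = G.s\<^sup>2 / G.T"
  have "form_eq 3 (g2_laplacian \<phi>) (Phi (4 * (G.b1 + 2 * G.c1) * G.s ^ 3 * G.\<rho> / G.T\<^sup>2)
     (2 * (G.a1 - G.b1 + 2 * G.c1) / (G.s * G.\<rho>)) (2 * (G.a1 + G.b1) / G.s) (8 * e' * (1 + 2 * G.s ^ 4 * G.\<rho>\<^sup>2 / G.T\<^sup>2) / (G.s\<^sup>2 * G.\<rho>)))"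
    using eq G.g2_laplacian_eq unfolding form_eq_def by metis
  note fG = frame_coeff_Phi[OF this] and fF = frame_coeff_Phi[OF F.g2_laplacian_eq]
  note lF = laplacian_coefficients(1-3)[OF F.s_nz F.T_pos F.\<rho>_pos, of u, folded F.a_eq F.b_eq, folded c, folded F.a1_def F.b1_def F.c1_def k]
    laplacian_coefficients(4)[OF F.s_nz F.T_pos F.\<rho>_pos, of w u, folded F.b_eq, folded c k]
  note lG = laplacian_coefficients(1-3)[OF G.s_nz G.T_pos G.\<rho>_pos, of u', folded G.a_eq G.b_eq, folded c, folded G.a1_def G.b1_def G.c1_def k]
    laplacian_coefficients(4)[OF G.s_nz G.T_pos G.\<rho>_pos, of w' u', folded G.b_eq, folded c k]
  have "2 * (k * Af \<sigma> u F.\<rho>) = 2 * (k' * Af \<sigma>' u' G.\<rho>)" unfolding lF(1)[symmetric] lG(1)[symmetric] using fF(1) fG(1) by simp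
  moreover have "k * Bf \<sigma> u F.\<rho> / F.\<rho> = k' * Bf \<sigma>' u' G.\<rho> / G.\<rho>" unfolding lF(2)[symmetric] lG(2)[symmetric] using fF(2) fG(2) by simp
  moreover have "k * Cf \<sigma> u F.\<rho> = k' * Cf \<sigma>' u' G.\<rho>" unfolding lF(3)[symmetric] lG(3)[symmetric] using fF(3) fG(3) by simp
  moreover have "2 * (k * w * Ef \<sigma> u F.\<rho> / F.\<rho>) = 2 * (k' * w' * Ef \<sigma>' u' G.\<rho> / G.\<rho>)"
    unfolding lF(4)[symmetric] lG(4)[symmetric] using fF(4) fG(4) by simp
  moreover have "\<sigma> > 0" "\<sigma>' > 0" "k \<noteq> 0" unfolding k using F.s_nz F.T_pos G.s_nz G.T_pos by simp_all
  ultimately have i: "\<sigma> = \<sigma>' \<and> u = u' \<and> w = w' \<and> k = k'"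
    using f(1,2) g(1,2) unfolding r uw(1-4)[symmetric] by (intro coefficients_inject) simp_all
  have "k * \<sigma> = 4 * F.s" "k' * \<sigma>' = 4 * G.s" unfolding k using F.s_nz F.T_pos G.s_nz G.T_pos by (simp_all add: power2_eq_square)
  then have s: "F.s = G.s" using i by simp
  have "F.T = k * F.s / 4" "G.T = k' * G.s / 4" unfolding k using F.s_nz G.s_nz by simp_all
  then have T: "F.T = G.T" using i s by simp
  have \<rho>: "F.\<rho> = G.\<rho>" unfolding r using i by simp
  have a: "a = a'" using F.a_eq G.a_eq s \<rho> by simp
  have b: "b = b'" using F.b_eq G.b_eq s T by simp
  have "c = c'" "e = e'" using c i b by simp_all
  then show ?thesis using F.eq G.eq a b unfolding form_eq_def by metis
qed

text \<open>The conditions |u - 1| < 1/100000 and |w| < 1/100000, multiplied by |b|. In this shape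
  they are visibly open in the frame coefficients, and they leave a, hence \<sigma>, free.\<close>

definition near_Sp1 :: "dform set" where
  "near_Sp1 = {\<phi> \<in> pos_inv_3forms G_U1.
     \<bar>frame_coeff \<phi> (1, 3, 5) - frame_coeff \<phi> (0, 3, 4)\<bar> < \<bar>frame_coeff \<phi> (0, 3, 4)\<bar> / 100000 \<and>
     \<bar>frame_coeff \<phi> (1, 3, 6)\<bar> < \<bar>frame_coeff \<phi> (0, 3, 4)\<bar> / 100000}"

lemma pos_inv_3forms_Phi:
  assumes "\<phi> \<in> pos_inv_3forms G_U1"
  shows "pos_form \<phi> (frame_coeff \<phi> (0, 1, 2)) (frame_coeff \<phi> (0, 3, 4)) (frame_coeff \<phi> (1, 3, 5)) (frame_coeff \<phi> (1, 3, 6))"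
  using assms invariant_form_Phi[of \<phi>] unfolding pos_inv_3forms_def pos_form_def frame_coeff_def by simp

lemma near_Sp1_contains: "pos_inv_3forms G_Sp1 \<subseteq> near_Sp1"
proof
  fix \<phi> assume \<phi>: "\<phi> \<in> pos_inv_3forms G_Sp1"
  then have 1: "\<phi> \<in> pos_inv_3forms G_U1"
    using G_U1_subset unfolding pos_inv_3forms_def invariant_form_def by blast
  interpret pos_form \<phi> "frame_coeff \<phi> (0, 1, 2)" "frame_coeff \<phi> (0, 3, 4)" "frame_coeff \<phi> (1, 3, 5)" "frame_coeff \<phi> (1, 3, 6)"
    by (rule pos_inv_3forms_Phi[OF 1])
  have "invariant_form G_Sp1 3 \<phi>" using \<phi> unfolding pos_inv_3forms_def by blast
  note invariant_G_Sp1[OF this eq]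
  then show "\<phi> \<in> near_Sp1" using 1 nz(2) unfolding near_Sp1_def by simp
qed

lemma near_Sp1_open:
  assumes "\<phi> \<in> near_Sp1"
  shows "\<exists>\<epsilon>>0. \<forall>\<psi>\<in>pos_inv_3forms G_U1. form_dist \<phi> \<psi> < \<epsilon> \<longrightarrow> \<psi> \<in> near_Sp1"
proof -
  let ?b = "\<lambda>\<phi>. frame_coeff \<phi> (0, 3, 4)" and ?c = "\<lambda>\<phi>. frame_coeff \<phi> (1, 3, 5)" and ?e = "\<lambda>\<phi>. frame_coeff \<phi> (1, 3, 6)"
  define m where "m = min (\<bar>?b \<phi>\<bar> / 100000 - \<bar>?c \<phi> - ?b \<phi>\<bar>) (\<bar>?b \<phi>\<bar> / 100000 - \<bar>?e \<phi>\<bar>)"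
  have "m > 0" using assms unfolding near_Sp1_def m_def by simp
  \<comment> \<open>A third of the margin suffices: |c - b| moves by less than 2 m / 3, and |b| /
    100000 by far less than m / 3.\<close>
  moreover have "\<psi> \<in> near_Sp1" if \<psi>: "\<psi> \<in> pos_inv_3forms G_U1" and d: "form_dist \<phi> \<psi> < m / 3" for \<psi>
  proof -
    have "\<phi> \<in> pos_inv_3forms G_U1" using assms unfolding near_Sp1_def by blast
    note dist = frame_coeff_dist[OF pos_form.eq[OF pos_inv_3forms_Phi[OF this]] pos_form.eq[OF pos_inv_3forms_Phi[OF \<psi>]]]
    have near: "\<bar>c' - b'\<bar> < \<bar>b'\<bar> / 100000 \<and> \<bar>e'\<bar> < \<bar>b'\<bar> / 100000"
      if "\<bar>b - b'\<bar> < m / 3" "\<bar>c - c'\<bar> < m / 3" "\<bar>e - e'\<bar> < m / 3" "m \<le> \<bar>b\<bar> / 100000 - \<bar>c - b\<bar>" "m \<le> \<bar>b\<bar> / 100000 - \<bar>e\<bar>"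
      for b c e b' c' e' :: real
      using that by linarith
    show ?thesis unfolding near_Sp1_def using \<psi> near[OF le_less_trans[OF dist(1) d] le_less_trans[OF dist(2) d] le_less_trans[OF dist(3) d]]
      by (simp add: m_def)
  qed
  ultimately show ?thesis by (intro exI[of _ "m / 3"]) simp
qed

theorem theorem5p12:
  shows "\<exists>U. pos_inv_3forms G_Sp1 \<subseteq> U \<and> U \<subseteq> pos_inv_3forms G_U1 \<and>
    (\<forall>\<phi>\<in>U. \<exists>\<epsilon>>0. \<forall>\<psi>\<in>pos_inv_3forms G_U1. form_dist \<phi> \<psi> < \<epsilon> \<longrightarrow> \<psi> \<in> U) \<and>
    (\<forall>\<phi>\<in>U. \<forall>\<psi>\<in>U. form_eq 3 (g2_laplacian \<phi>) (g2_laplacian \<psi>) \<longrightarrow> form_eq 3 \<phi> \<psi>)"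
proof (rule exI[of _ near_Sp1], intro conjI ballI impI)
  show "pos_inv_3forms G_Sp1 \<subseteq> near_Sp1" by (rule near_Sp1_contains)
  show "near_Sp1 \<subseteq> pos_inv_3forms G_U1" unfolding near_Sp1_def by blast
  show "\<exists>\<epsilon>>0. \<forall>\<psi>\<in>pos_inv_3forms G_U1. form_dist \<phi> \<psi> < \<epsilon> \<longrightarrow> \<psi> \<in> near_Sp1" if "\<phi> \<in> near_Sp1" for \<phi>
    by (rule near_Sp1_open[OF that])
  show "form_eq 3 \<phi> \<psi>" if "\<phi> \<in> near_Sp1" "\<psi> \<in> near_Sp1" "form_eq 3 (g2_laplacian \<phi>) (g2_laplacian \<psi>)" for \<phi> \<psi>
    using that pos_inv_3forms_Phi unfolding near_Sp1_def by (blast intro: g2_laplacian_inject)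
qed

end
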